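(* Let $m\ge 3$ be an odd integer and $n$ an integer with $2m<n$. Let $f:[0,\infty)\to[0,\infty)$ be continuous with $f(t)=O(t^\lambda)$ as $t\to\infty$ for some constant $\lambda$, and let $u$ be a $C^{2m}$ nonnegative solution of $$0\le -\Delta^m u\le f(u)\quad\text{in } B_2(0)\setminus\{0\}\subset\mathbb{R}^n.$$ (a) If $0\le \lambda\le \frac{2m+n-2}{n-2}$, then $u(x)=O(|x|^{-(n-2)})$ as $x\to 0$. (b) If $\frac{2m+n-2}{n-2}<\lambda<\frac{n}{n-2m}$, then $u(x)=o(|x|^{-a})$ as $x\to0$, where $a=\frac{4m(m-1)}{n-\lambda(n-2m)}$.
   Context: $\Delta^m$ denotes the $m$-fold iterated Laplacian on $\mathbb{R}^n$, and $B_r(0)$ is the open ball of radius $r$ centered at the origin. *)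

theory Defs
  imports "HOL-Analysis.Analysis" "HOL-Library.Landau_Symbols"
begin

definition partial :: "'n::finite \<Rightarrow> (real^'n \<Rightarrow> real) \<Rightarrow> (real^'n \<Rightarrow> real)" where
  "partial i f = (\<lambda>x. deriv (\<lambda>t. f (x + t *\<^sub>R axis i 1)) 0)"

definition laplacian :: "(real^'n::finite \<Rightarrow> real) \<Rightarrow> (real^'n \<Rightarrow> real)" where
  "laplacian f = (\<lambda>x. \<Sum>i\<in>UNIV. partial i (partial i f) x)"

definition iter_laplacian :: "nat \<Rightarrow> (real^'n::finite \<Rightarrow> real) \<Rightarrow> (real^'n \<Rightarrow> real)" where
  "iter_laplacian m f = (laplacian ^^ m) f"

fun Ck_on :: "nat \<Rightarrow> (real^'n::finite) set \<Rightarrow> (real^'n \<Rightarrow> real) \<Rightarrow> bool" where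
  "Ck_on 0 S f = continuous_on S f"
| "Ck_on (Suc k) S f = (continuous_on S f \<and> f differentiable_on S \<and> (\<forall>i. Ck_on k S (partial i f)))"

end

theory Submission
  imports Defs
begin

text \<open>Write g = -Delta^m u, which is (-Delta)^m u because m is odd. Everything is obtained by testing
  against radial functions H(|x - z|^2).

  First, for each small e there is a nonnegative radial H vanishing for |x|^2 < e, comparable to
  |x|^(2m-2) further out, whose m-th iterated Laplacian is nonnegative for |x| < 1 and of size 1/e for
  |x|^2 of order e. Since u and g are nonnegative, integration by parts bounds the integral of
  |x|^(2m-2) g, and shows that the integral of u over the annulus where |x| is of order r is O(r^2).
  In particular the integral of g over that annulus is o(r^(2-2m)).

  Second, testing with the cut-off regularised fundamental solution (|y - x|^2 + d)^(m - n/2), whose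
  m-fold Laplacian is, up to sign, an explicit positive approximate identity, bounds u(x) by the mean of
  u over B(x, r/2), with r = |x|, plus the Riesz potential of g over that ball. Splitting the potential at
  a radius \<open>\<rho>\<close> gives u(x) \<open>\<le>\<close> C (r^(2-n) + \<open>\<rho>\<close>^(2m-n) o(r^(2-2m)) + \<open>\<rho>\<close>^(2m) sup g), and g \<open>\<le>\<close> f(u).
  At a maximum point of u times a power of the distance to the boundary of a ball, sup g is controlled by
  u^lam at the centre, so optimising \<open>\<rho>\<close> closes the estimate, exactly in the range lam < n/(n-2m).\<close>

section \<open>Symbol classes on the half-line\<close>

text \<open>Only the top iterate \<open>iter_laplacian m u\<close> has a sign; nothing is known
  about the intermediate Laplacians, so second-order maximum principles do not apply. Hence all 2m
  derivatives are moved at once onto test functions whose m-th Laplacian is controlled explicitly.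
  In the variable s = |x - z|^2 the Laplacian of a radial function has no singular coefficient at s
  = 0, and compact supports inside the punctured ball leave no boundary terms. The exponents come
  from scaling. If V is the value of u at the maximum point, \<rho> ~ V^(-1/\<gamma>) with \<gamma>
  = 2m/(lam - 1) makes \<rho>^(2m) V^lam a multiple of V. The Riesz term then contains V^\<theta>
  with \<theta> = (n - 2m)/\<gamma>, and \<theta> < 1 means lam < n/(n - 2m). Likewise \<gamma>
  \<le> n - 2 means lam \<ge> (2m + n - 2)/(n - 2), and at equality a = n - 2: part (a) is the
  borderline of the estimate for part (b). The little o comes from the finite total mass of
  |x|^(2m-2) g: shells shrinking to the origin carry arbitrarily little of it.\<close>

text \<open>The class is invariant, with the same B, under replacing f(s) by c^p f(s/c); this makes the estimates
  for the test functions uniform in their scale.\<close>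

fun symbol :: "nat \<Rightarrow> real \<Rightarrow> real \<Rightarrow> real set \<Rightarrow> (real \<Rightarrow> real) \<Rightarrow> bool" where
  "symbol 0 p B T f \<longleftrightarrow> continuous_on T f \<and> (\<forall>s\<in>T. 0 < s \<longrightarrow> \<bar>f s\<bar> \<le> B * s powr p)"
| "symbol (Suc k) p B T f \<longleftrightarrow>
     (\<forall>s\<in>T. f differentiable (at s)) \<and> (\<forall>s\<in>T. 0 < s \<longrightarrow> \<bar>f s\<bar> \<le> B * s powr p) \<and>
     symbol k (p - 1) B T (deriv f)"

lemma symbol_bound: "symbol k p B T f \<Longrightarrow> s \<in> T \<Longrightarrow> 0 < s \<Longrightarrow> \<bar>f s\<bar> \<le> B * s powr p"
  by (cases k) auto

lemma symbol_continuous: "symbol k p B T f \<Longrightarrow> continuous_on T f"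
  by (cases k)
    (auto intro!: continuous_at_imp_continuous_on differentiable_imp_continuous_within)

lemma symbol_DERIV: "symbol (Suc k) p B T f \<Longrightarrow> s \<in> T \<Longrightarrow> DERIV f s :> deriv f s"
  by (simp add: DERIV_deriv_iff_real_differentiable)

lemma DERIV_cong_open:
  fixes f :: "real \<Rightarrow> real"
  assumes "open T" "s \<in> T" "\<And>s. s \<in> T \<Longrightarrow> f s = g s" "DERIV f s :> D"
  shows "DERIV g s :> D"
proof -
  have "eventually (\<lambda>s. f s = g s) (nhds s)"
    using assms(1-3) by (auto simp: eventually_nhds)
  from DERIV_cong_ev[OF refl this refl] show ?thesis using assms(4) by blast
qed

lemma deriv_cong_open:
  fixes f :: "real \<Rightarrow> real"
  assumes "open T" "s \<in> T" "\<And>s. s \<in> T \<Longrightarrow> f s = g s"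
  shows "deriv f s = deriv g s"
  using assms by (intro deriv_cong_ev) (auto simp: eventually_nhds)

lemma symbol_cong:
  assumes "symbol k p B T f" "open T" "\<And>s. s \<in> T \<Longrightarrow> f s = g s"
  shows "symbol k p B T g"
  using assms
proof (induction k arbitrary: p f g)
  case 0
  then show ?case by (auto cong: continuous_on_cong)
next
  case (Suc k)
  have "DERIV g s :> deriv f s" if "s \<in> T" for s
    using DERIV_cong_open[OF Suc.prems(2) that Suc.prems(3) symbol_DERIV[OF Suc.prems(1) that]]
    by simp
  moreover have "symbol k (p - 1) B T (deriv g)"
  proof (rule Suc.IH[OF _ Suc.prems(2)])
    show "symbol k (p - 1) B T (deriv f)" using Suc.prems(1) by simp
    show "deriv f s = deriv g s" if "s \<in> T" for s
      using deriv_cong_open[OF Suc.prems(2) that Suc.prems(3)] .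
  qed
  moreover have "\<bar>g s\<bar> \<le> B * s powr p" if "s \<in> T" "0 < s" for s
    using symbol_bound[OF Suc.prems(1) that] Suc.prems(3)[OF that(1)] by simp
  ultimately show ?case
    by (auto simp: real_differentiable_def)
qed

lemma symbol_SucI:
  assumes "open T" "\<And>s. s \<in> T \<Longrightarrow> DERIV f s :> f' s"
    "\<And>s. s \<in> T \<Longrightarrow> 0 < s \<Longrightarrow> \<bar>f s\<bar> \<le> B * s powr p" "symbol k (p - 1) B T f'"
  shows "symbol (Suc k) p B T f"
proof -
  have "symbol k (p - 1) B T (deriv f)"
    by (rule symbol_cong[OF assms(4,1)]) (use assms(2) DERIV_imp_deriv in force)
  then show ?thesis using assms by (auto simp: real_differentiable_def)
qed

lemma symbol_SucD: "symbol (Suc k) p B T f \<Longrightarrow> symbol k p B T f"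
proof (induction k arbitrary: p f)
  case 0
  then show ?case using symbol_continuous[OF 0] by auto
next
  case (Suc k)
  then show ?case by auto
qed

lemma symbol_le: "symbol k p B T f \<Longrightarrow> j \<le> k \<Longrightarrow> symbol j p B T f"
  by (induction k) (auto simp del: symbol.simps dest: symbol_SucD simp: le_Suc_eq)

lemma symbol_mono:
  assumes "symbol k p B T f" "B \<le> B'" "T' \<subseteq> T"
  shows "symbol k p B' T' f"
  using assms(1)
proof (induction k arbitrary: p f)
  case 0
  have "\<bar>f s\<bar> \<le> B' * s powr p" if "s \<in> T'" "0 < s" for s
    by (rule order_trans[OF symbol_bound[OF 0] mult_right_mono[OF assms(2)]]) (use that assms(3) in auto)
  then show ?case using 0 assms continuous_on_subset[of T f T'] by auto
next
  case (Suc k)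
  have "\<bar>f s\<bar> \<le> B' * s powr p" if "s \<in> T'" "0 < s" for s
    by (rule order_trans[OF symbol_bound[OF Suc.prems] mult_right_mono[OF assms(2)]])
      (use that assms(3) in auto)
  then show ?case using Suc assms by auto
qed

lemma symbol_Un:
  assumes "symbol k p B T f" "symbol k p B T' f" "open T" "open T'"
  shows "symbol k p B (T \<union> T') f"
  using assms(1,2)
proof (induction k arbitrary: p f)
  case 0
  then show ?case using assms continuous_on_open_Un[of T T' f] by auto
next
  case (Suc k)
  then show ?case by auto
qed

lemma symbol_add:
  assumes "open T" "symbol k p B T f" "symbol k p B' T g"
  shows "symbol k p (B + B') T (\<lambda>s. f s + g s)"
  using assms(2,3)
proof (induction k arbitrary: p f g)
  case 0
  then show ?case
    using symbol_bound[OF 0(1)] symbol_bound[OF 0(2)]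
    by (auto intro!: continuous_on_add order_trans[OF abs_triangle_ineq] add_mono simp: distrib_right)
next
  case (Suc k)
  show ?case
  proof (rule symbol_SucI[OF assms(1), where f' = "\<lambda>s. deriv f s + deriv g s"])
    show "DERIV (\<lambda>s. f s + g s) s :> deriv f s + deriv g s" if "s \<in> T" for s
      using that Suc.prems by (intro DERIV_add symbol_DERIV)
    show "\<bar>f s + g s\<bar> \<le> (B + B') * s powr p" if "s \<in> T" "0 < s" for s
      using symbol_bound[OF Suc.prems(1) that] symbol_bound[OF Suc.prems(2) that]
      by (auto simp: algebra_simps)
    show "symbol k (p - 1) (B + B') T (\<lambda>s. deriv f s + deriv g s)"
      using Suc by auto
  qed
qed

text \<open>Leibniz rule: each differentiation splits a product into two products of the same kind,
  which doubles the constant and gives \<open>2 ^ k\<close>.\<close>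

lemma symbol_mult:
  assumes "open T" "0 \<le> B" "0 \<le> B'" "symbol k p B T f" "symbol k q B' T g"
  shows "symbol k (p + q) (2 ^ k * (B * B')) T (\<lambda>s. f s * g s)"
  using assms(4,5)
proof (induction k arbitrary: p q f g)
  case 0
  have "\<bar>f s * g s\<bar> \<le> B * B' * s powr (p + q)" if "s \<in> T" "0 < s" for s
    using mult_mono[OF symbol_bound[OF 0(1) that] symbol_bound[OF 0(2) that]] assms(2,3)
    by (simp add: abs_mult powr_add mult_ac)
  then show ?case using 0 by (auto intro!: continuous_intros)
next
  case (Suc k)
  show ?case
  proof (rule symbol_SucI[OF assms(1), where f' = "\<lambda>s. deriv f s * g s + f s * deriv g s"])
    show "DERIV (\<lambda>s. f s * g s) s :> deriv f s * g s + f s * deriv g s" if "s \<in> T" for s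
      using DERIV_mult[OF symbol_DERIV[OF Suc.prems(1) that] symbol_DERIV[OF Suc.prems(2) that]]
      by (simp add: mult_ac)
    show "\<bar>f s * g s\<bar> \<le> 2 ^ Suc k * (B * B') * s powr (p + q)" if "s \<in> T" "0 < s" for s
    proof -
      have "\<bar>f s * g s\<bar> \<le> 1 * (B * B' * s powr (p + q))"
        using mult_mono[OF symbol_bound[OF Suc.prems(1) that] symbol_bound[OF Suc.prems(2) that]]
          assms(2,3) by (simp add: abs_mult powr_add mult_ac)
      also have "\<dots> \<le> 2 ^ Suc k * (B * B' * s powr (p + q))"
        by (intro mult_right_mono) (use assms(2,3) one_le_power[of "2::real" "Suc k"] in auto)
      finally show ?thesis by (simp add: mult_ac)
    qed
    have f: "symbol k p B T f" "symbol k (p - 1) B T (deriv f)"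
      using Suc.prems(1) symbol_SucD[OF Suc.prems(1)] by auto
    have g: "symbol k q B' T g" "symbol k (q - 1) B' T (deriv g)"
      using Suc.prems(2) symbol_SucD[OF Suc.prems(2)] by auto
    have "symbol k (p + q - 1) (2 ^ k * (B * B')) T (\<lambda>s. deriv f s * g s)"
      using Suc.IH[OF f(2) g(1)] by (simp add: algebra_simps)
    moreover have "symbol k (p + q - 1) (2 ^ k * (B * B')) T (\<lambda>s. f s * deriv g s)"
      using Suc.IH[OF f(1) g(2)] by (simp add: algebra_simps)
    ultimately have "symbol k (p + q - 1) (2 ^ k * (B * B') + 2 ^ k * (B * B')) T
        (\<lambda>s. deriv f s * g s + f s * deriv g s)"
      by (rule symbol_add[OF assms(1)])
    moreover have "2 ^ k * (B * B') + 2 ^ k * (B * B') = 2 ^ Suc k * (B * B')"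
      by simp
    ultimately show "symbol k (p + q - 1) (2 ^ Suc k * (B * B')) T
        (\<lambda>s. deriv f s * g s + f s * deriv g s)"
      by metis
  qed
qed

lemma symbol_zero: "0 \<le> B \<Longrightarrow> open T \<Longrightarrow> symbol k p B T (\<lambda>_. 0)"
  by (induction k arbitrary: p) (auto simp: mult_nonneg_nonneg)

lemma symbol_const: "open T \<Longrightarrow> symbol k 0 \<bar>c\<bar> T (\<lambda>_. c)"
  by (cases k) (auto simp: symbol_zero)

lemma symbol_cmult:
  assumes "symbol k p B T f" "open T"
  shows "symbol k p (\<bar>c\<bar> * B) T (\<lambda>s. c * f s)"
  using assms(1)
proof (induction k arbitrary: p f)
  case 0
  then show ?case
    by (auto intro!: continuous_on_mult_left simp: abs_mult mult.assoc mult_left_mono)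
next
  case (Suc k)
  show ?case
  proof (rule symbol_SucI[where f' = "\<lambda>s. c * deriv f s"])
    show "\<bar>c * f s\<bar> \<le> \<bar>c\<bar> * B * s powr p" if "s \<in> T" "0 < s" for s
      using symbol_bound[OF Suc.prems that] by (simp add: abs_mult mult.assoc mult_left_mono)
    show "symbol k (p - 1) (\<bar>c\<bar> * B) T (\<lambda>s. c * deriv f s)"
      using Suc by auto
  qed (use assms DERIV_cmult[OF symbol_DERIV[OF Suc.prems]] in auto)
qed

lemma symbol_id: "open T \<Longrightarrow> symbol k 1 1 T (\<lambda>s. s)"
  using symbol_const[of T _ 1] by (cases k) auto

text \<open>The constant is uniform in the shift because p \<le> 0 gives (s + c)^p \<le> s^p. For c
  > 0 the domain contains 0, so the regularised kernel is differentiable there and still obeys the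
  bounds of the singular one.\<close>

lemma symbol_powr_shift:
  "p \<le> 0 \<Longrightarrow> \<exists>B\<ge>0. \<forall>c\<ge>0. symbol k p B {- c<..} (\<lambda>s. (s + c) powr p)"
proof (induction k arbitrary: p)
  case 0
  then show ?case
    by (intro exI[of _ 1]) (auto intro!: continuous_intros powr_mono2')
next
  case (Suc k)
  from Suc.IH[of "p - 1"] Suc.prems obtain B where
    B: "B \<ge> 0" "\<And>c. c \<ge> 0 \<Longrightarrow> symbol k (p - 1) B {- c<..} (\<lambda>s. (s + c) powr (p - 1))" by auto
  have "symbol (Suc k) p (1 + \<bar>p\<bar> * B) {- c<..} (\<lambda>s. (s + c) powr p)" if "c \<ge> 0" for c
  proof (rule symbol_SucI[where f' = "\<lambda>s. p * (s + c) powr (p - 1)"])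
    show "\<bar>(s + c) powr p\<bar> \<le> (1 + \<bar>p\<bar> * B) * s powr p" if "0 < s" for s
    proof -
      have "(s + c) powr p \<le> 1 * s powr p" using that Suc.prems \<open>c \<ge> 0\<close> by (auto intro: powr_mono2')
      also have "\<dots> \<le> (1 + \<bar>p\<bar> * B) * s powr p" by (intro mult_right_mono) (use B in auto)
      finally show ?thesis by simp
    qed
    show "symbol k (p - 1) (1 + \<bar>p\<bar> * B) {- c<..} (\<lambda>s. p * (s + c) powr (p - 1))"
      by (rule symbol_mono[OF symbol_cmult[OF B(2)[OF that]]]) auto
  qed (auto intro!: derivative_eq_intros)
  then show ?case using B(1) by (intro exI[of _ "1 + \<bar>p\<bar> * B"]) auto
qed

lemma symbol_powr: "\<exists>B\<ge>0. symbol k p B {0<..} (\<lambda>s. s powr p)"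
proof (induction k arbitrary: p)
  case 0
  then show ?case
    by (intro exI[of _ 1]) (auto intro!: continuous_intros)
next
  case (Suc k)
  from Suc.IH[of "p - 1"] obtain B where
    B: "B \<ge> 0" "symbol k (p - 1) B {0<..} (\<lambda>s. s powr (p - 1))" by auto
  have "symbol (Suc k) p (1 + \<bar>p\<bar> * B) {0<..} (\<lambda>s. s powr p)"
  proof (rule symbol_SucI[where f' = "\<lambda>s. p * s powr (p - 1)"])
    show "\<bar>s powr p\<bar> \<le> (1 + \<bar>p\<bar> * B) * s powr p" if "0 < s" for s
      using that B(1) by (simp add: algebra_simps)
    show "symbol k (p - 1) (1 + \<bar>p\<bar> * B) {0<..} (\<lambda>s. p * s powr (p - 1))"
      by (rule symbol_mono[OF symbol_cmult[OF B(2)]]) auto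
  qed (auto intro!: derivative_eq_intros)
  then show ?case using B(1) by (intro exI[of _ "1 + \<bar>p\<bar> * B"]) auto
qed

lemma open_scaled: "c > 0 \<Longrightarrow> open T \<Longrightarrow> open {s::real. s / c \<in> T}"
  using continuous_open_vimage[of T "\<lambda>s. s / c"] by (auto simp: vimage_def intro!: continuous_intros)

text \<open>Every derivative of f(s/c) brings a factor 1/c, which turns \<open>c powr p\<close> into
  \<open>c powr (p - 1)\<close>, exactly the drop of the order. So B survives the dilation.\<close>

lemma symbol_scale:
  assumes "c > 0" "open T" "symbol k p B T f"
  shows "symbol k p B {s. s / c \<in> T} (\<lambda>s. c powr p * f (s / c))"
  using assms(3)
proof (induction k arbitrary: p f)
  case 0
  have "\<bar>c powr p * f (s / c)\<bar> \<le> B * s powr p" if "s / c \<in> T" "0 < s" for s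
    using mult_left_mono[OF symbol_bound[OF 0 that(1)], of "c powr p"] that assms(1)
    by (simp add: abs_mult powr_divide)
  moreover have "continuous_on {s. s / c \<in> T} (\<lambda>s. c powr p * f (s / c))"
    by (intro continuous_intros continuous_on_compose2[OF symbol_continuous[OF 0]])
      (use assms(1) in auto)
  ultimately show ?case by auto
next
  case (Suc k)
  show ?case
  proof (rule symbol_SucI[OF open_scaled[OF assms(1,2)], where f' = "\<lambda>s. c powr (p - 1) * deriv f (s / c)"])
    show "DERIV (\<lambda>s. c powr p * f (s / c)) s :> c powr (p - 1) * deriv f (s / c)"
      if "s \<in> {s. s / c \<in> T}" for s
    proof -
      have "DERIV (\<lambda>s. f (s / c)) s :> deriv f (s / c) * (1 / c)"
        by (rule DERIV_chain2[OF symbol_DERIV[OF Suc.prems]]) (use that assms(1) in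
            \<open>auto intro!: derivative_eq_intros\<close>)
      from DERIV_cmult[OF this, of "c powr p"] show ?thesis
        using assms(1) by (simp add: powr_diff mult_ac)
    qed
    show "\<bar>c powr p * f (s / c)\<bar> \<le> B * s powr p" if "s \<in> {s. s / c \<in> T}" "0 < s" for s
      using mult_left_mono[OF symbol_bound[OF Suc.prems, of "s / c"], of "c powr p"] that assms(1)
      by (simp add: abs_mult powr_divide)
    show "symbol k (p - 1) B {s. s / c \<in> T} (\<lambda>s. c powr (p - 1) * deriv f (s / c))"
      using Suc by auto
  qed
qed

text \<open>The n-dimensional Laplacian of a radial function, written in the variable s = |x|^2.\<close>

definition Lop :: "real \<Rightarrow> (real \<Rightarrow> real) \<Rightarrow> real \<Rightarrow> real" where
  "Lop n f = (\<lambda>s. 4 * (s * deriv (deriv f) s) + 2 * n * deriv f s)"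

lemma Lop_cong:
  assumes "open T" "\<And>s. s \<in> T \<Longrightarrow> f s = g s" "s \<in> T"
  shows "Lop n f s = Lop n g s"
proof -
  have "deriv f s = deriv g s" if "s \<in> T" for s using deriv_cong_open[OF assms(1) that assms(2)] .
  then show ?thesis
    using deriv_cong_open[OF assms(1,3), of "deriv f" "deriv g"] assms(3) by (simp add: Lop_def)
qed

lemma Lop_funpow_cong:
  assumes "open T" "\<And>s. s \<in> T \<Longrightarrow> f s = g s" "s \<in> T"
  shows "(Lop n ^^ i) f s = (Lop n ^^ i) g s"
  using assms(3)
proof (induction i arbitrary: s)
  case (Suc i)
  then show ?case using Lop_cong[OF assms(1) Suc.IH] by simp
qed (use assms in auto)

lemma symbol_Lop:
  assumes "open T" "0 \<le> B" "symbol (k + 2) p B T f"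
  shows "symbol k (p - 1) ((4 * 2 ^ k + \<bar>2 * n\<bar>) * B) T (Lop n f)"
proof -
  have 1: "symbol (Suc k) (p - 1) B T (deriv f)" and 2: "symbol k (p - 1 - 1) B T (deriv (deriv f))"
    using assms(3) by (auto simp: numeral_2_eq_2)
  have "symbol k (1 + (p - 1 - 1)) (2 ^ k * (1 * B)) T (\<lambda>s. s * deriv (deriv f) s)"
    by (intro symbol_mult symbol_id assms 2) auto
  then have "symbol k (p - 1) (\<bar>4\<bar> * (2 ^ k * B)) T (\<lambda>s. 4 * (s * deriv (deriv f) s))"
    by (intro symbol_cmult assms) simp
  moreover have "symbol k (p - 1) (\<bar>2 * n\<bar> * B) T (\<lambda>s. 2 * n * deriv f s)"
    by (rule symbol_cmult[OF symbol_SucD[OF 1] assms(1)])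
  ultimately have "symbol k (p - 1) (\<bar>4\<bar> * (2 ^ k * B) + \<bar>2 * n\<bar> * B) T (Lop n f)"
    unfolding Lop_def by (rule symbol_add[OF assms(1)])
  then show ?thesis
    by (simp add: distrib_right mult.assoc)
qed

text \<open>Each \<open>Lop\<close> costs two derivatives, but its factor s restores one order, so
  the order drops by 1 and not by 2. The quantifiers matter: C depends on k, m and n only, which
  makes the later bounds independent of scale and regularisation.\<close>

lemma symbol_Lop_funpow:
  "\<exists>C\<ge>0. \<forall>p B T f. open T \<longrightarrow> 0 \<le> B \<longrightarrow> symbol (k + 2 * m) p B T f \<longrightarrow>
     symbol k (p - real m) (C * B) T ((Lop n ^^ m) f)"
proof (induction m arbitrary: k)
  case 0
  then show ?case by (intro exI[of _ 1]) auto
next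
  case (Suc m)
  from Suc.IH[of "k + 2"] obtain C where C: "C \<ge> 0" "\<And>p B T f. open T \<Longrightarrow> 0 \<le> B \<Longrightarrow>
     symbol (k + 2 + 2 * m) p B T f \<Longrightarrow> symbol (k + 2) (p - real m) (C * B) T ((Lop n ^^ m) f)"
    by blast
  show ?case
  proof (intro exI[of _ "(4 * 2 ^ k + \<bar>2 * n\<bar>) * C"] conjI allI impI)
    fix p B T f
    assume *: "open T" "(0::real) \<le> B" "symbol (k + 2 * Suc m) p B T f"
    have "symbol (k + 2) (p - real m) (C * B) T ((Lop n ^^ m) f)"
      by (rule C(2)[OF *(1,2)]) (use *(3) in \<open>simp add: add.commute\<close>)
    from symbol_Lop[OF *(1) _ this, of n] C(1) *(2)
    show "symbol k (p - real (Suc m)) ((4 * 2 ^ k + \<bar>2 * n\<bar>) * C * B) T ((Lop n ^^ Suc m) f)"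
      by (simp add: mult.assoc diff_diff_eq add.commute)
  qed (use C in auto)
qed

section \<open>Primitives and cut-off functions\<close>

text \<open>All integrands used here vanish for s \<le> 1, so the lower limit 0 stands for any point
  up to 1; for negative s the interval is empty and the value 0 is the right one.\<close>

definition prim :: "(real \<Rightarrow> real) \<Rightarrow> real \<Rightarrow> real" where
  "prim f s = integral {0..s} f"

lemma prim_eq_0: "\<forall>x\<le>a. f x = 0 \<Longrightarrow> s \<le> a \<Longrightarrow> prim f s = 0"
  unfolding prim_def by (subst Henstock_Kurzweil_Integration.integral_cong[where g = "\<lambda>_. 0"]) auto

lemma prim_DERIV:
  assumes "continuous_on UNIV f" "\<forall>s\<le>1. f s = 0"
  shows "DERIV (prim f) s :> f s"
proof (cases "s < 1")
  case True
  have "DERIV (\<lambda>_. 0) s :> f s" using True assms(2) by simp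
  then show ?thesis
    by (rule DERIV_cong_open[where T = "{..<1}", rotated 3]) (use True prim_eq_0[OF assms(2)] in auto)
next
  case False
  have "((\<lambda>x. integral {0..x} f) has_real_derivative f s) (at s within {0..s + 1})"
    using False assms(1) by (intro integral_has_real_derivative) (auto intro: continuous_on_subset)
  moreover have "at s within {0..s + 1} = at s"
    using False by (intro at_within_interior) auto
  ultimately show ?thesis unfolding prim_def[abs_def] by simp
qed

lemma prim_mono:
  assumes "continuous_on UNIV f" "\<forall>s\<le>1. f s = 0" "\<And>s. 0 \<le> f s" "s \<le> t"
  shows "prim f s \<le> prim f t"
  by (rule DERIV_nonneg_imp_nondecreasing[OF assms(4)])
    (intro exI conjI, rule prim_DERIV[OF assms(1,2)], rule assms(3))

lemma prim_nonneg:
  assumes "continuous_on UNIV f" "\<forall>s\<le>1. f s = 0" "\<And>s. 0 \<le> f s"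
  shows "0 \<le> prim f s"
  using prim_mono[OF assms(1,2), of "min s 1" s] prim_eq_0[OF assms(2), of "min s 1"] assms(3) by simp

text \<open>On s \<ge> 1 a larger exponent is a weaker bound, and below 1 the function and its
  derivatives vanish.\<close>

lemma symbol_weaken:
  assumes "symbol k q B UNIV f" "\<And>s. s < 1 \<Longrightarrow> f s = 0" "q \<le> q'" "0 \<le> B"
  shows "symbol k q' B UNIV f"
  using assms(1-3)
proof (induction k arbitrary: q q' f)
  case 0
  have "\<bar>f s\<bar> \<le> B * s powr q'" if "s > 0" for s
  proof (cases "s < 1")
    case False
    have "\<bar>f s\<bar> \<le> B * s powr q" using 0(1) that by auto
    also have "\<dots> \<le> B * s powr q'" using False 0(3) assms(4) by (intro mult_left_mono powr_mono) auto
    finally show ?thesis .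
  qed (use 0 assms(4) in auto)
  then show ?case using 0(1) by auto
next
  case (Suc k)
  have "\<bar>f s\<bar> \<le> B * s powr q'" if "s > 0" for s
  proof (cases "s < 1")
    case False
    have "\<bar>f s\<bar> \<le> B * s powr q" using Suc.prems(1) that by auto
    also have "\<dots> \<le> B * s powr q'"
      using False Suc.prems(3) assms(4) by (intro mult_left_mono powr_mono) auto
    finally show ?thesis .
  qed (use Suc.prems assms(4) in auto)
  moreover have "symbol k (q' - 1) B UNIV (deriv f)"
  proof (rule Suc.IH)
    show "symbol k (q - 1) B UNIV (deriv f)" using Suc.prems(1) by simp
    show "deriv f s = 0" if "s < 1" for s
      using deriv_cong_open[of "{..<1}" s f "\<lambda>_. 0"] that Suc.prems(2) by auto
    show "q - 1 \<le> q' - 1" using Suc.prems(3) by simp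
  qed
  ultimately show ?case using Suc.prems(1) by auto
qed

text \<open>Removes the apparent singularity of \<open>powr\<close> at 0: the open sets s > 0 and s
  < 1 cover the line, and differentiability is local on each.\<close>

lemma symbol_glue_zero:
  assumes "symbol k p B {0<..} f" "\<And>s. s < 1 \<Longrightarrow> f s = 0" "0 \<le> B"
  shows "symbol k p B UNIV f"
proof -
  have "symbol k p B {..<1} f"
    by (rule symbol_cong[OF symbol_zero]) (use assms in auto)
  then have "symbol k p B ({0<..} \<union> {..<1}) f" by (intro symbol_Un assms) auto
  moreover have "{0<..} \<union> {..<1} = (UNIV :: real set)" by auto
  ultimately show ?thesis by simp
qed

lemma symbol_powr_mult:
  assumes "symbol k p B UNIV f" "\<forall>s\<le>1. f s = 0" "0 \<le> B"
  shows "\<exists>B'\<ge>0. symbol k (q + p) B' UNIV (\<lambda>s. s powr q * f s)"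
proof -
  obtain C where C: "C \<ge> 0" "symbol k q C {0<..} (\<lambda>s. s powr q)" using symbol_powr by blast
  have "symbol k (q + p) (2 ^ k * (C * B)) {0<..} (\<lambda>s. s powr q * f s)"
    by (intro symbol_mult C assms symbol_mono[OF assms(1)]) auto
  then have "symbol k (q + p) (2 ^ k * (C * B)) UNIV (\<lambda>s. s powr q * f s)"
    by (rule symbol_glue_zero) (use assms C in auto)
  then show ?thesis using C assms(3) by (intro exI[of _ "2 ^ k * (C * B)"]) auto
qed

text \<open>For q > -1 the primitive grows like s^(q+1); for q < -1 the integral converges, in
  general to a nonzero constant, hence the \<open>max\<close> with 0. Excluding q = -1 excludes a
  logarithm.\<close>

lemma symbol_prim:
  assumes f: "symbol k q B UNIV f" "\<forall>s\<le>1. f s = 0" and "q \<noteq> -1" "0 \<le> B"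
  shows "\<exists>B'\<ge>0. symbol (Suc k) (max (q + 1) 0) B' UNIV (prim f)"
proof -
  define r where "r = q + 1"
  have r: "r \<noteq> 0" using assms(3) by (simp add: r_def)
  define C where "C = B / \<bar>r\<bar>"
  have cont: "continuous_on UNIV f" using symbol_continuous[OF f(1)] .
  have bd: "\<bar>prim f s\<bar> \<le> C * s powr max r 0" if "s > 0" for s
  proof (cases "s \<le> 1")
    case False
    \<comment> \<open>P is a primitive of the bound B x^q, so P - \<open>prim f\<close> and P +
      \<open>prim f\<close> both increase; this bounds |\<open>prim f s\<close>| by P s - P
      1.\<close>
    define P where "P = (\<lambda>x. B / r * x powr r)"
    have P: "DERIV P x :> B * x powr q" if "x > 0" for x
      unfolding P_def using that r by (auto intro!: derivative_eq_intros simp: r_def)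
    have *: "\<bar>f x\<bar> \<le> B * x powr q" if "x > 0" for x using symbol_bound[OF f(1)] that by auto
    have "P 1 - prim f 1 \<le> P s - prim f s"
    proof (rule DERIV_nonneg_imp_nondecreasing[where f = "\<lambda>x. P x - prim f x"])
      show "\<exists>y. DERIV (\<lambda>x. P x - prim f x) x :> y \<and> 0 \<le> y" if "1 \<le> x" "x \<le> s" for x
        using that *[of x] by (intro exI[of _ "B * x powr q - f x"] conjI
          DERIV_diff P prim_DERIV cont f) auto
    qed (use False in auto)
    moreover have "P 1 + prim f 1 \<le> P s + prim f s"
    proof (rule DERIV_nonneg_imp_nondecreasing[where f = "\<lambda>x. P x + prim f x"])
      show "\<exists>y. DERIV (\<lambda>x. P x + prim f x) x :> y \<and> 0 \<le> y" if "1 \<le> x" "x \<le> s" for x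
        using that *[of x] by (intro exI[of _ "B * x powr q + f x"] conjI
          DERIV_add P prim_DERIV cont f) auto
    qed (use False in auto)
    moreover have "prim f 1 = 0" using prim_eq_0[OF f(2)] by simp
    ultimately have 1: "\<bar>prim f s\<bar> \<le> P s - P 1" by linarith
    have "P s - P 1 \<le> C * s powr max r 0"
    proof (cases "r > 0")
      case True
      then show ?thesis using assms(4) by (simp add: P_def C_def)
    next
      case False
      have "P s - P 1 = C - C * s powr r" using False r by (simp add: P_def C_def field_simps)
      also have "\<dots> \<le> C" using assms(4) by (simp add: C_def)
      finally show ?thesis using False \<open>s > 0\<close> by (simp add: max_def)
    qed
    with 1 show ?thesis by linarith
  qed (use prim_eq_0[OF f(2)] assms in \<open>auto simp: C_def\<close>)
  have "symbol (Suc k) (max r 0) (C + B) UNIV (prim f)"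
  proof (rule symbol_SucI[where f' = f])
    show "\<bar>prim f s\<bar> \<le> (C + B) * s powr max r 0" if "0 < s" for s
      using bd[OF that] assms(4) by (simp add: distrib_right add_increasing2)
    have "symbol k (max r 0 - 1) B UNIV f"
      by (rule symbol_weaken[OF f(1)]) (use f assms in \<open>auto simp: r_def\<close>)
    then show "symbol k (max r 0 - 1) (C + B) UNIV f"
      by (rule symbol_mono) (use assms in \<open>auto simp: C_def\<close>)
  qed (use prim_DERIV[OF cont f(2)] in auto)
  then show ?thesis using assms(4) by (intro exI[of _ "C + B"]) (auto simp: r_def C_def)
qed

text \<open>Smoothness is gained one order at a time by averaging with respect to ds/s, which preserves the
  symbol class.\<close>

lemma step_exists:
  "1 \<le> a \<Longrightarrow> a < b \<Longrightarrow> \<exists>\<sigma> B. 0 \<le> B \<and> symbol k 0 B UNIV \<sigma> \<and> (\<forall>s\<le>a. \<sigma> s = 0) \<and>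
     (\<forall>s\<ge>b. \<sigma> s = 1) \<and> (\<forall>s. 0 \<le> \<sigma> s \<and> \<sigma> s \<le> 1)"
proof (induction k arbitrary: a b)
  case 0
  have "continuous_on UNIV (\<lambda>s. max 0 (min 1 ((s - a) / (b - a))))"
    by (intro continuous_intros) (use 0 in auto)
  then show ?case
    by (intro exI[of _ "\<lambda>s. max 0 (min 1 ((s - a) / (b - a)))"] exI[of _ 1])
      (use 0 in \<open>auto simp: field_simps\<close>)
next
  case (Suc k)
  \<comment> \<open>The transition zone is halved geometrically: the given step rises on [a, b/d],
    and averaging over [s/d, s] stretches this to [a, b].\<close>
  define d where "d = sqrt (b / a)"
  have d: "d > 1" using Suc.prems by (simp add: d_def)
  have dd: "d * d = b / a" using Suc.prems by (simp add: d_def)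
  have abd: "a < b / d" "b / d < b"
  proof -
    have "a * (d * 1) < a * (d * d)" using d Suc.prems by (intro mult_strict_left_mono) auto
    also have "\<dots> = b" using Suc.prems by (simp add: dd)
    finally show "a < b / d" using d by (simp add: field_simps)
    show "b / d < b" using d Suc.prems by (simp add: field_simps)
  qed
  obtain \<sigma> B where s: "0 \<le> B" "symbol k 0 B UNIV \<sigma>" "\<And>s. s \<le> a \<Longrightarrow> \<sigma> s = 0"
    "\<And>s. s \<ge> b / d \<Longrightarrow> \<sigma> s = 1" "\<And>s. 0 \<le> \<sigma> s \<and> \<sigma> s \<le> 1"
    using Suc.IH[OF Suc.prems(1) abd(1)] by blast
  have s1: "\<forall>s\<le>1. \<sigma> s = 0" using s(3) Suc.prems by auto
  define g where "g = (\<lambda>s. s powr (-1) * \<sigma> s)"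
  obtain B1 where B1: "B1 \<ge> 0" "symbol k (-1) B1 UNIV g"
    using symbol_powr_mult[OF s(2) s1 s(1), of "-1"] unfolding g_def by auto
  have g0: "\<forall>s\<le>1. g s = 0" using s1 by (simp add: g_def)
  have cont: "continuous_on UNIV g" using symbol_continuous[OF B1(2)] .
  note D = prim_DERIV[OF cont g0]
  \<comment> \<open>The average of \<sigma> over [s/d, s] with respect to ds/s; that interval has
    total mass ln d.\<close>
  define \<tau> where "\<tau> = (\<lambda>s. (prim g s - prim g (s / d)) / ln d)"
  have lnd: "ln d > 0" using d by simp
  have gnn: "0 \<le> g s" for s using s(5)[of s] by (simp add: g_def)
  \<comment> \<open>Since \<sigma> \<le> 1, the integrand g is at most 1/z, which gives \<tau> \<le>
    1. Beyond b/d equality holds, which gives \<tau> = 1 from b on.\<close>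
  have mono: "ln x - prim g x \<le> ln y - prim g y" if "0 < x" "x \<le> y" for x y
  proof (rule DERIV_nonneg_imp_nondecreasing[where f = "\<lambda>x. ln x - prim g x", OF that(2)])
    fix z assume "x \<le> z" "z \<le> y"
    then have z: "z > 0" using that by simp
    then have "DERIV (\<lambda>x. ln x - prim g x) z :> 1 / z - g z"
      by (auto intro!: derivative_eq_intros D simp: field_simps)
    moreover have "g z \<le> 1 / z" using s(5)[of z] z
      by (simp add: g_def powr_minus field_simps)
    ultimately show "\<exists>w. DERIV (\<lambda>x. ln x - prim g x) z :> w \<and> 0 \<le> w"
      by (intro exI[of _ "1 / z - g z"]) simp
  qed
  have mono': "ln x - prim g x \<ge> ln y - prim g y" if "b / d \<le> x" "x \<le> y" for x y
  proof (rule DERIV_nonpos_imp_nonincreasing[where f = "\<lambda>x. ln x - prim g x", OF that(2)])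
    fix z assume "x \<le> z" "z \<le> y"
    then have z: "z > 0" "\<sigma> z = 1" using that abd Suc.prems s(4) by auto
    then have "DERIV (\<lambda>x. ln x - prim g x) z :> 1 / z - g z"
      by (auto intro!: derivative_eq_intros D simp: field_simps)
    moreover have "g z = 1 / z" using z
      by (simp add: g_def powr_minus field_simps)
    ultimately show "\<exists>w. DERIV (\<lambda>x. ln x - prim g x) z :> w \<and> w \<le> 0"
      by (intro exI[of _ "1 / z - g z"]) simp
  qed
  have t0: "\<tau> s = 0" if "s \<le> a" for s
  proof -
    have "prim g x = 0" if "x \<le> a" for x
      by (rule prim_eq_0[OF _ that]) (use s(3) in \<open>simp add: g_def\<close>)
    moreover have "s / d \<le> a" 
    proof (cases "s \<ge> 0")
      case True
      then have "s / d \<le> s / 1" using d by (intro divide_left_mono) auto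
      then show ?thesis using that by simp
    next
      case False
      then have "s / d \<le> 0" using d by (simp add: divide_nonpos_pos)
      then show ?thesis using Suc.prems by linarith
    qed
    ultimately show ?thesis using that by (simp add: \<tau>_def)
  qed
  have t01: "0 \<le> \<tau> s \<and> \<tau> s \<le> 1" for s
  proof (cases "s \<le> a")
    case False
    then have sp: "s > 0" using Suc.prems by auto
    then have sd: "s / d \<le> s" "s / d > 0" using d by (auto simp: field_simps)
    have "prim g (s / d) \<le> prim g s" using prim_mono[OF cont g0 gnn sd(1)] .
    moreover have "prim g s - prim g (s / d) \<le> ln d"
      using mono[OF sd(2,1)] sp d by (simp add: ln_div)
    ultimately show ?thesis using lnd by (simp add: \<tau>_def)
  qed (use t0 in auto)
  have t1: "\<tau> s = 1" if "s \<ge> b" for s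
  proof -
    have sp: "s > 0" using that Suc.prems by auto
    then have sd: "s / d \<le> s" "s / d > 0" "b / d \<le> s / d" using d that by (auto simp: field_simps)
    have "prim g s - prim g (s / d) \<ge> ln d"
      using mono'[OF sd(3,1)] sp d by (simp add: ln_div)
    then have "\<tau> s \<ge> 1" using lnd by (simp add: \<tau>_def field_simps)
    with t01[of s] show ?thesis by simp
  qed
  define B2 where "B2 = 1 + \<bar>1 / ln d\<bar> * (B1 + \<bar>- 1\<bar> * B1)"
  have "symbol (Suc k) 0 B2 {0<..} \<tau>"
  \<comment> \<open>The derivative is a difference of g and a dilate of g. Both lie in the class of
    order -1 with the same constant, so one order of smoothness has been gained.\<close>
  proof (rule symbol_SucI[where f' = "\<lambda>s. 1 / ln d * (g s + (-1) * (d powr (-1) * g (s / d)))"])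
    show "DERIV \<tau> s :> 1 / ln d * (g s + (-1) * (d powr (-1) * g (s / d)))" if "s \<in> {0<..}" for s
    proof -
      have "DERIV (\<lambda>s. prim g (s / d)) s :> g (s / d) * (1 / d)"
        by (rule DERIV_chain2[OF D]) (use d in \<open>auto intro!: derivative_eq_intros\<close>)
      from DERIV_cdivide[OF DERIV_diff[OF D this], of "ln d"] show ?thesis
        using d unfolding \<tau>_def by (simp add: powr_minus field_simps)
    qed
    show "\<bar>\<tau> s\<bar> \<le> B2 * s powr 0" if "0 < s" for s
      using that t01[of s] lnd B1(1) by (simp add: B2_def add_increasing2)
    have "symbol k (-1) B1 {s. s / d \<in> UNIV} (\<lambda>s. d powr (-1) * g (s / d))"
      using d B1 by (intro symbol_scale) auto
    then have "symbol k (-1) (\<bar>- 1\<bar> * B1) UNIV (\<lambda>s. (-1) * (d powr (-1) * g (s / d)))"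
      by (intro symbol_cmult) auto
    from symbol_cmult[OF symbol_add[OF open_UNIV B1(2) this] open_UNIV, of "1 / ln d"]
    show "symbol k (0 - 1) B2 {0<..} (\<lambda>s. 1 / ln d * (g s + (-1) * (d powr (-1) * g (s / d))))"
      by (auto elim!: symbol_mono simp: B2_def simp del: mult_minus1 symbol.simps)
  qed auto
  then have "symbol (Suc k) 0 B2 UNIV \<tau>"
    by (rule symbol_glue_zero) (use t0 Suc.prems B1 lnd in \<open>auto simp: B2_def\<close>)
  then show ?case using t0 t1 t01 B1 lnd
    by (intro exI[of _ \<tau>] exI[of _ B2]) (auto simp: B2_def)
qed

lemma cutoff_exists:
  "\<exists>\<phi> B. 0 \<le> B \<and> symbol k 0 B UNIV \<phi> \<and> (\<forall>s\<le>1. \<phi> s = 1) \<and>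
     (\<forall>s\<ge>2. \<phi> s = 0) \<and> (\<forall>s. 0 \<le> \<phi> s \<and> \<phi> s \<le> (1::real))"
proof -
  obtain \<sigma> B where s: "0 \<le> B" "symbol k 0 B UNIV \<sigma>" "\<And>s. s \<le> 1 \<Longrightarrow> \<sigma> s = 0"
    "\<And>s. s \<ge> 2 \<Longrightarrow> \<sigma> s = 1" "\<And>s. 0 \<le> \<sigma> s \<and> \<sigma> s \<le> 1"
    using step_exists[of 1 2 k] by auto
  have "symbol k 0 (\<bar>1\<bar> + \<bar>-1\<bar> * B) UNIV (\<lambda>s. 1 + (-1) * \<sigma> s)"
    by (intro symbol_add symbol_const symbol_cmult s) auto
  then show ?thesis using s
    by (intro exI[of _ "\<lambda>s. 1 + (-1) * \<sigma> s"] exI[of _ "\<bar>1\<bar> + \<bar>-1\<bar> * B"]) auto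
qed

section \<open>Radial solutions vanishing near the origin\<close>

text \<open>In divergence form \<open>Lop n f\<close> is 4 s^(1 - n/2) (s^(n/2) f')'. Integrating
  twice from the region where f vanishes inverts it.\<close>

definition Jop :: "real \<Rightarrow> (real \<Rightarrow> real) \<Rightarrow> real \<Rightarrow> real" where
  "Jop n f = prim (\<lambda>s. s powr (- (n / 2)) * prim (\<lambda>t. t powr (n / 2 - 1) * (1 / 4 * f t)) s)"

lemma continuous_powr_mult:
  assumes "continuous_on UNIV f" "\<forall>s\<le>1. f s = 0"
  shows "continuous_on UNIV (\<lambda>s. s powr q * (f s :: real))"
proof -
  have "continuous_on {0<..} (\<lambda>s. s powr q * f s)"
    by (intro continuous_intros continuous_on_subset[OF assms(1)]) auto
  moreover have "continuous_on {..<1} (\<lambda>s. s powr q * f s) \<longleftrightarrow> continuous_on {..<1} (\<lambda>_::real. 0::real)"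
    using assms(2) by (intro continuous_on_cong) auto
  ultimately have "continuous_on ({0<..} \<union> {..<1}) (\<lambda>s. s powr q * f s)"
    by (intro continuous_on_open_Un) auto
  moreover have "{0<..} \<union> {..<1} = (UNIV :: real set)" by auto
  ultimately show ?thesis by simp
qed

lemma prim_continuous:
  "continuous_on UNIV f \<Longrightarrow> \<forall>s\<le>1. f s = 0 \<Longrightarrow> continuous_on UNIV (prim f)"
  by (rule continuous_at_imp_continuous_on) (blast intro: DERIV_isCont[OF prim_DERIV])

lemma DERIV_increment:
  fixes F :: "real \<Rightarrow> real"
  assumes "a \<le> b" "\<And>x. DERIV F x :> F' x" "\<And>x. a \<le> x \<Longrightarrow> x \<le> b \<Longrightarrow> K \<le> F' x"
  shows "K * (b - a) \<le> F b - F a"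
proof -
  have "F a - K * a \<le> F b - K * b"
  proof (rule DERIV_nonneg_imp_nondecreasing[where f = "\<lambda>x. F x - K * x", OF assms(1)])
    fix x assume "a \<le> x" "x \<le> b"
    then show "\<exists>y. DERIV (\<lambda>x. F x - K * x) x :> y \<and> 0 \<le> y"
      using assms(3)[of x] by (intro exI[of _ "F' x - K"]) (auto intro!: derivative_eq_intros assms(2))
  qed
  then show ?thesis by (simp add: algebra_simps)
qed

context
  fixes n :: real and f :: "real \<Rightarrow> real"
  assumes cont: "continuous_on UNIV f" and zero: "\<forall>s\<le>1. f s = 0"
begin

abbreviation (input) "Jinner \<equiv> \<lambda>t. t powr (n / 2 - 1) * (1 / 4 * f t)"
abbreviation (input) "Jouter \<equiv> \<lambda>s. s powr (- (n / 2)) * prim Jinner s"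

lemma Jop_aux: "continuous_on UNIV Jinner" "\<forall>s\<le>1. Jinner s = 0" "continuous_on UNIV Jouter" "\<forall>s\<le>1. Jouter s = 0"
proof -
  show w: "continuous_on UNIV Jinner"
    by (rule continuous_powr_mult) (use zero in \<open>auto intro!: continuous_intros cont\<close>)
  show w0: "\<forall>s\<le>1. Jinner s = 0" using zero by simp
  have p0: "\<forall>s\<le>1. prim Jinner s = 0" using prim_eq_0[OF w0] by blast
  show "continuous_on UNIV Jouter"
    by (rule continuous_powr_mult[OF prim_continuous[OF w w0] p0])
  show "\<forall>s\<le>1. Jouter s = 0" using p0 by simp
qed

lemma Jop_eq_0: "\<forall>s\<le>1. Jop n f s = 0"
  unfolding Jop_def using prim_eq_0[OF Jop_aux(4)] by blast

lemma Jop_DERIV: "DERIV (Jop n f) s :> Jouter s"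
  unfolding Jop_def by (rule prim_DERIV[OF Jop_aux(3,4)])

lemma Jop_continuous: "continuous_on UNIV (Jop n f)"
  by (intro continuous_at_imp_continuous_on ballI DERIV_isCont[OF Jop_DERIV])

lemma Lop_Jop: "Lop n (Jop n f) s = f s"
proof (cases "s < 1")
  case True
  have "Lop n (Jop n f) s = Lop n (\<lambda>_. 0) s"
    by (rule Lop_cong[of "{..<1}"]) (use True Jop_eq_0 in auto)
  then show ?thesis using True zero by (simp add: Lop_def)
next
  case False
  then have s: "s > 0" by simp
  have d: "deriv (Jop n f) = Jouter" by (intro ext DERIV_imp_deriv Jop_DERIV)
  have "DERIV Jouter s :> (- (n / 2)) * s powr (- (n / 2) - 1) * prim Jinner s + s powr (- (n / 2)) * Jinner s"
  proof -
    have "DERIV (\<lambda>s. s powr (- (n / 2))) s :> - (n / 2) * s powr (- (n / 2) - 1)"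
      using s by (auto intro!: derivative_eq_intros)
    from DERIV_mult[OF this prim_DERIV[OF Jop_aux(1,2)]] show ?thesis by (simp add: mult.commute)
  qed
  then have dv: "deriv Jouter s = (- (n / 2)) * s powr (- (n / 2) - 1) * prim Jinner s + s powr (- (n / 2)) * Jinner s"
    by (rule DERIV_imp_deriv)
  have "Lop n (Jop n f) s = 4 * (s * ((- (n / 2)) * s powr (- (n / 2) - 1) * prim Jinner s
      + s powr (- (n / 2)) * Jinner s)) + 2 * n * (s powr (- (n / 2)) * prim Jinner s)"
    by (simp only: Lop_def d dv)
  also have "\<dots> = 4 * (s powr (- (n / 2)) * s * (s powr (n / 2 - 1) * (1 / 4 * f s)))
      + 2 * n * prim Jinner s * (s powr (- (n / 2)) - s * s powr (- (n / 2) - 1))"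
    by (simp add: algebra_simps)
  also have "s * s powr (- (n / 2) - 1) = s powr (- (n / 2))"
    using s powr_mult_base[of s "- (n / 2) - 1"] by simp
  also have "s powr (- (n / 2)) * s * (s powr (n / 2 - 1) * (1 / 4 * f s))
      = (s powr (- (n / 2)) * (s * s powr (n / 2 - 1))) * (1 / 4 * f s)" by simp
  also have "s * s powr (n / 2 - 1) = s powr (n / 2)"
    using s powr_mult_base[of s "n / 2 - 1"] by simp
  also have "s powr (- (n / 2)) * s powr (n / 2) = 1"
    using s by (simp add: powr_add[symmetric])
  finally show ?thesis by simp
qed

text \<open>The two \<open>max\<close> record the constants left by the integrations: the inner one
  contributes s^(-n/2) to the derivative, the outer one s^0. The excluded exponents are those at
  which one of the integrals would produce a logarithm.\<close>

lemma symbol_Jop: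
  assumes "symbol k p B UNIV f" "0 \<le> B" "p \<noteq> - (n / 2)" "max p (- (n / 2)) \<noteq> - 1"
  shows "\<exists>B'\<ge>0. symbol (k + 2) (max (max p (- (n / 2)) + 1) 0) B' UNIV (Jop n f)"
proof -
  have "symbol k p (\<bar>1/4\<bar> * B) UNIV (\<lambda>t. 1 / 4 * f t)" by (intro symbol_cmult assms) auto
  from symbol_powr_mult[OF this, of "n / 2 - 1"] zero assms(2) obtain B1 where
    B1: "B1 \<ge> 0" "symbol k (n / 2 - 1 + p) B1 UNIV Jinner" by auto
  from symbol_prim[OF B1(2) Jop_aux(2) _ B1(1)] assms(3) obtain B2 where
    B2: "B2 \<ge> 0" "symbol (Suc k) (max (n / 2 - 1 + p + 1) 0) B2 UNIV (prim Jinner)" by auto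
  have "\<forall>s\<le>1. prim Jinner s = 0" using prim_eq_0[OF Jop_aux(2)] by blast
  from symbol_powr_mult[OF B2(2) this B2(1), of "- (n / 2)"] obtain B3 where
    B3: "B3 \<ge> 0" "symbol (Suc k) (- (n / 2) + max (n / 2 - 1 + p + 1) 0) B3 UNIV Jouter" by auto
  have eq: "- (n / 2) + max (n / 2 - 1 + p + 1) 0 = max p (- (n / 2))" by auto
  from symbol_prim[OF B3(2)[unfolded eq] Jop_aux(4) assms(4) B3(1)]
  show ?thesis unfolding Jop_def by simp
qed

context
  assumes nonneg: "\<And>s. 0 \<le> f s"
begin

lemma prim_w_nonneg: "0 \<le> prim Jinner s"
  using nonneg by (intro prim_nonneg Jop_aux) auto

lemma Jop_nonneg: "0 \<le> Jop n f s"
  unfolding Jop_def using prim_w_nonneg by (intro prim_nonneg Jop_aux) auto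

lemma Jop_mono: "mono (Jop n f)"
  unfolding Jop_def using prim_w_nonneg by (intro monoI prim_mono Jop_aux) auto

text \<open>Start of the lower bounds. The seed decays, so f is bounded below on [3/2, 2] only; that
  mass keeps the derivative of \<open>Jop n f\<close> positive on [2, 3], and monotonicity carries
  the gain to all larger s.\<close>

lemma Jop_ge_1:
  assumes "\<And>t. 3 / 2 \<le> t \<Longrightarrow> t \<le> 2 \<Longrightarrow> c \<le> f t" "c > 0" "n \<ge> 2" "s \<ge> 3"
  shows "3 powr (- (n / 2)) * (c / 8) \<le> Jop n f s"
proof -
  have "c / 4 * (2 - 3 / 2) \<le> prim Jinner 2 - prim Jinner (3 / 2)"
  proof (rule DERIV_increment[OF _ prim_DERIV[OF Jop_aux(1,2)]])
    fix x :: real assume x: "3 / 2 \<le> x" "x \<le> 2"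
    have "1 * (1 / 4 * c) \<le> x powr (n / 2 - 1) * (1 / 4 * f x)"
      by (intro mult_mono) (use x assms in \<open>auto intro: ge_one_powr_ge_zero\<close>)
    then show "c / 4 \<le> Jinner x" by simp
  qed auto
  then have Q: "c / 8 \<le> prim Jinner 2" using prim_w_nonneg[of "3 / 2"] by simp
  have Qm: "mono (prim Jinner)" using nonneg by (intro monoI prim_mono Jop_aux) auto
  have "3 powr (- (n / 2)) * (c / 8) * (3 - 2) \<le> Jop n f 3 - Jop n f 2"
  proof (rule DERIV_increment[OF _ Jop_DERIV])
    fix x :: real assume x: "2 \<le> x" "x \<le> 3"
    show "3 powr (- (n / 2)) * (c / 8) \<le> Jouter x"
      by (intro mult_mono order_trans[OF Q monoD[OF Qm x(1)]] powr_mono2')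
        (use x assms in auto)
  qed auto
  also have "\<dots> \<le> Jop n f s" using Jop_nonneg[of 2] monoD[OF Jop_mono assms(4)] by simp
  finally show ?thesis by simp
qed

text \<open>Both integrals are restricted to the upper half of their ranges, [x/2, x] and [s/2, s].
  There the argument of f is at least s/4, and the outer integration gains the factor s.\<close>

lemma Jop_ge:
  assumes "mono f" "s > 0" "n \<ge> 2"
  shows "2 powr (- (n / 2)) / 8 * s * f (s / 4) \<le> Jop n f s"
proof -
  have Q: "(x / 2) powr (n / 2) * (1 / 4 * f (x / 2)) \<le> prim Jinner x" if "x > 0" for x
  proof -
    have "(x / 2) powr (n / 2 - 1) * (1 / 4 * f (x / 2)) * (x - x / 2) \<le> prim Jinner x - prim Jinner (x / 2)"
    proof (rule DERIV_increment[OF _ prim_DERIV[OF Jop_aux(1,2)]])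
      fix y assume y: "x / 2 \<le> y" "y \<le> x"
      show "(x / 2) powr (n / 2 - 1) * (1 / 4 * f (x / 2)) \<le> Jinner y"
        by (intro mult_mono powr_mono2 monoD[OF assms(1)])
          (use that y assms nonneg in auto)
    qed (use that in auto)
    moreover have "(x / 2) powr (n / 2) = x / 2 * (x / 2) powr (n / 2 - 1)"
      using powr_mult_base[of "x / 2" "n / 2 - 1"] that by simp
    then have "(x / 2) powr (n / 2 - 1) * (1 / 4 * f (x / 2)) * (x - x / 2)
       = (x / 2) powr (n / 2) * (1 / 4 * f (x / 2))" by simp
    ultimately show ?thesis using prim_w_nonneg[of "x / 2"] by linarith
  qed
  have "2 powr (- (n / 2)) * (1 / 4 * f (s / 4)) * (s - s / 2) \<le> Jop n f s - Jop n f (s / 2)"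
  proof (rule DERIV_increment[OF _ Jop_DERIV])
    fix x assume x: "s / 2 \<le> x" "x \<le> s"
    then have xp: "x > 0" using assms(2) by simp
    have "2 powr (- (n / 2)) * (1 / 4 * f (s / 4)) \<le> 2 powr (- (n / 2)) * (1 / 4 * f (x / 2))"
      using x by (intro mult_left_mono monoD[OF assms(1)]) auto
    also have "\<dots> = x powr (- (n / 2)) * ((x / 2) powr (n / 2) * (1 / 4 * f (x / 2)))"
      using xp by (simp add: powr_divide powr_minus field_simps)
    also have "\<dots> \<le> Jouter x" by (intro mult_left_mono Q xp) auto
    finally show "2 powr (- (n / 2)) * (1 / 4 * f (s / 4)) \<le> Jouter x" .
  qed (use assms(2) in auto)
  then show ?thesis using Jop_nonneg[of "s / 2"] by (simp add: algebra_simps)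
qed

end
end

section \<open>Test functions vanishing near the origin and growing like |x|^(2m-2)\<close>

text \<open>An explicit source that is continuous, positive for s > 1, and for n \<ge> 4 decays fast
  enough that \<open>Jop\<close> turns it into a bounded function.\<close>

definition hseed :: "real \<Rightarrow> real \<Rightarrow> real" where
  "hseed n s = s powr (- n) * max 0 (s - 1)"

text \<open>For large s the iterate \<open>hfun n (Suc j)\<close> is comparable to s^j, so
  \<open>hfun n m\<close> has the growth |x|^(2m-2), while its m-fold \<open>Lop\<close> is the
  seed.\<close>

definition hfun :: "real \<Rightarrow> nat \<Rightarrow> real \<Rightarrow> real" where
  "hfun n j = (Jop n ^^ j) (hseed n)"

lemma hseed: "continuous_on UNIV (hseed n)" "\<forall>s\<le>1. hseed n s = 0" "\<And>s. 0 \<le> hseed n s"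
proof -
  show "continuous_on UNIV (hseed n)"
    unfolding hseed_def by (intro continuous_powr_mult continuous_intros) auto
qed (auto simp: hseed_def)

lemma hfun_0: "hfun n 0 = hseed n" and hfun_Suc: "hfun n (Suc j) = Jop n (hfun n j)"
  by (simp_all add: hfun_def)

lemma hfun_props: "continuous_on UNIV (hfun n j) \<and> (\<forall>s\<le>1. hfun n j s = 0) \<and> (\<forall>s. 0 \<le> hfun n j s)"
proof (induction j)
  case 0
  then show ?case using hseed by (auto simp: hfun_0)
next
  case (Suc j)
  then show ?case
    using Jop_continuous[of "hfun n j"] Jop_eq_0[of "hfun n j"] Jop_nonneg[of "hfun n j"]
    by (auto simp: hfun_Suc)
qed

lemmas hfun_continuous = hfun_props[THEN conjunct1]
lemmas hfun_eq_0 = hfun_props[THEN conjunct2, THEN conjunct1]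
lemmas hfun_nonneg = hfun_props[THEN conjunct2, THEN conjunct2, rule_format]

lemma Lop_hfun: "Lop n (hfun n (Suc j)) = hfun n j"
  unfolding hfun_Suc using Lop_Jop[OF hfun_continuous hfun_eq_0] by blast

text \<open>The seed is placed in order -n/2 - 1, strictly below the logarithmic exponent -n/2; its
  actual decay s^(1-n) allows this for n \<ge> 4. The first \<open>Jop\<close> then gives order 0,
  and every further one adds one order and two derivatives.\<close>

lemma symbol_hfun:
  assumes "n \<ge> 4"
  shows "\<exists>B\<ge>0. symbol (2 * Suc j) (real j) B UNIV (hfun n (Suc j))"
proof (induction j)
  case 0
  have "\<bar>hseed n s\<bar> \<le> 1 * s powr (- (n / 2) - 1)" if "s > 0" for s
  proof (cases "s \<le> 1")
    case False
    have "hseed n s \<le> s powr (- n) * s powr 1"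
      unfolding hseed_def using False by (intro mult_left_mono) auto
    also have "\<dots> = s powr (- n + 1)" by (rule powr_add[symmetric])
    also have "\<dots> \<le> s powr (- (n / 2) - 1)" using False assms by (intro powr_mono) auto
    finally show ?thesis using hseed(3)[of n s] by simp
  qed (use hseed in auto)
  then have "symbol 0 (- (n / 2) - 1) 1 UNIV (hseed n)" using hseed(1) by auto
  from symbol_Jop[OF hseed(1,2) this, of n] assms show ?case
    by (simp add: hfun_def max_def numeral_2_eq_2 del: symbol.simps)
next
  case (Suc j)
  then obtain B where "0 \<le> B" "symbol (2 * Suc j) (real j) B UNIV (hfun n (Suc j))" by blast
  from symbol_Jop[OF hfun_continuous hfun_eq_0 this(2,1), of n] assms show ?case
    unfolding hfun_Suc[of n "Suc j"] by (simp add: max_def add.commute del: symbol.simps)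
qed

text \<open>Induction with \<open>Jop_ge\<close>: each step gains a factor s and multiplies the
  threshold A by 4, because \<open>Jop_ge\<close> evaluates the previous function at s/4.\<close>

lemma hfun_lower:
  assumes "n \<ge> 2"
  shows "\<exists>c A. c > 0 \<and> A \<ge> 1 \<and> (\<forall>s\<ge>A. c * s ^ j \<le> hfun n (Suc j) s)"
proof (induction j)
  case 0
  define c where "c = 2 powr (- n) * (1 / 2)"
  have "c \<le> hseed n t" if "3 / 2 \<le> t" "t \<le> 2" for t
    unfolding c_def hseed_def by (intro mult_mono powr_mono2') (use that assms in auto)
  from Jop_ge_1[OF hseed(1,2,3) this] assms show ?case
    by (intro exI[of _ "3 powr (- (n / 2)) * (c / 8)"] exI[of _ 3]) (auto simp: c_def hfun_def)
next
  case (Suc j)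
  then obtain c A where cA: "c > 0" "A \<ge> 1" "\<And>s. s \<ge> A \<Longrightarrow> c * s ^ j \<le> hfun n (Suc j) s" by blast
  have mono: "mono (hfun n (Suc j))"
    unfolding hfun_Suc by (intro Jop_mono hfun_continuous hfun_eq_0 hfun_nonneg)
  show ?case
  proof (intro exI conjI allI impI)
    fix s assume s: "s \<ge> 4 * A"
    have "2 powr (- (n / 2)) / 8 * c / 4 ^ j * s ^ Suc j = 2 powr (- (n / 2)) / 8 * s * (c * (s / 4) ^ j)"
      by (simp add: power_divide)
    also have "\<dots> \<le> 2 powr (- (n / 2)) / 8 * s * hfun n (Suc j) (s / 4)"
      using s cA by (intro mult_left_mono cA) auto
    also have "\<dots> \<le> hfun n (Suc (Suc j)) s"
      unfolding hfun_Suc[of n "Suc j"]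
      by (intro Jop_ge hfun_continuous hfun_eq_0 hfun_nonneg mono) (use s cA assms in auto)
    finally show "2 powr (- (n / 2)) / 8 * c / 4 ^ j * s ^ Suc j \<le> hfun n (Suc (Suc j)) s" .
  qed (use cA in auto)
qed

section \<open>The regularised fundamental solution\<close>

text \<open>Closed form of the i-th iterate of the negative radial Laplacian applied to (s + d)^(-a), where
  a = n/2 - m. All coefficients are nonnegative for i \<open>\<le>\<close> m, and for i = m only the term j = m is left.\<close>

definition bubble :: "nat \<Rightarrow> real \<Rightarrow> real \<Rightarrow> nat \<Rightarrow> real \<Rightarrow> real" where
  "bubble m a d i s = (\<Sum>j\<le>i. 4 ^ i * real (i choose j) * pochhammer (real m - real i) (i - j) * d ^ j *
     (pochhammer a (i + j) * (s + d) powr (- (a + real (i + j)))))"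

lemma DERIV_shift_powr:
  fixes s :: real
  shows "s > - d \<Longrightarrow> DERIV (\<lambda>s. (s + d) powr b) s :> b * (s + d) powr (b - 1)"
  by (auto intro!: derivative_eq_intros)

text \<open>The coefficient recursion behind \<open>Lop_bubble\<close>, used with x = m - i - 1;
  passing from i to i + 1 lowers the Pochhammer argument by 1. It is Pascal's rule combined with
  (l+1) C(i,l+1) = (i-l) C(i,l).\<close>

lemma bubble_coeff:
  fixes x :: real
  assumes "j \<le> Suc i"
  shows "real (Suc i choose j) * pochhammer x (Suc i - j) =
     (if j \<le> i then real (i choose j) * pochhammer (x + 1) (i - j) * (x - real j) else 0) +
     (if j = 0 then 0 else real (i choose (j - 1)) * pochhammer (x + 1) (Suc i - j))"
proof (cases j)
  case 0
  then show ?thesis by (simp add: pochhammer_rec)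
next
  case (Suc l)
  show ?thesis
  proof (cases "l = i")
    case True
    then show ?thesis using Suc by simp
  next
    case False
    then have l: "l < i" using assms Suc by simp
    have e: "i - l = Suc (i - Suc l)" using l by simp
    define P where "P = pochhammer (x + 1) (i - Suc l)"
    have 1: "pochhammer x (Suc i - j) = x * P"
      unfolding P_def using Suc e by (simp add: pochhammer_rec)
    have 2: "pochhammer (x + 1) (Suc i - j) = P * (x + real i - real l)"
      unfolding P_def using Suc l by (simp add: e pochhammer_Suc) 
    have "Suc l * (i choose Suc l) = (i - l) * (i choose l)"
      using binomial_absorb_comp[of i l] binomial_absorption[of l i] by simp
    then have "real (Suc l) * real (i choose Suc l) = real (i - l) * real (i choose l)"
      unfolding of_nat_mult[symmetric] by (rule arg_cong)
    then have "real (i choose Suc l) * real (Suc l) = real (i choose l) * (real i - real l)"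
      using l by (simp add: of_nat_diff mult.commute)
    then have "real (i choose Suc l) * (P * real (Suc l)) = real (i choose l) * (P * (real i - real l))"
      by (simp add: mult_ac)
    then have "(real (i choose l) + real (i choose Suc l)) * (x * P) =
        real (i choose Suc l) * P * (x - real (Suc l)) + real (i choose l) * (P * (x + real i - real l))"
      by (simp only: ring_distribs mult_ac)
    then show ?thesis using Suc l 1[unfolded Suc] 2[unfolded Suc] by (simp add: P_def[symmetric])
  qed
qed

text \<open>Writing the factor s in \<open>Lop\<close> as (s + d) - d leaves only two pure powers of
  s + d.\<close>

lemma Lop_shift_powr:
  assumes "s > - d"
  shows "Lop n (\<lambda>s. (s + d) powr (- b)) s =
    - (4 * b * ((n / 2 - b - 1) * (s + d) powr (- (b + 1)) + (b + 1) * d * (s + d) powr (- (b + 2))))"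
proof -
  define E where "E = (\<lambda>s. (s + d) powr (- b))"
  have 1: "deriv E s = - b * (s + d) powr (- (b + 1))" if "s > - d" for s
    unfolding E_def using DERIV_imp_deriv[OF DERIV_shift_powr[OF that, of "- b"]]
    by (simp add: minus_diff_commute)
  have "deriv (deriv E) s = deriv (\<lambda>s. - b * (s + d) powr (- (b + 1))) s"
    by (rule deriv_cong_open[of "{- d<..}"]) (use 1 assms in auto)
  also have "\<dots> = - b * (- (b + 1) * (s + d) powr (- (b + 1) - 1))"
    by (intro DERIV_imp_deriv DERIV_cmult DERIV_shift_powr assms)
  also have "- (b + 1) - 1 = - (b + 2)" by simp
  finally have 2: "deriv (deriv E) s = b * (b + 1) * (s + d) powr (- (b + 2))" by (simp add: algebra_simps)
  have e: "1 + - (b + 2) = - (b + 1)" by simp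
  have 3: "(s + d) powr (- (b + 1)) = (s + d) * (s + d) powr (- (b + 2))"
    using powr_mult_base[of "s + d" "- (b + 2)", unfolded e] assms by linarith
  show ?thesis unfolding Lop_def E_def[symmetric] 1[OF assms] 2 3 by (simp add: algebra_simps)
qed

lemma Lop_eqI:
  assumes "open T" "s \<in> T" "\<And>x. x \<in> T \<Longrightarrow> DERIV f x :> f1 x" "DERIV f1 s :> f2"
  shows "Lop n f s = 4 * (s * f2) + 2 * n * f1 s"
proof -
  have 1: "deriv f x = f1 x" if "x \<in> T" for x using assms(3)[OF that] by (rule DERIV_imp_deriv)
  have "deriv (deriv f) s = deriv f1 s" using deriv_cong_open[OF assms(1,2) 1] .
  also have "\<dots> = f2" using assms(4) by (rule DERIV_imp_deriv)
  finally show ?thesis by (simp add: Lop_def 1[OF assms(2)])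
qed

lemma Lop_sum_shift_powr:
  assumes "s > - d"
  shows "Lop n (\<lambda>s. \<Sum>j\<in>A. c j * (s + d) powr (- b j)) s =
     (\<Sum>j\<in>A. c j * Lop n (\<lambda>s. (s + d) powr (- b j)) s)"
proof -
  define f1 where "f1 = (\<lambda>j s. - b j * (s + d) powr (- b j - 1))"
  define f2 where "f2 = (\<lambda>j. - b j * ((- b j - 1) * (s + d) powr (- b j - 1 - 1)))"
  have D: "DERIV (\<lambda>s. (s + d) powr (- b j)) x :> f1 j x" if "x \<in> {- d<..}" for x j
    unfolding f1_def using that by (intro DERIV_shift_powr) auto
  have D': "DERIV (f1 j) s :> f2 j" for j
    unfolding f1_def f2_def using assms by (intro DERIV_cmult DERIV_shift_powr) auto
  have "Lop n (\<lambda>s. \<Sum>j\<in>A. c j * (s + d) powr (- b j)) s =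
      4 * (s * (\<Sum>j\<in>A. c j * f2 j)) + 2 * n * (\<Sum>j\<in>A. c j * f1 j s)"
    by (rule Lop_eqI[of "{- d<..}"]) (use assms in \<open>auto intro!: DERIV_sum DERIV_cmult D D'\<close>)
  moreover have "Lop n (\<lambda>s. (s + d) powr (- b j)) s = 4 * (s * f2 j) + 2 * n * f1 j s" for j
    by (rule Lop_eqI[of "{- d<..}"]) (use assms D D' in auto)
  ultimately show ?thesis
    by (simp add: sum_distrib_left sum.distrib algebra_simps)
qed

text \<open>The relation n = 2(a + m) turns the factor n/2 - (a + k) - 1 into m - 1 - k. Each term
  with index k = i + j then feeds indices k + 1 and k + 2, the latter with an extra d, and
  \<open>bubble_coeff\<close> collects them.\<close>

lemma Lop_bubble:
  assumes "s > - d" "n = 2 * (a + real m)"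
  shows "Lop n (bubble m a d i) s = - bubble m a d (Suc i) s"
proof -
  define E where "E = (\<lambda>k. pochhammer a k * (s + d) powr (- (a + real k)))"
  define c where "c = (\<lambda>i j. real (i choose j) * pochhammer (real m - real i) (i - j))"
  have L: "pochhammer a k * Lop n (\<lambda>s. (s + d) powr (- (a + real k))) s =
      - 4 * ((real m - 1 - real k) * E (Suc k) + d * E (Suc (Suc k)))" for k
  proof -
    have "n / 2 - (a + real k) - 1 = real m - 1 - real k" using assms(2) by (simp add: field_simps)
    moreover have "a + real k + 1 = a + real (Suc k)" "a + real k + 2 = a + real (Suc (Suc k))" by auto
    ultimately show ?thesis
      unfolding Lop_shift_powr[OF assms(1)] E_def by (simp only: pochhammer_Suc) (simp add: algebra_simps)
  qed
  have "Lop n (bubble m a d i) s = (\<Sum>j\<le>i. (4 ^ i * c i j * d ^ j) *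
      (pochhammer a (i + j) * Lop n (\<lambda>s. (s + d) powr (- (a + real (i + j)))) s))"
    using Lop_sum_shift_powr[OF assms(1), of n "\<lambda>j. 4 ^ i * c i j * d ^ j * pochhammer a (i + j)"
        "\<lambda>j. a + real (i + j)" "{..i}"]
    unfolding bubble_def[abs_def] c_def by (simp only: mult.assoc)
  also have "\<dots> = - (4 ^ Suc i * (\<Sum>j\<le>i. c i j * d ^ j *
      ((real m - 1 - real (i + j)) * E (Suc (i + j)) + d * E (Suc (Suc (i + j))))))"
    unfolding L sum_distrib_left sum_negf[symmetric] by (intro sum.cong) (auto simp: algebra_simps)
  also have "(\<Sum>j\<le>i. c i j * d ^ j *
      ((real m - 1 - real (i + j)) * E (Suc (i + j)) + d * E (Suc (Suc (i + j))))) =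
      (\<Sum>j\<le>i. c i j * (real m - real (Suc i) - real j) * d ^ j * E (Suc i + j)) +
      (\<Sum>j\<le>i. c i j * d ^ Suc j * E (Suc i + Suc j))"
    by (simp add: sum.distrib[symmetric] algebra_simps)
  also have "\<dots> = (\<Sum>j\<le>Suc i. c (Suc i) j * d ^ j * E (Suc i + j))"
  proof -
    have "c (Suc i) j = (if j \<le> i then c i j * (real m - real (Suc i) - real j) else 0) +
       (if j = 0 then 0 else c i (j - 1))" if "j \<le> Suc i" for j
      using bubble_coeff[OF that, of "real m - real (Suc i)"] that unfolding c_def
      by (auto simp: Suc_diff_le)
    then have "(\<Sum>j\<le>Suc i. c (Suc i) j * d ^ j * E (Suc i + j)) =
      (\<Sum>j\<le>Suc i. (if j \<le> i then c i j * (real m - real (Suc i) - real j) else 0) * d ^ j * E (Suc i + j)) +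
      (\<Sum>j\<le>Suc i. (if j = 0 then 0 else c i (j - 1)) * d ^ j * E (Suc i + j))"
      unfolding sum.distrib[symmetric] by (intro sum.cong) (auto simp: distrib_right)
    also have "(\<Sum>j\<le>Suc i. (if j = 0 then 0 else c i (j - 1)) * d ^ j * E (Suc i + j)) =
      (\<Sum>j\<le>i. c i j * d ^ Suc j * E (Suc i + Suc j))"
      unfolding sum.atMost_Suc_shift by simp
    finally show ?thesis by simp
  qed
  also have "4 ^ Suc i * \<dots> = bubble m a d (Suc i) s"
    unfolding bubble_def c_def E_def sum_distrib_left by (simp only: mult.assoc)
  finally show ?thesis .
qed

lemma Lop_cmult_bubble:
  assumes "s > - d"
  shows "Lop n (\<lambda>s. k * bubble m a d i s) s = k * Lop n (bubble m a d i) s"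
proof -
  define c where "c = (\<lambda>j. 4 ^ i * (real (i choose j) * (pochhammer (real m - real i) (i - j) *
      (d ^ j * pochhammer a (i + j)))))"
  have b: "bubble m a d i = (\<lambda>s. \<Sum>j\<le>i. c j * (s + d) powr (- (a + real (i + j))))"
    unfolding bubble_def[abs_def] c_def by (simp only: mult.assoc)
  have "(\<lambda>s. k * bubble m a d i s) = (\<lambda>s. \<Sum>j\<le>i. (k * c j) * (s + d) powr (- (a + real (i + j))))"
    unfolding b by (simp only: sum_distrib_left mult.assoc)
  then show ?thesis unfolding b
    by (simp only: Lop_sum_shift_powr[OF assms]) (simp only: sum_distrib_left mult.assoc)
qed

lemma Lop_funpow_bubble:
  assumes "s > - d" "n = 2 * (a + real m)"
  shows "(Lop n ^^ i) (bubble m a d 0) s = (-1) ^ i * bubble m a d i s"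
  using assms(1)
proof (induction i arbitrary: s)
  case (Suc i)
  have "(Lop n ^^ Suc i) (bubble m a d 0) s = Lop n (\<lambda>s. (-1) ^ i * bubble m a d i s) s"
    using Lop_cong[of "{- d<..}", OF _ Suc.IH] Suc.prems by simp
  also have "\<dots> = (-1) ^ i * Lop n (bubble m a d i) s"
    by (rule Lop_cmult_bubble[OF Suc.prems])
  finally show ?case using Lop_bubble[OF Suc.prems assms(2)] by simp
qed simp

lemma bubble_0: "bubble m a d 0 s = (s + d) powr (- a)"
  by (simp add: bubble_def)

text \<open>For i = m the Pochhammer symbols have argument 0 and vanish unless j = m. With a = n/2 -
  m the result is a multiple of d^m (s + d)^(-n/2 - m): of size d^(-n/2) for s \<le> d and with
  total mass independent of d.\<close>

lemma bubble_top:
  "bubble m a d m s = 4 ^ m * pochhammer a (2 * m) * d ^ m * (s + d) powr (- (a + 2 * real m))"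
proof -
  have "bubble m a d m s = (\<Sum>j\<in>{m}. 4 ^ m * real (m choose j) * pochhammer (real m - real m) (m - j) * d ^ j *
     (pochhammer a (m + j) * (s + d) powr (- (a + real (m + j)))))"
    unfolding bubble_def by (rule sum.mono_neutral_right) (auto simp: pochhammer_0_left)
  then show ?thesis by (simp flip: mult_2)
qed

section \<open>Integration by parts against radial functions\<close>

lemma integral_translate:
  fixes F :: "'a::euclidean_space \<Rightarrow> real"
  assumes "F \<in> borel_measurable borel"
  shows "integral\<^sup>L lborel (\<lambda>x. F (c + x)) = integral\<^sup>L lborel F"
    "integrable lborel F \<Longrightarrow> integrable lborel (\<lambda>x. F (c + x))"
proof -
  have d: "distr lborel borel ((+) c) = lborel" by (rule lborel_distr_plus)
  have "integral\<^sup>L (distr lborel borel ((+) c)) F = integral\<^sup>L lborel (\<lambda>x. F (c + x))"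
    using assms by (intro integral_distr) auto
  then show "integral\<^sup>L lborel (\<lambda>x. F (c + x)) = integral\<^sup>L lborel F" unfolding d by simp
  have "integrable (distr lborel borel ((+) c)) F \<longleftrightarrow> integrable lborel (\<lambda>x. F (c + x))"
    using assms by (intro integrable_distr_eq) auto
  then show "integrable lborel F \<Longrightarrow> integrable lborel (\<lambda>x. F (c + x))" unfolding d by simp
qed

lemma integrable_on_compact:
  fixes F :: "'a::euclidean_space \<Rightarrow> real"
  assumes "compact K" "continuous_on K F"
  shows "integrable lborel (\<lambda>x. indicator K x * F x)"
  using borel_integrable_compact[OF assms] by simp

text \<open>Translation invariance makes every difference quotient of a compactly supported function
  integrate to zero; dominated convergence replaces the divergence theorem.\<close>

lemma integral_directional_derivative_eq_0:
  fixes F G :: "'a::euclidean_space \<Rightarrow> real"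
  assumes K: "compact K" "\<And>x. x \<notin> K \<Longrightarrow> F x = 0"
    and cont: "continuous_on UNIV F" "continuous_on UNIV G"
    and D: "\<And>x. DERIV (\<lambda>t. F (x + t *\<^sub>R e)) 0 :> G x"
  shows "integral\<^sup>L lborel G = 0"
proof -
  have D': "DERIV (\<lambda>t. F (x + t *\<^sub>R e)) t0 :> G (x + t0 *\<^sub>R e)" for x t0
    using D[of "x + t0 *\<^sub>R e"] DERIV_shift[of "\<lambda>t. F (x + t *\<^sub>R e)" _ 0 t0]
    by (simp add: algebra_simps)
  have G0: "G x = 0" if "x \<notin> K" for x
  proof -
    have "open ((\<lambda>t. x + t *\<^sub>R e) -` (- K))"
      using K(1) by (intro open_vimage continuous_intros) (auto simp: compact_imp_closed open_Compl)
    then have "DERIV (\<lambda>_. 0::real) 0 :> G x"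
      using that K(2) by (intro DERIV_cong_open[OF _ _ _ D[of x]]) auto
    then show ?thesis using DERIV_unique[OF _ DERIV_const] by blast
  qed
  have "bounded (G ` K)"
    using K(1) cont(2) by (intro compact_imp_bounded compact_continuous_image) (auto intro: continuous_on_subset)
  then obtain B where B: "B > 0" "\<And>x. x \<in> K \<Longrightarrow> \<bar>G x\<bar> \<le> B"
    unfolding bounded_pos by auto
  have GB: "\<bar>G x\<bar> \<le> B" for x using B G0[of x] by (cases "x \<in> K") auto
  \<comment> \<open>All difference quotients with steps in [0, 1] are supported in this one compact
    set, which makes the dominating function integrable.\<close>
  define K' where "K' = (\<lambda>(x, t). x - t *\<^sub>R e) ` (K \<times> {0..1::real})"
  have K': "compact K'"
    unfolding K'_def case_prod_unfold using K(1)
    by (intro compact_continuous_image continuous_intros compact_Times) auto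
  define h where "h = (\<lambda>(k::nat) x. (F (x + (1 / real (Suc k)) *\<^sub>R e) - F x) * real (Suc k))"
  have Fm: "F \<in> borel_measurable borel" using cont(1) by (rule borel_measurable_continuous_onI)
  have Fi: "integrable lborel F"
  proof -
    have "(\<lambda>x. indicator K x * F x) = F" using K(2) by (auto simp: indicator_def fun_eq_iff)
    then show ?thesis
      using integrable_on_compact[OF K(1) continuous_on_subset[OF cont(1)]] by simp
  qed
  have h0: "integral\<^sup>L lborel (h k) = 0" for k
  proof -
    have "integral\<^sup>L lborel (\<lambda>x. F (x + (1 / real (Suc k)) *\<^sub>R e) - F x) = 0"
      using integral_translate[OF Fm, of "(1 / real (Suc k)) *\<^sub>R e"] Fi
      by (subst Bochner_Integration.integral_diff) (auto simp: add.commute)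
    then show ?thesis unfolding h_def by simp
  qed
  have hb: "norm (h k x) \<le> B * indicator K' x" for k x
  proof -
    define t where "t = 1 / real (Suc k)"
    have t: "0 < t" "t \<le> 1" by (auto simp: t_def)
    \<comment> \<open>By the mean value theorem the quotient is a value of G on the segment, hence
      bounded by B uniformly in the step.\<close>
    obtain s where s: "0 < s" "s < t" "F (x + t *\<^sub>R e) - F (x + 0 *\<^sub>R e) = (t - 0) * G (x + s *\<^sub>R e)"
      using MVT2[OF t(1), of "\<lambda>t. F (x + t *\<^sub>R e)" "\<lambda>t. G (x + t *\<^sub>R e)"] D' by blast
    have "h k x = (F (x + t *\<^sub>R e) - F (x + 0 *\<^sub>R e)) / t" by (simp add: h_def t_def)
    then have h: "h k x = G (x + s *\<^sub>R e)" using s t by simp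
    show ?thesis
    proof (cases "x \<in> K'")
      case False
      have "x + s *\<^sub>R e \<notin> K"
      proof
        assume "x + s *\<^sub>R e \<in> K"
        then have "(x + s *\<^sub>R e) - s *\<^sub>R e \<in> K'"
          unfolding K'_def using s t by (intro image_eqI[of _ _ "(x + s *\<^sub>R e, s)"]) auto
        then show False using False by simp
      qed
      then show ?thesis using h G0 False by simp
    qed (use h GB in simp)
  qed
  have lim: "(\<lambda>k. h k x) \<longlonglongrightarrow> G x" for x
  proof -
    have "((\<lambda>t. (F (x + t *\<^sub>R e) - F x) / t) \<longlongrightarrow> G x) (at 0)"
      using D[of x] by (simp add: DERIV_def)
    moreover have "filterlim (\<lambda>k. 1 / real (Suc k)) (at 0) sequentially"
      unfolding filterlim_at using LIMSEQ_inverse_real_of_nat by (auto simp: inverse_eq_divide)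
    ultimately have "(\<lambda>k. (F (x + (1 / real (Suc k)) *\<^sub>R e) - F x) / (1 / real (Suc k))) \<longlonglongrightarrow> G x"
      by (rule filterlim_compose)
    then show ?thesis by (simp add: h_def)
  qed
  have "(\<lambda>k. integral\<^sup>L lborel (h k)) \<longlonglongrightarrow> integral\<^sup>L lborel G"
  proof (rule integral_dominated_convergence[where w = "\<lambda>x. B * indicator K' x"])
    show "G \<in> borel_measurable lborel"
      using cont(2) by (auto intro: borel_measurable_continuous_onI)
    show "h k \<in> borel_measurable lborel" for k
      unfolding h_def by (auto intro!: borel_measurable_continuous_onI continuous_intros continuous_on_compose2[OF cont(1)])
    show "integrable lborel (\<lambda>x. B * indicator K' x)"
      using integrable_on_compact[OF K', of "\<lambda>_. B"] by (simp add: mult.commute)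
  qed (use lim hb in auto)
  then show ?thesis by (simp add: h0 LIMSEQ_const_iff)
qed

section \<open>Partial derivatives and Green's identities\<close>

lemma DERIV_partial:
  fixes f :: "real^'n \<Rightarrow> real"
  assumes "f differentiable (at x)"
  shows "DERIV (\<lambda>t. f (x + t *\<^sub>R axis i 1)) 0 :> partial i f x"
proof -
  have "(\<lambda>t::real. x + t *\<^sub>R axis i 1) differentiable (at 0)" by simp
  then have "(f \<circ> (\<lambda>t::real. x + t *\<^sub>R axis i 1)) differentiable (at 0)"
    using assms by (intro differentiable_chain_at) auto
  then show ?thesis
    unfolding partial_def by (simp add: o_def DERIV_deriv_iff_real_differentiable)
qed

lemma partial_cong:
  fixes f :: "real^'n \<Rightarrow> real"
  assumes "open S" "x \<in> S" "\<And>x. x \<in> S \<Longrightarrow> f x = g x"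
  shows "partial i f x = partial i g x"
  unfolding partial_def
proof (rule deriv_cong_open)
  show "open ((\<lambda>t::real. x + t *\<^sub>R axis i 1) -` S)"
    using assms(1) by (intro open_vimage continuous_intros)
qed (use assms in auto)

lemma Ck_on_cong:
  assumes "Ck_on k S f" "open S" "\<And>x. x \<in> S \<Longrightarrow> f x = g x"
  shows "Ck_on k S g"
  using assms
proof (induction k arbitrary: f g)
  case 0
  then show ?case by (auto cong: continuous_on_cong)
next
  case (Suc k)
  have "Ck_on k S (partial i g)" for i
  proof (rule Suc.IH[OF _ Suc.prems(2)])
    show "Ck_on k S (partial i f)" using Suc.prems(1) by simp
    show "partial i f x = partial i g x" if "x \<in> S" for x
      using partial_cong[OF Suc.prems(2) that Suc.prems(3)] .
  qed
  moreover have "continuous_on S g"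
    using Suc.prems(1,3) by (auto cong: continuous_on_cong)
  moreover have "g differentiable_on S"
    unfolding differentiable_on_def
  proof
    fix x assume x: "x \<in> S"
    then have "f differentiable (at x within S)" using Suc.prems(1) by (auto simp: differentiable_on_def)
    then show "g differentiable (at x within S)"
      by (rule differentiable_transform_within[where d = 1]) (use x Suc.prems(3) in auto)
  qed
  ultimately show ?case by simp
qed

lemma Ck_on_SucD: "Ck_on (Suc k) S f \<Longrightarrow> Ck_on k S f"
  by (induction k arbitrary: f) auto

lemma Ck_on_le: "Ck_on k S f \<Longrightarrow> j \<le> k \<Longrightarrow> Ck_on j S f"
  by (induction k) (auto simp del: Ck_on.simps dest: Ck_on_SucD simp: le_Suc_eq)

lemma Ck_on_continuous: "Ck_on k S f \<Longrightarrow> continuous_on S f"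
  by (cases k) auto

lemma Ck_on_differentiable: "Ck_on (Suc k) S f \<Longrightarrow> open S \<Longrightarrow> x \<in> S \<Longrightarrow> f differentiable (at x)"
  using at_within_open[of x S] by (simp add: differentiable_on_def) metis

lemma Ck_on_sum:
  fixes f :: "'b \<Rightarrow> real^'n::finite \<Rightarrow> real"
  assumes "open S" "finite A" "\<And>j. j \<in> A \<Longrightarrow> Ck_on k S (f j)"
  shows "Ck_on k S (\<lambda>x. \<Sum>j\<in>A. f j x)"
  using assms(3)
proof (induction k arbitrary: f)
  case 0
  then show ?case by (auto intro: continuous_on_sum)
next
  case (Suc k)
  have "Ck_on k S (partial i (\<lambda>x. \<Sum>j\<in>A. f j x))" for i
  proof (rule Ck_on_cong[OF _ assms(1)])
    show "Ck_on k S (\<lambda>x. \<Sum>j\<in>A. partial i (f j) x)" using Suc by auto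
    show "(\<Sum>j\<in>A. partial i (f j) x) = partial i (\<lambda>x. \<Sum>j\<in>A. f j x) x" if "x \<in> S" for x
    proof -
      have "DERIV (\<lambda>t. \<Sum>j\<in>A. f j (x + t *\<^sub>R axis i 1)) 0 :> (\<Sum>j\<in>A. partial i (f j) x)"
        by (intro DERIV_sum DERIV_partial Ck_on_differentiable[OF Suc.prems assms(1) that])
      then show ?thesis unfolding partial_def[of i "\<lambda>x. \<Sum>j\<in>A. f j x"] by (rule DERIV_imp_deriv[symmetric])
    qed
  qed
  then show ?case
    using Suc.prems assms(2) by (auto intro!: continuous_on_sum differentiable_sum simp: differentiable_on_def)
qed

lemma Ck_on_laplacian:
  assumes "open S" "Ck_on (Suc (Suc k)) S f"
  shows "Ck_on k S (laplacian f)"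
  unfolding laplacian_def by (rule Ck_on_sum) (use assms in auto)

text \<open>The i-th field v p_i - \<psi> \<partial>_i v has i-th derivative v q_i - \<psi>
  \<partial>_i \<partial>_i v, since the first-order cross terms cancel. Each coordinate thus needs
  a single use of \<open>integral_directional_derivative_eq_0\<close>.\<close>

lemma green_identity:
  fixes v \<psi> :: "real^'n::finite \<Rightarrow> real"
  assumes S: "open S" "compact K" "K \<subseteq> S" and v: "Ck_on 2 S v"
    and \<psi>: "\<And>x. x \<notin> K \<Longrightarrow> \<psi> x = 0" "continuous_on UNIV \<psi>"
      "\<And>i. continuous_on UNIV (p i)" "\<And>i. continuous_on UNIV (q i)"
      "\<And>i x. DERIV (\<lambda>t. \<psi> (x + t *\<^sub>R axis i 1)) 0 :> p i x"
      "\<And>i x. DERIV (\<lambda>t. p i (x + t *\<^sub>R axis i 1)) 0 :> q i x"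
  shows "integral\<^sup>L lborel (\<lambda>x. indicator K x * (v x * (\<Sum>i\<in>UNIV. q i x))) =
    integral\<^sup>L lborel (\<lambda>x. indicator K x * (laplacian v x * \<psi> x))"
proof -
  have oK: "open (- K)" using S(2) by (simp add: compact_imp_closed open_Compl)
  have line: "open ((\<lambda>t::real. x + t *\<^sub>R axis i 1) -` A)" if "open A" for A and x :: "real^'n" and i
    using that by (intro open_vimage continuous_intros)
  have zero: "D = 0" if "\<And>x. x \<notin> K \<Longrightarrow> f x = 0" "x \<notin> K" "DERIV (\<lambda>t. f (x + t *\<^sub>R axis i 1)) 0 :> D"
    for f :: "real^'n \<Rightarrow> real" and x i D
  proof -
    have "DERIV (\<lambda>_. 0::real) 0 :> D"
      by (rule DERIV_cong_open[OF line[OF oK] _ _ that(3)]) (use that in auto)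
    then show ?thesis using DERIV_unique[OF _ DERIV_const] by blast
  qed
  have p0: "p i x = 0" if "x \<notin> K" for i x using zero[OF \<psi>(1) that \<psi>(5)] .
  have q0: "q i x = 0" if "x \<notin> K" for i x using zero[OF p0 that \<psi>(6)] .
  have v2: "Ck_on (Suc (Suc 0)) S v" using v by (simp add: numeral_2_eq_2)
  have vc: "continuous_on S v" "continuous_on S (partial i v)" "continuous_on S (partial i (partial i v))" for i
    using v2 by auto
  define F where "F = (\<lambda>i x. if x \<in> S then v x * p i x - \<psi> x * partial i v x else 0)"
  define G where "G = (\<lambda>i x. if x \<in> S then v x * q i x - \<psi> x * partial i (partial i v) x else 0)"
  \<comment> \<open>v is controlled on S only. S and the complement of K are open and cover the
    space, so extension by zero keeps continuity.\<close>
  have glue: "continuous_on UNIV f" if "continuous_on S f" "\<And>x. x \<notin> K \<Longrightarrow> f x = 0" for f :: "real^'n \<Rightarrow> real"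
  proof -
    have "continuous_on (- K) f \<longleftrightarrow> continuous_on (- K) (\<lambda>_. 0::real)"
      using that(2) by (intro continuous_on_cong) auto
    then have "continuous_on (S \<union> - K) f" by (intro continuous_on_open_Un S oK that) simp
    moreover have "S \<union> - K = UNIV" using S(3) by auto
    ultimately show ?thesis by simp
  qed
  have Fc: "continuous_on UNIV (F i)" for i
  proof (rule glue)
    have "continuous_on S (\<lambda>x. v x * p i x - \<psi> x * partial i v x)"
      by (intro continuous_intros vc continuous_on_subset[OF \<psi>(2)] continuous_on_subset[OF \<psi>(3)]) auto
    then show "continuous_on S (F i)" by (simp add: F_def cong: continuous_on_cong)
    show "F i x = 0" if "x \<notin> K" for x using that \<psi>(1) p0 by (simp add: F_def)
  qed
  have G0: "G i x = 0" if "x \<notin> K" for i x using that \<psi>(1) q0 by (simp add: G_def)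
  have Gc: "continuous_on UNIV (G i)" for i
  proof (rule glue)
    have "continuous_on S (\<lambda>x. v x * q i x - \<psi> x * partial i (partial i v) x)"
      by (intro continuous_intros vc continuous_on_subset[OF \<psi>(2)] continuous_on_subset[OF \<psi>(4)]) auto
    then show "continuous_on S (G i)" by (simp add: G_def cong: continuous_on_cong)
  qed (rule G0)
  have "integral\<^sup>L lborel (G i) = 0" for i
  proof (rule integral_directional_derivative_eq_0[OF S(2) _ Fc Gc])
    show "F i x = 0" if "x \<notin> K" for x using that \<psi>(1) p0 by (simp add: F_def)
    show "DERIV (\<lambda>t. F i (x + t *\<^sub>R axis i 1)) 0 :> G i x" for x
    proof (cases "x \<in> S")
      case True
      have dv: "DERIV (\<lambda>t. v (x + t *\<^sub>R axis i 1)) 0 :> partial i v x"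
        by (rule DERIV_partial[OF Ck_on_differentiable[OF v2 S(1) True]])
      have "Ck_on (Suc 0) S (partial i v)" using v2 by simp
      then have dpv: "DERIV (\<lambda>t. partial i v (x + t *\<^sub>R axis i 1)) 0 :> partial i (partial i v) x"
        by (rule DERIV_partial[OF Ck_on_differentiable[OF _ S(1) True]])
      have "DERIV (\<lambda>t. v (x + t *\<^sub>R axis i 1) * p i (x + t *\<^sub>R axis i 1) -
          \<psi> (x + t *\<^sub>R axis i 1) * partial i v (x + t *\<^sub>R axis i 1)) 0 :> G i x"
        using DERIV_diff[OF DERIV_mult[OF dv \<psi>(6)[where i = i and x = x]] DERIV_mult[OF \<psi>(5)[where i = i and x = x] dpv]] True
        by (simp add: G_def algebra_simps)
      then show ?thesis
        by (rule DERIV_cong_open[OF line[OF S(1)], rotated 2]) (use True in \<open>auto simp: F_def\<close>)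
    next
      case False
      have "DERIV (\<lambda>_. 0::real) 0 :> G i x" using False by (simp add: G_def)
      then show ?thesis
        by (rule DERIV_cong_open[OF line[OF oK, of x i], rotated 2])
          (use False S(3) \<psi>(1) p0 in \<open>auto simp: F_def\<close>)
    qed
  qed
  moreover have Gi: "integrable lborel (G i)" for i
  proof -
    have eq: "(\<lambda>x. indicator K x * G i x) = G i" using G0 by (auto simp: indicator_def fun_eq_iff)
    have "integrable lborel (\<lambda>x. indicator K x * G i x)"
      by (rule integrable_on_compact[OF S(2) continuous_on_subset[OF Gc]]) simp
    then show ?thesis by (simp only: eq)
  qed
  ultimately have "integral\<^sup>L lborel (\<lambda>x. \<Sum>i\<in>UNIV. G i x) = 0"
    by (subst Bochner_Integration.integral_sum) auto
  moreover have "(\<Sum>i\<in>UNIV. G i x) = indicator K x * (v x * (\<Sum>i\<in>UNIV. q i x)) -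
      indicator K x * (laplacian v x * \<psi> x)" for x
  proof (cases "x \<in> K")
    case True
    then show ?thesis using S(3)
      by (auto simp: G_def laplacian_def sum_subtractf sum_distrib_left sum_distrib_right mult.commute)
  qed (use G0 in simp)
  moreover have "integrable lborel (\<lambda>x. indicator K x * (v x * (\<Sum>i\<in>UNIV. q i x)))"
    using S by (intro integrable_on_compact continuous_intros continuous_on_subset[OF vc(1)]
        continuous_on_subset[OF \<psi>(4)]) auto
  moreover have "integrable lborel (\<lambda>x. indicator K x * (laplacian v x * \<psi> x))"
    using S unfolding laplacian_def
    by (intro integrable_on_compact continuous_intros continuous_on_subset[OF vc(3)]
        continuous_on_subset[OF \<psi>(2)]) auto
  ultimately show ?thesis by simp
qed

text \<open>Composing H with |y - z|^2 instead of |y - z| keeps all derivatives continuous at y = z.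
  T is an open set around the half-line so that two-sided derivatives of H exist at s = 0.\<close>

lemma green_radial:
  fixes u :: "real^'n::finite \<Rightarrow> real"
  assumes S: "open S" "compact K" "K \<subseteq> S" and u: "Ck_on 2 S u"
    and T: "open T" "{0..} \<subseteq> T" and H: "symbol 2 b B T H"
    and supp: "\<And>y. y \<notin> K \<Longrightarrow> H ((norm (y - z))\<^sup>2) = 0"
  shows "integral\<^sup>L lborel (\<lambda>y. indicator K y * (u y * Lop (real CARD('n)) H ((norm (y - z))\<^sup>2))) =
    integral\<^sup>L lborel (\<lambda>y. indicator K y * (laplacian u y * H ((norm (y - z))\<^sup>2)))"
proof -
  define N where "N = (\<lambda>y. (norm (y - z))\<^sup>2)"
  define p where "p = (\<lambda>i y. deriv H (N y) * (2 * (y - z) $ i))"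
  define q where "q = (\<lambda>i y. deriv (deriv H) (N y) * (2 * (y - z) $ i) * (2 * (y - z) $ i) + deriv H (N y) * 2)"
  have NT: "N y \<in> T" for y using T(2) by (auto simp: N_def)
  have H1: "DERIV H s :> deriv H s" and H2: "DERIV (deriv H) s :> deriv (deriv H) s" if "s \<in> T" for s
    using H that by (auto simp: numeral_2_eq_2 DERIV_deriv_iff_real_differentiable)
  have Hc: "continuous_on T H" "continuous_on T (deriv H)" "continuous_on T (deriv (deriv H))"
  proof -
    have "symbol (Suc 0) (b - 1) B T (deriv H)" "symbol 0 (b - 1 - 1) B T (deriv (deriv H))"
      using H by (auto simp: numeral_2_eq_2)
    then show "continuous_on T H" "continuous_on T (deriv H)" "continuous_on T (deriv (deriv H))"
      using H symbol_continuous by blast+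
  qed
  have Nline: "N (x + t *\<^sub>R axis i 1) = N x + t * (2 * (x - z) $ i) + t\<^sup>2" for x t i
  proof -
    have "N (x + t *\<^sub>R axis i 1) = ((x - z) + t *\<^sub>R axis i 1) \<bullet> ((x - z) + t *\<^sub>R axis i 1)"
      unfolding N_def power2_norm_eq_inner by (simp add: algebra_simps)
    also have "\<dots> = (x - z) \<bullet> (x - z) + t * (2 * (x - z) $ i) + t\<^sup>2"
      by (simp add: inner_add_left inner_add_right inner_axis inner_axis' power2_eq_square algebra_simps)
    finally show ?thesis by (simp add: N_def power2_norm_eq_inner)
  qed
  have comp: "DERIV (\<lambda>t. h (N (x + t *\<^sub>R axis i 1))) 0 :> h' * (2 * (x - z) $ i)"
    if "DERIV h (N x) :> h'" for h h' x i
  proof (rule DERIV_chain2[where f = h])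
    show "DERIV h (N (x + 0 *\<^sub>R axis i 1)) :> h'" using that by simp
    show "DERIV (\<lambda>t. N (x + t *\<^sub>R axis i 1)) 0 :> 2 * (x - z) $ i"
      unfolding Nline by (auto intro!: derivative_eq_intros)
  qed
  have Nc: "continuous_on UNIV N" unfolding N_def by (intro continuous_intros)
  have cc: "continuous_on UNIV (\<lambda>y. h (N y))" if "continuous_on T h" for h :: "real \<Rightarrow> real"
    by (rule continuous_on_compose2[OF that Nc]) (use NT in auto)
  have "integral\<^sup>L lborel (\<lambda>y. indicator K y * (u y * (\<Sum>i\<in>UNIV. q i y))) =
    integral\<^sup>L lborel (\<lambda>y. indicator K y * (laplacian u y * H (N y)))"
  proof (rule green_identity[OF S u, where p = p])
    show "DERIV (\<lambda>t. H (N (x + t *\<^sub>R axis i 1))) 0 :> p i x" for i x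
      unfolding p_def by (rule comp[OF H1[OF NT]])
    show "DERIV (\<lambda>t. p i (x + t *\<^sub>R axis i 1)) 0 :> q i x" for i x
    proof -
      have "DERIV (\<lambda>t. 2 * (x + t *\<^sub>R axis i 1 - z) $ i) 0 :> 2"
        by (auto intro!: derivative_eq_intros simp: axis_def)
      from DERIV_mult[OF comp[OF H2[OF NT[of x]], of i] this] show ?thesis
        unfolding p_def q_def by (simp add: algebra_simps)
    qed
    show "continuous_on UNIV (p i)" "continuous_on UNIV (q i)" for i
      unfolding p_def q_def by (intro continuous_intros cc Hc)+
  qed (use supp cc Hc in \<open>auto simp: N_def\<close>)
  moreover have "(\<Sum>i\<in>UNIV. q i y) = Lop (real CARD('n)) H (N y)" for y
  proof -
    have "N y = (\<Sum>i\<in>UNIV. ((y - z) $ i)\<^sup>2)"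
      by (simp add: N_def norm_vec_def L2_set_def sum_nonneg)
    moreover have "q i y = 4 * deriv (deriv H) (N y) * ((y - z) $ i)\<^sup>2 + 2 * deriv H (N y)" for i
      by (simp add: q_def power2_eq_square algebra_simps)
    then have "(\<Sum>i\<in>UNIV. q i y) = 4 * deriv (deriv H) (N y) * (\<Sum>i\<in>UNIV. ((y - z) $ i)\<^sup>2) +
        2 * real CARD('n) * deriv H (N y)"
      by (simp only: sum.distrib sum_distrib_left) simp
    ultimately show ?thesis by (simp only: Lop_def mult_ac)
  qed
  ultimately show ?thesis by (simp add: N_def)
qed

lemma Lop_funpow_zero: "(Lop n ^^ i) (\<lambda>_. 0) = (\<lambda>_. 0)"
  by (induction i) (simp_all add: Lop_def)

text \<open>Induction moves the outermost \<open>Lop\<close> onto u and continues with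
  \<open>laplacian u\<close>. H is required to vanish on the open set Q, not just at single values,
  so that its iterates vanish there as well.\<close>

lemma green_iterated:
  fixes u :: "real^'n::finite \<Rightarrow> real"
  assumes S: "open S" "compact K" "K \<subseteq> S" and u: "Ck_on (2 * m) S u"
    and T: "open T" "{0..} \<subseteq> T" and H: "symbol (2 * m) b B T H" "0 \<le> B"
    and supp: "open Q" "\<And>s. s \<in> Q \<Longrightarrow> H s = 0" "\<And>y. y \<notin> K \<Longrightarrow> (norm (y - z))\<^sup>2 \<in> Q"
  shows "integral\<^sup>L lborel (\<lambda>y. indicator K y * (u y * (Lop (real CARD('n)) ^^ m) H ((norm (y - z))\<^sup>2))) =
    integral\<^sup>L lborel (\<lambda>y. indicator K y * (iter_laplacian m u y * H ((norm (y - z))\<^sup>2)))"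
  using u H(1)
proof (induction m arbitrary: u)
  case 0
  then show ?case by (simp add: iter_laplacian_def)
next
  case (Suc m)
  let ?n = "real CARD('n)"
  obtain C where "\<And>p B T f. open T \<Longrightarrow> 0 \<le> B \<Longrightarrow> symbol (2 + 2 * m) p B T f \<Longrightarrow>
      symbol 2 (p - real m) (C * B) T ((Lop ?n ^^ m) f)"
    using symbol_Lop_funpow[of 2 m ?n] by blast
  from this[OF T(1) H(2)] Suc.prems(2) have C: "symbol 2 (b - real m) (C * B) T ((Lop ?n ^^ m) H)"
    by (simp del: symbol.simps)
  have zero: "(Lop ?n ^^ m) H ((norm (y - z))\<^sup>2) = 0" if "y \<notin> K" for y
    using Lop_funpow_cong[OF supp(1), where f = H and g = "\<lambda>_. 0" and s = "(norm (y - z))\<^sup>2" and n = ?n and i = m] supp(2) supp(3)[OF that]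
    by (simp add: Lop_funpow_zero)
  have u2: "Ck_on 2 S u" by (rule Ck_on_le[OF Suc.prems(1)]) simp
  have "Ck_on (Suc (Suc (2 * m))) S u" using Suc.prems(1) by (simp del: Ck_on.simps)
  then have lu: "Ck_on (2 * m) S (laplacian u)" by (rule Ck_on_laplacian[OF S(1)])
  have Hm: "symbol (2 * m) b B T H" by (rule symbol_le[OF Suc.prems(2)]) simp
  have "integral\<^sup>L lborel (\<lambda>y. indicator K y * (u y * (Lop ?n ^^ Suc m) H ((norm (y - z))\<^sup>2))) =
    integral\<^sup>L lborel (\<lambda>y. indicator K y * (laplacian u y * (Lop ?n ^^ m) H ((norm (y - z))\<^sup>2)))"
    using green_radial[OF S u2 T C zero] by simp
  also have "\<dots> = integral\<^sup>L lborel (\<lambda>y. indicator K y * (iter_laplacian m (laplacian u) y * H ((norm (y - z))\<^sup>2)))"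
    by (rule Suc.IH[OF lu Hm])
  finally show ?case by (simp add: iter_laplacian_def funpow_swap1)
qed

section \<open>Integral bounds near the singularity\<close>

lemma Lop_scale:
  assumes "symbol 2 p B UNIV f" "e > 0"
  shows "Lop n (\<lambda>s. k * f (s / e)) = (\<lambda>s. k / e * Lop n f (s / e))"
proof
  fix s
  have D1: "DERIV f x :> deriv f x" and D2: "DERIV (deriv f) x :> deriv (deriv f) x" for x
    using assms(1) by (auto simp: numeral_2_eq_2 DERIV_deriv_iff_real_differentiable)
  have E1: "DERIV (\<lambda>s. k * f (s / e)) x :> k * (deriv f (x / e) * (1 / e))" for x
    by (intro DERIV_cmult DERIV_chain2[OF D1]) (use assms(2) in \<open>auto intro!: derivative_eq_intros\<close>)
  have E2: "DERIV (\<lambda>x. k * (deriv f (x / e) * (1 / e))) s :> k * (deriv (deriv f) (s / e) * (1 / e) * (1 / e))"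
    by (intro DERIV_cmult DERIV_cmult_right DERIV_chain2[OF D2])
      (use assms(2) in \<open>auto intro!: derivative_eq_intros\<close>)
  have "Lop n (\<lambda>s. k * f (s / e)) s = 4 * (s * (k * (deriv (deriv f) (s / e) * (1 / e) * (1 / e)))) +
      2 * n * (k * (deriv f (s / e) * (1 / e)))"
    by (rule Lop_eqI[OF open_UNIV UNIV_I E1 E2])
  then show "Lop n (\<lambda>s. k * f (s / e)) s = k / e * Lop n f (s / e)"
    using assms(2) by (simp add: Lop_def field_simps)
qed

lemma Lop_funpow_hfun_scale:
  assumes "n \<ge> 4" "e > 0"
  shows "(Lop n ^^ j) (\<lambda>s. k * hfun n j (s / e)) = (\<lambda>s. k / e ^ j * hseed n (s / e))"
proof (induction j arbitrary: k)
  case 0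
  then show ?case by (simp add: hfun_0)
next
  case (Suc j)
  obtain B where "symbol (2 * Suc j) (real j) B UNIV (hfun n (Suc j))"
    using symbol_hfun[OF assms(1)] by blast
  then have "symbol 2 (real j) B UNIV (hfun n (Suc j))" by (rule symbol_le) simp
  from Lop_scale[OF this assms(2), of n k] show ?case
    using Suc[of "k / e"] by (simp add: funpow_swap1 Lop_hfun)
qed

lemma integrable_on_compact_subset:
  fixes F :: "'a::euclidean_space \<Rightarrow> real"
  assumes "compact K" "continuous_on S F" "K \<subseteq> S"
  shows "integrable lborel (\<lambda>x. indicator K x * F x)"
  using assms by (intro integrable_on_compact continuous_on_subset[of S F K])

lemma indicator_integral_nonneg:
  fixes F :: "'a::euclidean_space \<Rightarrow> real"
  shows "(\<And>x. x \<in> K \<Longrightarrow> 0 \<le> F x) \<Longrightarrow> 0 \<le> integral\<^sup>L lborel (\<lambda>x. indicator K x * F x)"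
  by (intro integral_nonneg_AE AE_I2) (auto simp: indicator_def)

lemma compact_annulus: "compact {x::'a::euclidean_space. a \<le> (norm x)\<^sup>2 \<and> (norm x)\<^sup>2 \<le> b}"
proof (rule compact_eq_bounded_closed[THEN iffD2], intro conjI)
  show "bounded {x::'a. a \<le> (norm x)\<^sup>2 \<and> (norm x)\<^sup>2 \<le> b}"
    unfolding bounded_iff
    by (intro exI[of _ "sqrt b"]) (auto intro: real_le_rsqrt)
  show "closed {x::'a. a \<le> (norm x)\<^sup>2 \<and> (norm x)\<^sup>2 \<le> b}"
    by (intro closed_Collect_conj closed_Collect_le continuous_intros)
qed

locale polyharmonic_inequality =
  fixes u :: "real^'n::finite \<Rightarrow> real" and m :: nat
  assumes m_pos: "1 \<le> m" and dim: "2 * m < CARD('n)" "4 \<le> CARD('n)"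
    and smooth: "Ck_on (2 * m) (ball 0 2 - {0}) u"
    and u_nonneg: "\<And>x. x \<in> ball 0 2 - {0} \<Longrightarrow> 0 \<le> u x"
    and g_nonneg: "\<And>x. x \<in> ball 0 2 - {0} \<Longrightarrow> 0 \<le> - iter_laplacian m u x"
begin

abbreviation punctured :: "(real^'n) set" where "punctured \<equiv> ball 0 2 - {0}"

definition g :: "real^'n \<Rightarrow> real" where "g x = - iter_laplacian m u x"

lemma open_punctured: "open punctured" by (intro open_Diff) auto

lemma u_cont: "continuous_on punctured u" using Ck_on_continuous[OF smooth] .

lemma g_cont: "continuous_on punctured g"
proof -
  have "Ck_on 0 S (iter_laplacian k v)" if "open S" "Ck_on (2 * k) S v" for k S and v :: "real^'n \<Rightarrow> real"
    using that(2)
  proof (induction k arbitrary: v)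
    case (Suc k)
    have "Ck_on (Suc (Suc (2 * k))) S v" using Suc.prems by (simp del: Ck_on.simps)
    from Suc.IH[OF Ck_on_laplacian[OF that(1) this]] show ?case
      by (simp add: iter_laplacian_def funpow_swap1)
  qed (simp add: iter_laplacian_def)
  from this[OF open_punctured smooth] show ?thesis
    unfolding g_def by (auto intro: continuous_intros)
qed

lemma g_nonneg': "x \<in> punctured \<Longrightarrow> 0 \<le> g x" using g_nonneg by (simp add: g_def)

lemma annulus_subset: "0 < a \<Longrightarrow> b < 4 \<Longrightarrow> {x. a \<le> (norm x)\<^sup>2 \<and> (norm x)\<^sup>2 \<le> b} \<subseteq> punctured"
proof
  fix x :: "real^'n" assume "0 < a" "b < 4" "x \<in> {x. a \<le> (norm x)\<^sup>2 \<and> (norm x)\<^sup>2 \<le> b}"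
  then show "x \<in> punctured" using power2_less_imp_less[of "norm x" 2] by auto
qed

text \<open>The test function is the cut-off times e^(m-1) h(|x|^2/e) with h the m-fold \<open>Jop\<close>-iterate of
  \<open>hseed\<close>.\<close>

lemma dyadic_bounds:
  "\<exists>C A. 0 \<le> C \<and> 1 \<le> A \<and> (\<forall>e. 0 < e \<longrightarrow> 32 * e < 1 \<longrightarrow>
     integral\<^sup>L lborel (\<lambda>x. indicator {x. A * e \<le> (norm x)\<^sup>2 \<and> (norm x)\<^sup>2 \<le> 1} x *
        (g x * ((norm x)\<^sup>2) ^ (m - 1))) \<le> C \<and>
     integral\<^sup>L lborel (\<lambda>x. indicator {x. 2 * e \<le> (norm x)\<^sup>2 \<and> (norm x)\<^sup>2 \<le> 32 * e} x * u x) \<le> C * e)"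
proof -
  define n where "n = real CARD('n)"
  have n: "n \<ge> 4" using dim by (simp add: n_def)
  obtain j where j: "m = Suc j" using m_pos by (cases m) auto
  obtain Bh where Bh: "Bh \<ge> 0" "symbol (2 * m) (real j) Bh UNIV (hfun n m)"
    using symbol_hfun[OF n, of j] unfolding j by blast
  obtain \<phi> B\<phi> where \<phi>: "0 \<le> B\<phi>" "symbol (2 * m) 0 B\<phi> UNIV \<phi>" "\<And>s. s \<le> 1 \<Longrightarrow> \<phi> s = 1"
    "\<And>s. s \<ge> 2 \<Longrightarrow> \<phi> s = 0" "\<And>s. 0 \<le> \<phi> s \<and> \<phi> s \<le> 1"
    using cutoff_exists[of "2 * m"] by blast
  obtain c A where cA: "c > 0" "A \<ge> 1" "\<And>s. s \<ge> A \<Longrightarrow> c * s ^ j \<le> hfun n m s"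
    using hfun_lower[of n j] n unfolding j by auto
  define B where "B = 2 ^ (2 * m) * (B\<phi> * Bh)"
  have B: "B \<ge> 0" using \<phi>(1) Bh(1) by (simp add: B_def)
  obtain D where D: "D \<ge> 0" "\<And>p B T f. open T \<Longrightarrow> 0 \<le> B \<Longrightarrow> symbol (0 + 2 * m) p B T f \<Longrightarrow>
     symbol 0 (p - real m) (D * B) T ((Lop n ^^ m) f)"
    using symbol_Lop_funpow[of 0 m n] by blast
  define E where "E = D * B"
  have E: "E \<ge> 0" using D B by (simp add: E_def)
  \<comment> \<open>Lower bound of the seed for 2 \<le> s/e \<le> 32: there (s/e)^(-n) \<ge> 32^(-n)
    and s/e - 1 \<ge> 1.\<close>
  define c' where "c' = 32 powr (- n)"
  have c': "c' > 0" by (simp add: c'_def)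
  \<comment> \<open>The only error mass: u on the fixed shell where the cut-off varies, independent
    of e.\<close>
  define U where "U = integral\<^sup>L lborel (\<lambda>x::real^'n. indicator {x. 1 \<le> (norm x)\<^sup>2 \<and> (norm x)\<^sup>2 \<le> 2} x * u x)"
  have U: "U \<ge> 0" unfolding U_def
    using annulus_subset[of 1 2] by (intro indicator_integral_nonneg u_nonneg) auto
  define C where "C = E * U / c + E * U / c'"
  have main: "c * integral\<^sup>L lborel (\<lambda>x. indicator {x. A * e \<le> (norm x)\<^sup>2 \<and> (norm x)\<^sup>2 \<le> 1} x *
        (g x * ((norm x)\<^sup>2) ^ j)) +
     c' / e * integral\<^sup>L lborel (\<lambda>x. indicator {x. 2 * e \<le> (norm x)\<^sup>2 \<and> (norm x)\<^sup>2 \<le> 32 * e} x * u x) \<le> E * U"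
    if e: "0 < e" "32 * e < 1" for e
  proof -
    define H where "H = (\<lambda>s. \<phi> s * (e powr real j * hfun n m (s / e)))"
    have "symbol (2 * m) (real j) Bh {s. s / e \<in> UNIV} (\<lambda>s. e powr real j * hfun n m (s / e))"
      by (intro symbol_scale Bh e) auto
    then have "symbol (2 * m) (0 + real j) B UNIV H"
      unfolding H_def B_def by (intro symbol_mult \<phi> Bh) auto
    then have Hs: "symbol (2 * m) (real j) B UNIV H" by simp
    have HL: "symbol 0 (real j - real m) E UNIV ((Lop n ^^ m) H)"
      unfolding E_def by (rule D(2)) (use B Hs in auto)
    \<comment> \<open>The symbol constant E does not depend on e, because the dilation by e
      preserved it; the order is j - m = -1, so the bound is at most E for s \<ge> 1.\<close>
    have far: "\<bar>(Lop n ^^ m) H s\<bar> \<le> E" if "s \<ge> 1" for s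
    proof -
      have "\<bar>(Lop n ^^ m) H s\<bar> \<le> E * s powr (- 1)" using symbol_bound[OF HL, of s] that by (simp add: j)
      also have "\<dots> \<le> E * 1" using that E by (intro mult_left_mono) (auto simp: powr_minus field_simps)
      finally show ?thesis by simp
    qed
    have near: "(Lop n ^^ m) H s = hseed n (s / e) / e" if "s < 1" for s
    proof -
      have "(Lop n ^^ m) H s = (Lop n ^^ m) (\<lambda>s. e powr real j * hfun n m (s / e)) s"
        by (rule Lop_funpow_cong[of "{..<1}"]) (use that \<phi>(3) in \<open>auto simp: H_def\<close>)
      also have "\<dots> = e powr real j / e ^ m * hseed n (s / e)"
        using Lop_funpow_hfun_scale[OF n e(1)] by simp
      also have "e powr real j / e ^ m = 1 / e" using e by (simp add: powr_realpow j)
      finally show ?thesis by simp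
    qed
    have H0: "0 \<le> H s" for s unfolding H_def using \<phi>(5)[of s] hfun_nonneg by simp
    define K where "K = {x::real^'n. e \<le> (norm x)\<^sup>2 \<and> (norm x)\<^sup>2 \<le> 2}"
    have K: "compact K" "K \<subseteq> punctured"
      unfolding K_def using compact_annulus annulus_subset[of e 2] e by auto
    have green: "integral\<^sup>L lborel (\<lambda>y. indicator K y * (u y * (Lop n ^^ m) H ((norm (y - 0))\<^sup>2))) =
      integral\<^sup>L lborel (\<lambda>y. indicator K y * (iter_laplacian m u y * H ((norm (y - 0))\<^sup>2)))"
      unfolding n_def
    proof (rule green_iterated[OF open_punctured K smooth open_UNIV _ Hs B])
      \<comment> \<open>Below e the test function vanishes identically, so the singularity of u at
        the origin never enters; above 2 the cut-off vanishes.\<close>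
      show "open ({..<e} \<union> {2<..})" by auto
      show "H s = 0" if "s \<in> {..<e} \<union> {2<..}" for s
        using that \<phi>(4)[of s] hfun_eq_0[of n m, rule_format, of "s / e"] e by (auto simp: H_def)
    qed (auto simp: K_def)
    have cN: "continuous_on X (\<lambda>y. f ((norm y)\<^sup>2))" if "continuous_on UNIV f" for f :: "real \<Rightarrow> real" and X :: "(real^'n) set"
      by (rule continuous_on_compose2[OF that]) (auto intro!: continuous_intros)
    have Hc: "continuous_on UNIV H" "continuous_on UNIV ((Lop n ^^ m) H)"
      using symbol_continuous[OF Hs] symbol_continuous[OF HL] by auto
    have i1: "integrable lborel (\<lambda>y. indicator K y * (g y * H ((norm y)\<^sup>2)))"
      by (rule integrable_on_compact_subset[OF K(1) _ K(2)]) (intro continuous_intros g_cont cN Hc)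
    have i2: "integrable lborel (\<lambda>y. indicator K y * (u y * (Lop n ^^ m) H ((norm y)\<^sup>2)))"
      by (rule integrable_on_compact_subset[OF K(1) _ K(2)]) (intro continuous_intros u_cont cN Hc)
    define K1 where "K1 = {x::real^'n. A * e \<le> (norm x)\<^sup>2 \<and> (norm x)\<^sup>2 \<le> 1}"
    define K2 where "K2 = {x::real^'n. 2 * e \<le> (norm x)\<^sup>2 \<and> (norm x)\<^sup>2 \<le> 32 * e}"
    define K3 where "K3 = {x::real^'n. 1 \<le> (norm x)\<^sup>2 \<and> (norm x)\<^sup>2 \<le> 2}"
    have sub: "K1 \<subseteq> punctured" "K2 \<subseteq> punctured" "K3 \<subseteq> punctured"
    proof -
      have "0 < A * e" using e cA(2) by simp
      then show "K1 \<subseteq> punctured" "K2 \<subseteq> punctured" "K3 \<subseteq> punctured"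
        unfolding K1_def K2_def K3_def using e by (intro annulus_subset; simp)+
    qed
    have Kcomp: "compact K1" "compact K2" "compact K3"
      unfolding K1_def K2_def K3_def by (rule compact_annulus)+
    have j1: "integrable lborel (\<lambda>y. indicator K1 y * (g y * ((norm y)\<^sup>2) ^ j))"
      by (rule integrable_on_compact_subset[OF Kcomp(1) _ sub(1)]) (intro continuous_intros g_cont)
    have j2: "integrable lborel (\<lambda>y. indicator K2 y * u y)"
      by (rule integrable_on_compact_subset[OF Kcomp(2) u_cont sub(2)])
    have j3: "integrable lborel (\<lambda>y. indicator K3 y * u y)"
      by (rule integrable_on_compact_subset[OF Kcomp(3) u_cont sub(3)])
    have "integral\<^sup>L lborel (\<lambda>y. c * (indicator K1 y * (g y * ((norm y)\<^sup>2) ^ j)) +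
        c' / e * (indicator K2 y * u y) - E * (indicator K3 y * u y)) \<le>
      integral\<^sup>L lborel (\<lambda>y. indicator K y * (g y * H ((norm y)\<^sup>2)) +
        indicator K y * (u y * (Lop n ^^ m) H ((norm y)\<^sup>2)))"
    proof (rule integral_mono)
      fix y :: "real^'n"
      define s where "s = (norm y)\<^sup>2"
      have t1: "c * (indicator K1 y * (g y * s ^ j)) \<le> indicator K y * (g y * H s)"
      proof (cases "y \<in> K")
        case True
        then have y: "y \<in> punctured" using K(2) by auto
        show ?thesis
        proof (cases "y \<in> K1")
          case 1: True
          then have s: "A \<le> s / e" "s \<le> 1" using e by (auto simp: K1_def s_def field_simps)
          have "c * s ^ j = e powr real j * (c * (s / e) ^ j)"
            using e by (simp add: powr_realpow power_divide)
          also have "\<dots> \<le> e powr real j * hfun n m (s / e)" by (intro mult_left_mono cA s) auto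
          also have "\<dots> = H s" using \<phi>(3)[OF s(2)] by (simp add: H_def)
          finally have "g y * (c * s ^ j) \<le> g y * H s" using g_nonneg'[OF y] by (rule mult_left_mono)
          then show ?thesis using 1 True by (simp add: mult_ac)
        qed (use True H0 g_nonneg'[OF y] in simp)
      next
        case False
        have "e \<le> A * e" using cA(2) e by simp
        then have "y \<notin> K1" using False by (auto simp: K_def K1_def)
        then show ?thesis using False by simp
      qed
      have t2: "c' / e * (indicator K2 y * u y) - E * (indicator K3 y * u y) \<le>
          indicator K y * (u y * (Lop n ^^ m) H s)"
      proof (cases "y \<in> K")
        case True
        then have y: "0 \<le> u y" by (intro u_nonneg subsetD[OF K(2)])
        show ?thesis
        proof (cases "s < 1")
          case 1: True
          have "y \<notin> K3" using 1 by (simp add: K3_def s_def)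
          moreover have "indicator K2 y * c' / e \<le> hseed n (s / e) / e"
          proof (cases "y \<in> K2")
            case 2: True
            then have se: "2 \<le> s / e" "s / e \<le> 32" using e by (auto simp: K2_def s_def field_simps)
            have "32 powr (- n) * 1 \<le> (s / e) powr (- n) * max 0 (s / e - 1)"
              by (intro mult_mono powr_mono2') (use se n in auto)
            then show ?thesis using 2 e by (simp add: c'_def hseed_def divide_right_mono)
          qed (use hseed(3) e in simp)
          then have "u y * (indicator K2 y * c' / e) \<le> u y * (Lop n ^^ m) H s"
            unfolding near[OF 1] using y by (rule mult_left_mono)
          ultimately show ?thesis using True by (simp add: mult_ac)
        next
          case 1: False
          have "y \<notin> K2" using 1 e by (auto simp: K2_def s_def)
          moreover have "y \<in> K3" using 1 True by (auto simp: K3_def K_def s_def)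
          moreover have "u y * (- E) \<le> u y * (Lop n ^^ m) H s"
            using far[of s] 1 by (intro mult_left_mono y) auto
          ultimately show ?thesis using True by (simp add: mult_ac)
        qed
      next
        case False
        then have "y \<notin> K2" "y \<notin> K3" using e by (auto simp: K_def K2_def K3_def)
        then show ?thesis using False by simp
      qed
      show "c * (indicator K1 y * (g y * ((norm y)\<^sup>2) ^ j)) +
        c' / e * (indicator K2 y * u y) - E * (indicator K3 y * u y) \<le>
        indicator K y * (g y * H ((norm y)\<^sup>2)) + indicator K y * (u y * (Lop n ^^ m) H ((norm y)\<^sup>2))"
        using t1 t2 unfolding s_def by linarith
    qed (intro Bochner_Integration.integrable_add Bochner_Integration.integrable_diff integrable_mult_right i1 i2 j1 j2 j3)+
    also have "\<dots> = 0"
    proof -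
      have "integral\<^sup>L lborel (\<lambda>y. indicator K y * (iter_laplacian m u y * H ((norm (y - 0))\<^sup>2))) =
        - integral\<^sup>L lborel (\<lambda>y. indicator K y * (g y * H ((norm y)\<^sup>2)))"
        unfolding g_def by simp
      then show ?thesis
        using green by (simp add: Bochner_Integration.integral_add[OF i1 i2])
    qed
    finally have "integral\<^sup>L lborel (\<lambda>y. c * (indicator K1 y * (g y * ((norm y)\<^sup>2) ^ j)) +
        c' / e * (indicator K2 y * u y) - E * (indicator K3 y * u y)) \<le> 0" .
    moreover have "integral\<^sup>L lborel (\<lambda>y. c * (indicator K1 y * (g y * ((norm y)\<^sup>2) ^ j)) +
        c' / e * (indicator K2 y * u y) - E * (indicator K3 y * u y)) =
      c * integral\<^sup>L lborel (\<lambda>y. indicator K1 y * (g y * ((norm y)\<^sup>2) ^ j)) +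
      c' / e * integral\<^sup>L lborel (\<lambda>y. indicator K2 y * u y) - E * integral\<^sup>L lborel (\<lambda>y. indicator K3 y * u y)"
      using j1 j2 j3 by simp
    ultimately show ?thesis unfolding K1_def K2_def K3_def U_def by linarith
  qed
  have "integral\<^sup>L lborel (\<lambda>x. indicator {x. A * e \<le> (norm x)\<^sup>2 \<and> (norm x)\<^sup>2 \<le> 1} x *
        (g x * ((norm x)\<^sup>2) ^ (m - 1))) \<le> C \<and>
     integral\<^sup>L lborel (\<lambda>x. indicator {x. 2 * e \<le> (norm x)\<^sup>2 \<and> (norm x)\<^sup>2 \<le> 32 * e} x * u x) \<le> C * e"
    if e: "0 < e" "32 * e < 1" for e
  proof -
    define I1 where "I1 = integral\<^sup>L lborel (\<lambda>x. indicator {x. A * e \<le> (norm x)\<^sup>2 \<and> (norm x)\<^sup>2 \<le> 1} x *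
        (g x * ((norm x)\<^sup>2) ^ j))"
    define I2 where "I2 = integral\<^sup>L lborel (\<lambda>x. indicator {x. 2 * e \<le> (norm x)\<^sup>2 \<and> (norm x)\<^sup>2 \<le> 32 * e} x * u x)"
    have "I1 \<ge> 0" unfolding I1_def
      using annulus_subset[of "A * e" 1] e cA(2)
      by (intro indicator_integral_nonneg mult_nonneg_nonneg g_nonneg') auto
    moreover have "I2 \<ge> 0" unfolding I2_def
      using annulus_subset[of "2 * e" "32 * e"] e by (intro indicator_integral_nonneg u_nonneg) auto
    moreover have m: "c * I1 + c' / e * I2 \<le> E * U" using main[OF e] unfolding I1_def I2_def .
    ultimately have "c * I1 \<le> E * U" "c' / e * I2 \<le> E * U"
      using cA(1) c' e by (smt (verit, ccfv_SIG) divide_nonneg_nonneg mult_nonneg_nonneg)+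
    then have "I1 \<le> E * U / c" "I2 \<le> E * U / c' * e" using cA(1) c' e by (auto simp: field_simps)
    moreover have "E * U / c \<le> C" "E * U / c' \<le> C" using E U cA(1) c' by (auto simp: C_def)
    then have "E * U / c \<le> C" "E * U / c' * e \<le> C * e" using e by (auto intro!: mult_right_mono simp del: times_divide_eq_left)
    ultimately have "I1 \<le> C" "I2 \<le> C * e" by linarith+
    then show ?thesis unfolding I1_def I2_def j by simp
  qed
  moreover have "0 \<le> C" using E U cA c' by (simp add: C_def)
  ultimately show ?thesis using cA(2) by blast
qed

section \<open>Consequences on balls B(x, |x|/2)\<close>

lemma indicator_integral_mono:
  fixes F :: "real^'n \<Rightarrow> real"
  assumes "compact K1" "compact K2" "K1 \<subseteq> K2" "K2 \<subseteq> punctured" "continuous_on punctured F"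
    "\<And>x. x \<in> punctured \<Longrightarrow> 0 \<le> F x"
  shows "integral\<^sup>L lborel (\<lambda>x. indicator K1 x * F x) \<le> integral\<^sup>L lborel (\<lambda>x. indicator K2 x * F x)"
proof (rule integral_mono)
  have "0 \<le> F x" if "x \<in> K2" for x using assms(4,6) that by blast
  then show "indicator K1 x * F x \<le> indicator K2 x * F x" for x
    using assms(3) by (auto simp: indicator_def)
qed (use assms in \<open>auto intro!: integrable_on_compact_subset[of _ punctured]\<close>)

lemma cball_in_annulus:
  assumes "y \<in> cball x (norm x / 2)"
  shows "(norm x)\<^sup>2 / 4 \<le> (norm y)\<^sup>2 \<and> (norm y)\<^sup>2 \<le> 9 / 4 * (norm x)\<^sup>2"
proof -
  have d: "norm (x - y) \<le> norm x / 2" using assms by (simp add: dist_norm)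
  have "norm x / 2 \<le> norm y" using d norm_triangle_ineq2[of x y] by linarith
  from power_mono[OF this, of 2] have "(norm x)\<^sup>2 / 4 \<le> (norm y)\<^sup>2"
    by (simp add: power_divide)
  moreover have "norm y \<le> 3 / 2 * norm x" using d norm_triangle_ineq3[of x y] by linarith
  from power_mono[OF this, of 2] have "(norm y)\<^sup>2 \<le> 9 / 4 * (norm x)\<^sup>2"
    by (simp add: power_mult_distrib power_divide)
  ultimately show ?thesis by simp
qed

lemma norm_lt_power2: "norm x < 1 / 4 \<Longrightarrow> (norm x)\<^sup>2 < 1 / 16"
  using power_strict_mono[of "norm x" "1 / 4" 2] by (simp add: power_divide)

lemma u_mean_bound:
  "\<exists>C\<ge>0. \<forall>x. 0 < norm x \<longrightarrow> norm x < 1 / 4 \<longrightarrow>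
     integral\<^sup>L lborel (\<lambda>y. indicator (cball x (norm x / 2)) y * u y) \<le> C * (norm x)\<^sup>2"
proof -
  obtain C where C: "0 \<le> C" "\<And>e. 0 < e \<Longrightarrow> 32 * e < 1 \<Longrightarrow>
      integral\<^sup>L lborel (\<lambda>x. indicator {x. 2 * e \<le> (norm x)\<^sup>2 \<and> (norm x)\<^sup>2 \<le> 32 * e} x * u x) \<le> C * e"
    using dyadic_bounds by blast
  have "integral\<^sup>L lborel (\<lambda>y. indicator (cball x (norm x / 2)) y * u y) \<le> C / 8 * (norm x)\<^sup>2"
    if x: "0 < norm x" "norm x < 1 / 4" for x
  proof -
    \<comment> \<open>With this e the shell 2e \<le> |y|^2 \<le> 32e is |x|^2/4 \<le> |y|^2 \<le>
      4|x|^2, which contains the ball; |x| < 1/4 gives 32e < 1.\<close>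
    define e where "e = (norm x)\<^sup>2 / 8"
    have e: "0 < e" "32 * e < 1" using x norm_lt_power2[OF x(2)] by (auto simp: e_def)
    have "integral\<^sup>L lborel (\<lambda>y. indicator (cball x (norm x / 2)) y * u y) \<le>
      integral\<^sup>L lborel (\<lambda>x. indicator {x. 2 * e \<le> (norm x)\<^sup>2 \<and> (norm x)\<^sup>2 \<le> 32 * e} x * u x)"
    proof (rule indicator_integral_mono[OF compact_cball compact_annulus _ _ u_cont u_nonneg])
      show "cball x (norm x / 2) \<subseteq> {x. 2 * e \<le> (norm x)\<^sup>2 \<and> (norm x)\<^sup>2 \<le> 32 * e}"
      proof
        fix y assume "y \<in> cball x (norm x / 2)"
        from cball_in_annulus[OF this] show "y \<in> {x. 2 * e \<le> (norm x)\<^sup>2 \<and> (norm x)\<^sup>2 \<le> 32 * e}"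
          by (simp add: e_def)
      qed
      show "{x. 2 * e \<le> (norm x)\<^sup>2 \<and> (norm x)\<^sup>2 \<le> 32 * e} \<subseteq> punctured"
        using e by (intro annulus_subset) auto
    qed auto
    also have "\<dots> \<le> C * e" by (rule C(2)[OF e])
    finally show ?thesis by (simp add: e_def)
  qed
  then show ?thesis using C(1) by (intro exI[of _ "C / 8"]) auto
qed

text \<open>The weighted mass of g on a \<le> |y|^2 \<le> 1 increases as a decreases and stays
  bounded, hence converges. The ball around x lies between two radii whose masses are both close to
  the limit.\<close>

lemma g_annulus_small:
  assumes "0 < \<kappa>"
  shows "\<exists>R>0. \<forall>x. 0 < norm x \<longrightarrow> norm x < R \<longrightarrow>
     integral\<^sup>L lborel (\<lambda>y. indicator (cball x (norm x / 2)) y * g y) * ((norm x)\<^sup>2) ^ (m - 1) \<le> \<kappa>"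
proof -
  define ann where "ann = (\<lambda>a. {y::real^'n. a \<le> (norm y)\<^sup>2 \<and> (norm y)\<^sup>2 \<le> 1})"
  define G where "G = (\<lambda>y. g y * ((norm y)\<^sup>2) ^ (m - 1))"
  define M where "M = (\<lambda>a. integral\<^sup>L lborel (\<lambda>y. indicator (ann a) y * G y))"
  have Gc: "continuous_on punctured G" unfolding G_def by (intro continuous_intros g_cont)
  have Gn: "0 \<le> G y" if "y \<in> punctured" for y using g_nonneg'[OF that] by (simp add: G_def)
  have ann: "compact (ann a)" for a unfolding ann_def by (rule compact_annulus)
  have ann': "ann a \<subseteq> punctured" if "a > 0" for a unfolding ann_def using that by (intro annulus_subset) auto
  obtain C A where CA: "1 \<le> A" "\<And>e. 0 < e \<Longrightarrow> 32 * e < 1 \<Longrightarrow> M (A * e) \<le> C"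
    using dyadic_bounds unfolding M_def ann_def G_def by blast
  have mono: "M b \<le> M a" if "0 < a" "a \<le> b" for a b
    unfolding M_def
    by (rule indicator_integral_mono[OF ann ann _ ann' Gc Gn]) (use that in \<open>auto simp: ann_def\<close>)
  have MC: "M a \<le> C" if "0 < a" for a
  proof -
    define e where "e = min (a / A) (1 / 64)"
    have e: "0 < e" "32 * e < 1" using that CA(1) by (auto simp: e_def)
    have "e \<le> a / A" by (simp add: e_def)
    then have "A * e \<le> a" using CA(1) by (simp add: field_simps)
    then have "M a \<le> M (A * e)" using e CA(1) by (intro mono) auto
    also have "\<dots> \<le> C" by (rule CA(2)[OF e])
    finally show ?thesis .
  qed
  \<comment> \<open>L is the limit of M a as a tends to 0; below, t is chosen with M t within
    \<kappa>' of it.\<close>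
  define L where "L = (SUP a\<in>{0<..}. M a)"
  have bdd: "bdd_above (M ` {0<..})" by (rule bdd_aboveI[of _ C]) (use MC in auto)
  \<comment> \<open>Pays for replacing the weight |y|^2 by its lower bound |x|^2/4 on the ball,
    raised to the power m - 1.\<close>
  define \<kappa>' where "\<kappa>' = \<kappa> / 4 ^ (m - 1)"
  have k': "\<kappa>' > 0" using assms by (simp add: \<kappa>'_def)
  have "L - \<kappa>' < L" using k' by simp
  then obtain t where t: "t > 0" "L - \<kappa>' < M t"
    unfolding L_def by (subst (asm) less_cSUP_iff[OF _ bdd]) auto
  define R where "R = min (1 / 4) (sqrt t / 2)"
  have R: "R > 0" using t by (simp add: R_def)
  have "integral\<^sup>L lborel (\<lambda>y. indicator (cball x (norm x / 2)) y * g y) * ((norm x)\<^sup>2) ^ (m - 1) \<le> \<kappa>"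
    if x: "0 < norm x" "norm x < R" for x
  proof -
    have x4: "(norm x)\<^sup>2 < 1 / 16" using x by (intro norm_lt_power2) (simp add: R_def)
    have "norm x < sqrt t / 2" using x by (simp add: R_def)
    from power_strict_mono[OF this, of 2] have xt: "4 * (norm x)\<^sup>2 < t" using t by (simp add: power_divide)
    define a where "a = (norm x)\<^sup>2 / 4"
    have a: "a > 0" "a \<le> t" using x xt zero_le_power2[of "norm x"] unfolding a_def by (simp, linarith)
    let ?B = "cball x (norm x / 2)"
    have B: "a \<le> (norm y)\<^sup>2 \<and> (norm y)\<^sup>2 < t \<and> (norm y)\<^sup>2 \<le> 1" if "y \<in> ?B" for y
      using cball_in_annulus[OF that] xt x4 x(1) unfolding a_def by auto
    have "?B \<subseteq> ann a" using B by (auto simp: ann_def)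
    then have B': "?B \<subseteq> punctured" using ann'[OF a(1)] by blast
    have i0: "integrable lborel (\<lambda>y. indicator ?B y * g y)"
      by (rule integrable_on_compact_subset[OF compact_cball g_cont B'])
    have i1: "integrable lborel (\<lambda>y. indicator (ann b) y * G y)" if "b > 0" for b
      by (rule integrable_on_compact_subset[OF ann Gc ann'[OF that]])
    have "integral\<^sup>L lborel (\<lambda>y. a ^ (m - 1) * (indicator ?B y * g y)) \<le>
      integral\<^sup>L lborel (\<lambda>y. indicator (ann a) y * G y - indicator (ann t) y * G y)"
    proof (rule integral_mono)
      fix y :: "real^'n"
      show "a ^ (m - 1) * (indicator ?B y * g y) \<le> indicator (ann a) y * G y - indicator (ann t) y * G y"
      proof (cases "y \<in> ?B")
        case True
        then have "y \<in> ann a" "y \<notin> ann t" using B[OF True] by (auto simp: ann_def)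
        moreover have "a ^ (m - 1) * g y \<le> ((norm y)\<^sup>2) ^ (m - 1) * g y"
          using B[OF True] a by (intro mult_right_mono power_mono g_nonneg' subsetD[OF B' True]) auto
        ultimately show ?thesis using True by (simp add: G_def mult.commute)
      next
        case False
        have "0 \<le> G y" if "y \<in> ann a" using Gn[OF subsetD[OF ann'[OF a(1)] that]] .
        then have "indicator (ann t) y * G y \<le> indicator (ann a) y * G y"
          using a by (auto simp: indicator_def ann_def)
        then show ?thesis using False by simp
      qed
    qed (intro Bochner_Integration.integrable_diff integrable_mult_right i0 i1 a t)+
    also have "\<dots> = M a - M t"
      unfolding M_def by (intro Bochner_Integration.integral_diff i1 a t)
    also have "M a \<le> L" unfolding L_def using a by (intro cSUP_upper bdd) auto
    finally have "a ^ (m - 1) * integral\<^sup>L lborel (\<lambda>y. indicator ?B y * g y) \<le> \<kappa>'" using t by simp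
    then have "4 ^ (m - 1) * (a ^ (m - 1) * integral\<^sup>L lborel (\<lambda>y. indicator ?B y * g y)) \<le> 4 ^ (m - 1) * \<kappa>'"
      by (intro mult_left_mono) auto
    moreover have "((norm x)\<^sup>2) ^ (m - 1) = 4 ^ (m - 1) * a ^ (m - 1)"
      by (simp add: a_def flip: power_mult_distrib)
    ultimately show ?thesis unfolding \<kappa>'_def by (simp only: mult_ac) simp
  qed
  with R show ?thesis by blast
qed

end

section \<open>The local pointwise bound\<close>

lemma integral_cball_const:
  "0 \<le> r \<Longrightarrow> integral\<^sup>L lborel (\<lambda>y. indicator (cball (x::real^'n::finite) r) y * (c::real)) =
     c * (unit_ball_vol (real CARD('n)) * r ^ CARD('n))"
  using content_cball[of r x] by (simp add: mult.commute)

lemma norm_sq_add_neq_0: "0 < d \<Longrightarrow> (norm v)\<^sup>2 + d \<noteq> (0::real)"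
  using zero_le_power2[of "norm v"] by linarith

text \<open>Halving the radius replaces polar coordinates: the outer half-shell contributes at most
  c \<rho>^b, and these contributions form a geometric series with ratio 2^(-b). The constant does
  not depend on d.\<close>

lemma riesz_integral_bound:
  assumes "0 < a" "2 * a < real CARD('n::finite)"
  shows "\<exists>C>0. \<forall>(x::real^'n) d \<rho>. 0 < d \<longrightarrow> 0 < \<rho> \<longrightarrow>
    integral\<^sup>L lborel (\<lambda>y. indicator (cball x \<rho>) y * ((norm (y - x))\<^sup>2 + d) powr (- a)) \<le>
      C * \<rho> powr (real CARD('n) - 2 * a)"
proof -
  define n where "n = CARD('n)"
  define b where "b = real n - 2 * a"
  have b: "b > 0" using assms by (simp add: b_def n_def)
  define V where "V = unit_ball_vol (real n)"
  have V: "V > 0" by (simp add: V_def)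
  \<comment> \<open>Volume of the whole ball of radius \<rho> times the kernel bound
    (\<rho>/2)^(-2a) = 4^a \<rho>^(-2a).\<close>
  define c where "c = V * 4 powr a"
  \<comment> \<open>Chosen so that c \<rho>^b = C \<rho>^b - C (\<rho>/2)^b; the series
    telescopes.\<close>
  define C where "C = c / (1 - (1 / 2) powr b)"
  have "(1 / 2 :: real) powr b < 1" using powr_less_mono2[of b "1 / 2" 1] b by simp
  then have C: "C > 0" "C * (1 - (1 / 2) powr b) = c" using V b by (simp_all add: C_def c_def)
  have "integral\<^sup>L lborel (\<lambda>y. indicator (cball x \<rho>) y * ((norm (y - x))\<^sup>2 + d) powr (- a)) \<le> C * \<rho> powr b"
    if d: "0 < d" and \<rho>: "0 < \<rho>" for x :: "real^'n" and d \<rho>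
  proof -
    define k where "k = (\<lambda>y. ((norm (y - x))\<^sup>2 + d) powr (- a))"
    define M where "M = (\<lambda>\<rho>. integral\<^sup>L lborel (\<lambda>y. indicator (cball x \<rho>) y * k y))"
    have kc: "continuous_on UNIV k"
      unfolding k_def using norm_sq_add_neq_0[OF d] by (intro continuous_intros) auto
    have i: "integrable lborel (\<lambda>y. indicator (cball x \<rho>) y * k y)" for \<rho>
      by (rule integrable_on_compact_subset[OF compact_cball kc]) simp
    have ic: "integrable lborel (\<lambda>y. indicator (cball x \<rho>) y * w)" for \<rho> and w :: real
      by (rule integrable_on_compact) auto
    have half: "M \<rho> - C * \<rho> powr b \<le> M (\<rho> / 2) - C * (\<rho> / 2) powr b" if \<rho>: "0 < \<rho>" for \<rho>
    proof -
      have "M \<rho> \<le> integral\<^sup>L lborel (\<lambda>y. indicator (cball x (\<rho> / 2)) y * k y +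
          indicator (cball x \<rho>) y * (\<rho> / 2) powr (- 2 * a))"
        unfolding M_def
      proof (rule integral_mono)
        fix y
        have k0: "0 \<le> k y" by (simp add: k_def)
        show "indicator (cball x \<rho>) y * k y \<le> indicator (cball x (\<rho> / 2)) y * k y +
          indicator (cball x \<rho>) y * (\<rho> / 2) powr (- 2 * a)"
        proof (cases "y \<in> cball x (\<rho> / 2)")
          case False
          have "k y \<le> ((\<rho> / 2)\<^sup>2) powr (- a)"
            unfolding k_def
          proof (rule powr_mono2')
            have "\<rho> / 2 \<le> norm (y - x)" using False by (simp add: dist_norm norm_minus_commute)
            from power_mono[OF this, of 2] \<rho> d show "(\<rho> / 2)\<^sup>2 \<le> (norm (y - x))\<^sup>2 + d" by linarith
          qed (use assms \<rho> in auto)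
          also have "((\<rho> / 2)\<^sup>2) powr (- a) = (\<rho> / 2) powr (- 2 * a)"
            using \<rho> powr_powr[of "\<rho> / 2" 2 "- a"] by (simp add: powr_numeral)
          finally show ?thesis using False by (auto simp: indicator_def)
        qed (use k0 \<rho> in \<open>auto simp: indicator_def\<close>)
      qed (intro Bochner_Integration.integrable_add i ic)+
      also have "\<dots> = M (\<rho> / 2) + (\<rho> / 2) powr (- 2 * a) * (V * \<rho> ^ n)"
        unfolding M_def using \<rho> integral_cball_const[of \<rho> x "(\<rho> / 2) powr (- 2 * a)"]
        by (subst Bochner_Integration.integral_add[OF i ic]) (simp add: V_def n_def)
      also have "(\<rho> / 2) powr (- 2 * a) * (V * \<rho> ^ n) = c * \<rho> powr b"
      proof -
        have "(\<rho> / 2) powr (- 2 * a) = \<rho> powr (- 2 * a) * 2 powr (2 * a)"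
          using \<rho> by (simp add: powr_divide powr_minus field_simps)
        moreover have "(2::real) powr (2 * a) = 4 powr a" using powr_powr[of 2 2 a] by simp
        moreover have "\<rho> ^ n = \<rho> powr real n" using \<rho> by (simp add: powr_realpow)
        moreover have "\<rho> powr (- 2 * a) * \<rho> powr real n = \<rho> powr b"
          by (simp add: b_def powr_add[symmetric])
        ultimately show ?thesis by (simp add: c_def)
      qed
      also have "c * \<rho> powr b = C * \<rho> powr b - C * (\<rho> / 2) powr b"
        unfolding C(2)[symmetric] using \<rho> by (simp add: powr_divide algebra_simps)
      finally show ?thesis by simp
    qed
    have iter: "M \<rho> - C * \<rho> powr b \<le> M (\<rho> / 2 ^ j) - C * (\<rho> / 2 ^ j) powr b" for j
    proof (induction j)
      case (Suc j)
      then show ?case using half[of "\<rho> / 2 ^ j"] \<rho> by (simp add: mult.commute)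
    qed simp
    \<comment> \<open>The crude bound d^(-a) on the kernel depends on d, but it only has to show
      that the remainder tends to 0 as j grows.\<close>
    have "M \<rho> - C * \<rho> powr b \<le> (d powr (- a) * V * \<rho> ^ n) * ((1 / 2) ^ n) ^ j" for j
    proof -
      define \<rho>' where "\<rho>' = \<rho> / 2 ^ j"
      have \<rho>': "\<rho>' > 0" using \<rho> by (simp add: \<rho>'_def)
      have "M \<rho>' \<le> integral\<^sup>L lborel (\<lambda>y. indicator (cball x \<rho>') y * d powr (- a))"
        unfolding M_def
      proof (rule integral_mono[OF i ic])
        fix y
        have "k y \<le> d powr (- a)" unfolding k_def using d assms by (intro powr_mono2') auto
        then show "indicator (cball x \<rho>') y * k y \<le> indicator (cball x \<rho>') y * d powr (- a)"
          by (auto simp: indicator_def)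
      qed
      also have "\<dots> = d powr (- a) * (V * \<rho>' ^ n)"
        using integral_cball_const[of \<rho>' x "d powr (- a)"] \<rho>' by (simp add: V_def n_def)
      also have "\<rho>' ^ n = \<rho> ^ n * ((1 / 2) ^ n) ^ j"
        by (simp add: \<rho>'_def power_divide flip: power_mult)
      finally have "M \<rho>' \<le> (d powr (- a) * V * \<rho> ^ n) * ((1 / 2) ^ n) ^ j" by (simp add: mult_ac)
      moreover have "C * \<rho>' powr b \<ge> 0" using C by simp
      ultimately show ?thesis using iter[of j] unfolding \<rho>'_def by linarith
    qed
    moreover have "(\<lambda>j. (d powr (- a) * V * \<rho> ^ n) * ((1 / 2) ^ n) ^ j) \<longlonglongrightarrow> (d powr (- a) * V * \<rho> ^ n) * 0"
    proof (intro tendsto_mult_left LIMSEQ_power_zero)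
      have "(1 / 2 :: real) ^ n < 1"
        using power_strict_decreasing[of 0 n "1 / 2 :: real"] by (simp add: n_def)
      then show "norm ((1 / 2 :: real) ^ n) < 1" by simp
    qed
    ultimately have "M \<rho> - C * \<rho> powr b \<le> 0"
      using LIMSEQ_le_const[of _ _ "M \<rho> - C * \<rho> powr b"] by fastforce
    then show ?thesis unfolding M_def k_def by simp
  qed
  then show ?thesis using C(1) unfolding b_def n_def by (intro exI[of _ C]) auto
qed

context polyharmonic_inequality
begin

text \<open>Green's formula with a cut-off times (s + d)^(-a) equates a positive average of u near
  x, up to an error supported where the cut-off varies, with an integral of g against a truncated
  Riesz kernel. The error gives the mean of u, and splitting the g-integral at \<rho> gives the
  other two terms.\<close>

lemma local_bound:
  assumes "odd m"
  shows "\<exists>C>0. \<forall>x \<rho> K. 0 < norm x \<longrightarrow> norm x < 1 / 4 \<longrightarrow> 0 < \<rho> \<longrightarrow> \<rho> \<le> norm x / 2 \<longrightarrow>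
    0 \<le> K \<longrightarrow> (\<forall>y\<in>cball x \<rho>. g y \<le> K) \<longrightarrow>
    u x \<le> C * (norm x powr (- real CARD('n)) *
        integral\<^sup>L lborel (\<lambda>y. indicator (cball x (norm x / 2)) y * u y) +
      \<rho> powr (2 * real m - real CARD('n)) *
        integral\<^sup>L lborel (\<lambda>y. indicator (cball x (norm x / 2)) y * g y) + \<rho> powr (2 * real m) * K)"
proof -
  define n where "n = real CARD('n)"
  define a where "a = n / 2 - real m"
  have a: "a > 0" "2 * a < n" "n = 2 * (a + real m)" using dim m_pos by (auto simp: a_def n_def field_simps)
  obtain R where R: "R > 0" "\<And>(x::real^'n) d \<rho>. 0 < d \<Longrightarrow> 0 < \<rho> \<Longrightarrow>
    integral\<^sup>L lborel (\<lambda>y. indicator (cball x \<rho>) y * ((norm (y - x))\<^sup>2 + d) powr (- a)) \<le> R * \<rho> powr (n - 2 * a)"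
    using riesz_integral_bound[of a, where 'n = 'n] a(1,2) unfolding n_def by blast
  obtain \<phi> B\<phi> where \<phi>: "0 \<le> B\<phi>" "symbol (2 * m) 0 B\<phi> UNIV \<phi>" "\<And>s. s \<le> 1 \<Longrightarrow> \<phi> s = 1"
    "\<And>s. s \<ge> 2 \<Longrightarrow> \<phi> s = 0" "\<And>s. 0 \<le> \<phi> s \<and> \<phi> s \<le> 1"
    using cutoff_exists[of "2 * m"] by blast
  obtain Bp where Bp: "Bp \<ge> 0" "\<And>d. d \<ge> 0 \<Longrightarrow> symbol (2 * m) (- a) Bp {- d<..} (\<lambda>s. (s + d) powr (- a))"
    using symbol_powr_shift[of "- a" "2 * m"] a(1) by auto
  define B where "B = 2 ^ (2 * m) * (B\<phi> * Bp)"
  have B: "B \<ge> 0" using \<phi>(1) Bp(1) by (simp add: B_def)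
  obtain D where D: "D \<ge> 0" "\<And>p B T f. open T \<Longrightarrow> 0 \<le> B \<Longrightarrow> symbol (0 + 2 * m) p B T f \<Longrightarrow>
     symbol 0 (p - real m) (D * B) T ((Lop n ^^ m) f)"
    using symbol_Lop_funpow[of 0 m n] by blast
  define E where "E = D * B * 8 powr (n / 2)"
  have E: "E \<ge> 0" using D B by (simp add: E_def)
  define V where "V = unit_ball_vol n"
  have V: "V > 0" by (simp add: V_def n_def)
  \<comment> \<open>Lower bound of the kernel for s \<le> d: there s + d \<le> 2d, hence the power
    of 2.\<close>
  define c where "c = 4 ^ m * pochhammer a (2 * m) * 2 powr (- (a + 2 * real m))"
  have c: "c > 0" using a(1) by (simp add: c_def pochhammer_pos)
  define C where "C = (E + 1 + R) / (c * V / 2)"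
  have C: "C > 0" using E R(1) c V by (auto simp: C_def intro!: divide_pos_pos add_nonneg_pos)
  have "u x \<le> C * (norm x powr (- n) * integral\<^sup>L lborel (\<lambda>y. indicator (cball x (norm x / 2)) y * u y) +
      \<rho> powr (2 * real m - n) * integral\<^sup>L lborel (\<lambda>y. indicator (cball x (norm x / 2)) y * g y) +
      \<rho> powr (2 * real m) * K)"
    if x: "0 < norm x" "norm x < 1 / 4" and \<rho>: "0 < \<rho>" "\<rho> \<le> norm x / 2" and K: "0 \<le> K" "\<And>y. y \<in> cball x \<rho> \<Longrightarrow> g y \<le> K"
    for x \<rho> K
  proof -
    define r where "r = norm x"
    have r: "r > 0" using x by (simp add: r_def)
    let ?B = "cball x (r / 2)"
    have B_sub: "?B \<subseteq> punctured"
    proof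
      fix y assume "y \<in> ?B"
      then have "(norm x)\<^sup>2 / 4 \<le> (norm y)\<^sup>2 \<and> (norm y)\<^sup>2 \<le> 9 / 4 * (norm x)\<^sup>2"
        unfolding r_def by (rule cball_in_annulus)
      then show "y \<in> punctured"
        using annulus_subset[of "(norm x)\<^sup>2 / 4" 1] norm_lt_power2[OF x(2)] x(1) by force
    qed
    define Iu where "Iu = integral\<^sup>L lborel (\<lambda>y. indicator ?B y * u y)"
    define Ig where "Ig = integral\<^sup>L lborel (\<lambda>y. indicator ?B y * g y)"
    have Iu: "Iu \<ge> 0" unfolding Iu_def by (intro indicator_integral_nonneg u_nonneg subsetD[OF B_sub])
    have Ig: "Ig \<ge> 0" unfolding Ig_def by (intro indicator_integral_nonneg g_nonneg' subsetD[OF B_sub])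
    define RHS where "RHS = r powr (- n) * Iu + \<rho> powr (2 * real m - n) * Ig + \<rho> powr (2 * real m) * K"
    have RHS: "RHS \<ge> 0" unfolding RHS_def using Iu Ig K by simp
    have "u x \<le> C * RHS"
    proof (cases "u x > 0")
      case False
      then show ?thesis using C RHS by (simp add: order_trans[OF _ mult_nonneg_nonneg])
    next
      case True
      have xp: "x \<in> punctured" by (rule subsetD[OF B_sub]) (use r in simp)
      have "isCont u x" using u_cont open_punctured xp by (simp add: continuous_on_eq_continuous_at)
      then obtain \<delta> where \<delta>: "\<delta> > 0" "\<And>y. dist y x < \<delta> \<Longrightarrow> dist (u y) (u x) < u x / 2"
        using True unfolding continuous_at_eps_delta by (metis half_gt_zero)
      define \<delta>' where "\<delta>' = min (\<delta> / 2) (r / 4)"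
      have \<delta>': "0 < \<delta>'" "\<delta>' < \<delta>" "\<delta>' \<le> r / 4" using \<delta>(1) r by (auto simp: \<delta>'_def)
      have u_low: "u x / 2 \<le> u y" if "y \<in> cball x \<delta>'" for y
      proof -
        have "dist (u y) (u x) < u x / 2" using \<delta>(2)[of y] that \<delta>' by (simp add: dist_commute)
        then show ?thesis unfolding dist_real_def by linarith
      qed
      \<comment> \<open>No limit d -> 0 is taken. On the ball of radius \<delta>' the kernel is at
        least c d^(-n/2) = c \<delta>'^(-n) and u is at least half of u x, so the volume of that
        ball cancels \<delta>' completely.\<close>
      define d where "d = \<delta>'\<^sup>2"
      have d: "d > 0" using \<delta>' by (simp add: d_def)
      have dr: "d < r\<^sup>2 / 8" unfolding d_def
      proof -
        have "\<delta>'\<^sup>2 \<le> (r / 4)\<^sup>2" using power_mono[OF \<delta>'(3), of 2] \<delta>'(1) by simp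
        also have "\<dots> < r\<^sup>2 / 8" using r by (simp add: power_divide)
        finally show "\<delta>'\<^sup>2 < r\<^sup>2 / 8" .
      qed
      \<comment> \<open>The cut-off is 1 up to e and 0 from 2e = (r/2)^2 on, so the support fits the
        ball of radius r/2.\<close>
      define e where "e = r\<^sup>2 / 8"
      have e: "e > 0" using r by (simp add: e_def)
      define H where "H = (\<lambda>s. (e powr 0 * \<phi> (s / e)) * (s + d) powr (- a))"
      have "symbol (2 * m) 0 B\<phi> {s. s / e \<in> UNIV} (\<lambda>s. e powr 0 * \<phi> (s / e))"
        by (intro symbol_scale \<phi> e) auto
      then have "symbol (2 * m) (0 + - a) B {- d<..} H"
        unfolding H_def B_def using d
        by (intro symbol_mult \<phi> Bp) (auto elim!: symbol_mono simp del: symbol.simps)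
      then have Hs: "symbol (2 * m) (- a) B {- d<..} H" by simp
      have HL: "symbol 0 (- a - real m) (D * B) {- d<..} ((Lop n ^^ m) H)"
        by (rule D(2)) (use B Hs in auto)
      \<comment> \<open>Where the cut-off varies only size counts. The order -a - m equals -n/2 with
        a constant independent of d, and s \<ge> r^2/8 produces r^(-n) and the factor
        8^(n/2).\<close>
      have far: "\<bar>(Lop n ^^ m) H s\<bar> \<le> E * r powr (- n)" if "s \<ge> e" for s
      proof -
        have "\<bar>(Lop n ^^ m) H s\<bar> \<le> D * B * s powr (- a - real m)"
          using symbol_bound[OF HL, of s] that e d by simp
        also have "\<dots> \<le> D * B * e powr (- a - real m)"
          using that e D(1) B a(1) by (intro mult_left_mono powr_mono2') auto
        also have "- a - real m = - (n / 2)" by (simp add: a_def)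
        also have "e powr (- (n / 2)) = 8 powr (n / 2) * (r\<^sup>2) powr (- (n / 2))"
          using r by (simp add: e_def powr_divide powr_minus field_simps)
        also have "(r\<^sup>2) powr (- (n / 2)) = r powr (- n)"
          using r powr_powr[of r 2 "- (n / 2)"] by (simp add: powr_numeral)
        finally show ?thesis by (simp add: E_def mult_ac)
      qed
      \<comment> \<open>Here the cut-off is 1, so the iterate is (-1)^m times the positive term of
        \<open>bubble_top\<close>; oddness of m supplies the minus sign, and minus the iterate
        becomes the averaging kernel for u.\<close>
      have near: "(Lop n ^^ m) H s = - (4 ^ m * pochhammer a (2 * m) * d ^ m * (s + d) powr (- (a + 2 * real m)))"
        if "0 \<le> s" "s < e" for s
      proof -
        have "(Lop n ^^ m) H s = (Lop n ^^ m) (bubble m a d 0) s"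
          by (rule Lop_funpow_cong[of "{- d<..<e}"]) (use that d e \<phi>(3) in \<open>auto simp: H_def bubble_0\<close>)
        also have "\<dots> = (- 1) ^ m * bubble m a d m s"
          by (rule Lop_funpow_bubble[OF _ a(3)]) (use that d in auto)
        finally show ?thesis using assms by (simp add: bubble_top)
      qed
      have near1: "(Lop n ^^ m) H s \<le> 0" if "0 \<le> s" "s < e" for s
        unfolding near[OF that] using d a(1) by (simp add: pochhammer_pos less_imp_le)
      have near2: "c * d powr (- (n / 2)) \<le> - (Lop n ^^ m) H s" if "0 \<le> s" "s \<le> d" for s
      proof -
        have "d ^ m * (2 * d) powr (- (a + 2 * real m)) \<le> d ^ m * (s + d) powr (- (a + 2 * real m))"
          using that d a(1) by (intro mult_left_mono powr_mono2') auto
        moreover have "d ^ m * (2 * d) powr (- (a + 2 * real m)) = 2 powr (- (a + 2 * real m)) * d powr (- (n / 2))"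
        proof -
          have "d ^ m * d powr (- (a + 2 * real m)) = d powr (real m + - (a + 2 * real m))"
            using d by (simp only: powr_add powr_realpow)
          also have "real m + - (a + 2 * real m) = - (n / 2)" by (simp add: a_def)
          finally have "d ^ m * d powr (- (a + 2 * real m)) = d powr (- (n / 2))" .
          then show ?thesis using d by (simp add: powr_mult mult_ac)
        qed
        ultimately have "2 powr (- (a + 2 * real m)) * d powr (- (n / 2)) \<le> d ^ m * (s + d) powr (- (a + 2 * real m))"
          by simp
        then have "4 ^ m * pochhammer a (2 * m) * (2 powr (- (a + 2 * real m)) * d powr (- (n / 2))) \<le>
            4 ^ m * pochhammer a (2 * m) * (d ^ m * (s + d) powr (- (a + 2 * real m)))"
          using a(1) by (intro mult_left_mono) (auto simp: pochhammer_pos less_imp_le)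
        moreover have "s < e" using that dr by (simp add: e_def)
        ultimately show ?thesis using near[of s] that by (simp add: c_def mult_ac)
      qed
      have H01: "0 \<le> H s" "H s \<le> (s + d) powr (- a)" for s
        using \<phi>(5)[of "s / e"] e by (auto simp: H_def mult_left_le_one_le)
      have N: "(norm (y - x))\<^sup>2 \<le> b\<^sup>2 \<longleftrightarrow> y \<in> cball x b" if "b \<ge> 0" for y b
        using that abs_le_square_iff[of "norm (y - x)" b] by (auto simp: dist_norm norm_minus_commute)
      have N': "b\<^sup>2 < (norm (y - x))\<^sup>2" if "y \<notin> cball x b" "b \<ge> 0" for y b
        using N[OF that(2), of y] that(1) by linarith
      have green: "integral\<^sup>L lborel (\<lambda>y. indicator ?B y * (u y * (Lop n ^^ m) H ((norm (y - x))\<^sup>2))) =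
        integral\<^sup>L lborel (\<lambda>y. indicator ?B y * (iter_laplacian m u y * H ((norm (y - x))\<^sup>2)))"
        unfolding n_def
      proof (rule green_iterated[OF open_punctured compact_cball B_sub smooth _ _ Hs B])
        show "open {(r / 2)\<^sup>2<..}" by simp
        show "H s = 0" if "s \<in> {(r / 2)\<^sup>2<..}" for s
        proof -
          have "2 \<le> s / e" using that e by (simp add: e_def field_simps power_divide)
          then show ?thesis using \<phi>(4) by (simp add: H_def)
        qed
        show "(norm (y - x))\<^sup>2 \<in> {(r / 2)\<^sup>2<..}" if "y \<notin> ?B" for y
          using N'[OF that] r by simp
      qed (use d in auto)
      have cN: "continuous_on X (\<lambda>y. f ((norm (y - x))\<^sup>2))" if "continuous_on {- d<..} f" for f :: "real \<Rightarrow> real" and X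
        by (rule continuous_on_compose2[OF that]) (use d in \<open>auto intro!: continuous_intros less_le_trans[OF _ zero_le_power2]\<close>)
      have Hc: "continuous_on {- d<..} H" "continuous_on {- d<..} ((Lop n ^^ m) H)"
        using symbol_continuous[OF Hs] symbol_continuous[OF HL] by auto
      have sub: "cball x \<delta>' \<subseteq> ?B" "cball x \<rho> \<subseteq> ?B" using \<delta>' r \<rho> by (auto simp: r_def)
      have i1: "integrable lborel (\<lambda>y. indicator ?B y * (g y * H ((norm (y - x))\<^sup>2)))"
        by (rule integrable_on_compact_subset[OF compact_cball _ B_sub]) (intro continuous_intros g_cont cN Hc)
      have i2: "integrable lborel (\<lambda>y. indicator ?B y * (u y * (Lop n ^^ m) H ((norm (y - x))\<^sup>2)))"
        by (rule integrable_on_compact_subset[OF compact_cball _ B_sub]) (intro continuous_intros u_cont cN Hc)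
      have j1: "integrable lborel (\<lambda>y. indicator ?B y * u y)"
        by (rule integrable_on_compact_subset[OF compact_cball u_cont B_sub])
      have j2: "integrable lborel (\<lambda>y. indicator ?B y * g y)"
        by (rule integrable_on_compact_subset[OF compact_cball g_cont B_sub])
      have j3: "integrable lborel (\<lambda>y. indicator (cball x \<delta>') y * (u x / 2))"
        by (rule integrable_on_compact) auto
      have j4: "integrable lborel (\<lambda>y. indicator (cball x \<rho>) y * ((norm (y - x))\<^sup>2 + d) powr (- a))"
        by (rule integrable_on_compact[OF compact_cball]) (use norm_sq_add_neq_0[OF d] in \<open>auto intro!: continuous_intros\<close>)
      have "integral\<^sup>L lborel (\<lambda>y. c * d powr (- (n / 2)) * (indicator (cball x \<delta>') y * (u x / 2)) -
          E * r powr (- n) * (indicator ?B y * u y)) \<le>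
        integral\<^sup>L lborel (\<lambda>y. - (indicator ?B y * (u y * (Lop n ^^ m) H ((norm (y - x))\<^sup>2))))"
      proof (rule integral_mono)
        fix y
        define s where "s = (norm (y - x))\<^sup>2"
        have s0: "0 \<le> s" by (simp add: s_def)
        show "c * d powr (- (n / 2)) * (indicator (cball x \<delta>') y * (u x / 2)) -
          E * r powr (- n) * (indicator ?B y * u y) \<le> - (indicator ?B y * (u y * (Lop n ^^ m) H ((norm (y - x))\<^sup>2)))"
        proof (cases "y \<in> ?B")
          case False
          then have "y \<notin> cball x \<delta>'" using sub by blast
          then show ?thesis using False by simp
        next
          case yB: True
          have uy: "0 \<le> u y" by (intro u_nonneg subsetD[OF B_sub yB])
          show ?thesis
          proof (cases "s < e")
            case True
            have "c * d powr (- (n / 2)) * (indicator (cball x \<delta>') y * (u x / 2)) \<le> u y * (- (Lop n ^^ m) H s)"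
            proof (cases "y \<in> cball x \<delta>'")
              case 1: True
              then have "s \<le> d" unfolding s_def d_def using N[of \<delta>' y] \<delta>' by simp
              then have "(u x / 2) * (c * d powr (- (n / 2))) \<le> u y * (- (Lop n ^^ m) H s)"
                using u_low[OF 1] uy near2[OF s0] c by (intro mult_mono) auto
              then show ?thesis using 1 by (simp add: mult_ac)
            next
              case 1: False
              have "0 \<le> u y * (- (Lop n ^^ m) H s)" using near1[OF s0 True] uy by (intro mult_nonneg_nonneg) auto
              then show ?thesis using 1 by simp
            qed
            moreover have "0 \<le> E * r powr (- n) * u y" using E uy by simp
            ultimately show ?thesis using yB unfolding s_def by simp
          next
            case False
            have "d < s" using False dr by (simp add: e_def)
            then have "y \<notin> cball x \<delta>'" using N[OF less_imp_le[OF \<delta>'(1)], of y] unfolding s_def d_def by linarith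
            moreover have "u y * (Lop n ^^ m) H s \<le> u y * (E * r powr (- n))"
              using far[of s] False uy by (intro mult_left_mono) auto
            ultimately show ?thesis using yB unfolding s_def by (simp add: mult_ac)
          qed
        qed
      qed (intro Bochner_Integration.integrable_diff integrable_minus integrable_mult_right i2 j1 j3)+
      moreover have "integral\<^sup>L lborel (\<lambda>y. c * d powr (- (n / 2)) * (indicator (cball x \<delta>') y * (u x / 2)) -
          E * r powr (- n) * (indicator ?B y * u y)) = c * V * u x / 2 - E * r powr (- n) * Iu"
      proof -
        have e1: "d powr (- (n / 2)) * \<delta>' ^ CARD('n) = 1"
        proof -
          have "d powr (- (n / 2)) = \<delta>' powr (- n)"
            unfolding d_def using \<delta>'(1) powr_powr[of \<delta>' 2 "- (n / 2)"] by (simp add: powr_numeral)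
          moreover have "\<delta>' ^ CARD('n) = \<delta>' powr n" using \<delta>'(1) by (simp add: n_def powr_realpow)
          ultimately show ?thesis using \<delta>'(1) by (simp add: powr_add[symmetric])
        qed
        have e2: "integral\<^sup>L lborel (\<lambda>y. c * d powr (- (n / 2)) * (indicator (cball x \<delta>') y * (u x / 2)) -
          E * r powr (- n) * (indicator ?B y * u y)) =
          c * d powr (- (n / 2)) * integral\<^sup>L lborel (\<lambda>y. indicator (cball x \<delta>') y * (u x / 2)) -
          E * r powr (- n) * Iu"
          unfolding Iu_def by (subst Bochner_Integration.integral_diff)
            (intro integrable_mult_right j1 j3 | simp only: integral_mult_right_zero)+
        have e3: "integral\<^sup>L lborel (\<lambda>y. indicator (cball x \<delta>') y * (u x / 2)) = u x / 2 * (V * \<delta>' ^ CARD('n))"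
          unfolding V_def n_def by (rule integral_cball_const) (use \<delta>' in simp)
        have e4: "c * d powr (- (n / 2)) * (u x / 2 * (V * \<delta>' ^ CARD('n))) =
          c * V * u x / 2 * (d powr (- (n / 2)) * \<delta>' ^ CARD('n))" by simp
        show ?thesis unfolding e2 e3 e4 e1 by simp
      qed
      moreover have "integral\<^sup>L lborel (\<lambda>y. - (indicator ?B y * (u y * (Lop n ^^ m) H ((norm (y - x))\<^sup>2)))) =
        integral\<^sup>L lborel (\<lambda>y. indicator ?B y * (g y * H ((norm (y - x))\<^sup>2)))"
        using green by (simp add: g_def)
      \<comment> \<open>Inside the ball of radius \<rho> the bound g \<le> K leaves the Riesz
        integral; outside it the kernel is at most \<rho>^(2m-n), which leaves the mass of
        g.\<close>
      moreover have "integral\<^sup>L lborel (\<lambda>y. indicator ?B y * (g y * H ((norm (y - x))\<^sup>2))) \<le>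
        integral\<^sup>L lborel (\<lambda>y. K * (indicator (cball x \<rho>) y * ((norm (y - x))\<^sup>2 + d) powr (- a)) +
          \<rho> powr (2 * real m - n) * (indicator ?B y * g y))"
      proof (rule integral_mono)
        fix y
        define s where "s = (norm (y - x))\<^sup>2"
        show "indicator ?B y * (g y * H ((norm (y - x))\<^sup>2)) \<le>
          K * (indicator (cball x \<rho>) y * ((norm (y - x))\<^sup>2 + d) powr (- a)) + \<rho> powr (2 * real m - n) * (indicator ?B y * g y)"
        proof (cases "y \<in> ?B")
          case True
          have gy: "0 \<le> g y" by (intro g_nonneg' subsetD[OF B_sub True])
          show ?thesis
          proof (cases "y \<in> cball x \<rho>")
            case 1: True
            have "g y * H s \<le> K * (s + d) powr (- a)"
              by (intro mult_mono K(2) 1 H01 K(1))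
            moreover have "0 \<le> \<rho> powr (2 * real m - n) * g y" using gy by simp
            ultimately show ?thesis using 1 True unfolding s_def by simp
          next
            case 1: False
            have "\<rho>\<^sup>2 \<le> s" using N'[OF 1 less_imp_le[OF \<rho>(1)]] unfolding s_def by linarith
            then have "(s + d) powr (- a) \<le> (\<rho>\<^sup>2) powr (- a)" using d a(1) \<rho> by (intro powr_mono2') auto
            also have "(\<rho>\<^sup>2) powr (- a) = \<rho> powr (2 * real m - n)"
              using \<rho> powr_powr[of \<rho> 2 "- a"] by (simp add: powr_numeral a_def algebra_simps)
            finally have "g y * H s \<le> g y * \<rho> powr (2 * real m - n)"
              using H01(2)[of s] gy by (intro mult_left_mono) auto
            then show ?thesis using 1 True unfolding s_def by (simp add: mult.commute)
          qed
        next
          case False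
          then have "y \<notin> cball x \<rho>" using sub by blast
          then show ?thesis using False by simp
        qed
      qed (intro Bochner_Integration.integrable_add integrable_mult_right i1 j2 j4)+
      moreover have "integral\<^sup>L lborel (\<lambda>y. K * (indicator (cball x \<rho>) y * ((norm (y - x))\<^sup>2 + d) powr (- a)) +
          \<rho> powr (2 * real m - n) * (indicator ?B y * g y)) =
          K * integral\<^sup>L lborel (\<lambda>y. indicator (cball x \<rho>) y * ((norm (y - x))\<^sup>2 + d) powr (- a)) +
          \<rho> powr (2 * real m - n) * Ig"
        unfolding Ig_def by (subst Bochner_Integration.integral_add)
          (intro integrable_mult_right j2 j4 | simp only: integral_mult_right_zero)+
      moreover have "K * integral\<^sup>L lborel (\<lambda>y. indicator (cball x \<rho>) y * ((norm (y - x))\<^sup>2 + d) powr (- a)) \<le>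
          K * (R * \<rho> powr (2 * real m))"
        using R(2)[OF d \<rho>(1), of x] K(1) by (intro mult_left_mono) (auto simp: a_def)
      ultimately have "c * V * u x / 2 \<le> E * (r powr (- n) * Iu) + \<rho> powr (2 * real m - n) * Ig + R * (\<rho> powr (2 * real m) * K)"
        by (simp add: mult_ac)
      also have "\<dots> \<le> (E + 1 + R) * (r powr (- n) * Iu) + (E + 1 + R) * (\<rho> powr (2 * real m - n) * Ig) +
          (E + 1 + R) * (\<rho> powr (2 * real m) * K)"
      proof -
        have "1 * (\<rho> powr (2 * real m - n) * Ig) \<le> (E + 1 + R) * (\<rho> powr (2 * real m - n) * Ig)"
          by (intro mult_right_mono) (use E R(1) Ig in auto)
        then show ?thesis
          by (intro add_mono mult_right_mono) (use E R(1) Iu K in auto)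
      qed
      also have "\<dots> = (E + 1 + R) * RHS" by (simp add: RHS_def distrib_left)
      finally have "(c * V / 2) * u x \<le> (E + 1 + R) * RHS" by simp
      then show ?thesis using c V unfolding C_def by (simp add: field_simps)
    qed
    then show ?thesis unfolding RHS_def Iu_def Ig_def r_def .
  qed
  then show ?thesis using C unfolding n_def by blast
qed

end

section \<open>Absorbing the nonlinearity\<close>

text \<open>Either the sublinear term is at most V/2 and can be absorbed, or V^(1-\<theta>) \<le> 2Q
  bounds V directly.\<close>

lemma absorb_sublinear:
  fixes V P Q \<theta> :: real
  assumes "0 < V" "\<theta> < 1" "0 \<le> Q" "V \<le> P + Q * V powr \<theta>"
  shows "V \<le> 2 * P \<or> V \<le> (2 * Q) powr (1 / (1 - \<theta>))"
proof (rule disjCI)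
  assume "\<not> V \<le> (2 * Q) powr (1 / (1 - \<theta>))"
  then have "((2 * Q) powr (1 / (1 - \<theta>))) powr (1 - \<theta>) < V powr (1 - \<theta>)"
    using assms by (intro powr_less_mono2) auto
  then have "2 * Q < V powr (1 - \<theta>)"
    using assms by (simp add: powr_powr)
  then have "2 * Q * V powr \<theta> < V powr (1 - \<theta>) * V powr \<theta>"
    using assms(1) by (intro mult_strict_right_mono) auto
  also have "\<dots> = V" using assms(1) by (simp add: powr_add[symmetric])
  finally show "V \<le> 2 * P" using assms(4) by simp
qed

lemma powr_const_mono:
  fixes r r0 p c :: real
  assumes "0 < c" "0 < r0" "c * r0 \<le> r" "0 \<le> p"
  shows "r powr (- p) \<le> c powr (- p) * r0 powr (- p)"
proof -
  have "r powr (- p) \<le> (c * r0) powr (- p)" using assms by (intro powr_mono2') auto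
  then show ?thesis using assms by (simp add: powr_mult)
qed

context polyharmonic_inequality
begin

text \<open>The radius in the local bound is chosen so that the nonlinear term absorbs half of u at the
  maximum point; if that radius does not fit into the ball, the maximum is already small.\<close>

lemma pointwise_bound:
  fixes l Cf :: real
  defines "n \<equiv> real CARD('n)" and "a \<equiv> 4 * real m * (real m - 1) / (real CARD('n) - l * (real CARD('n) - 2 * real m))"
    and "b \<equiv> 2 * real m / (real CARD('n) - l * (real CARD('n) - 2 * real m))"
  assumes m: "odd m" and l: "(2 * real m + n - 2) / (n - 2) \<le> l" "l < n / (n - 2 * real m)"
    and Cf: "0 < Cf" "\<And>x. x \<in> ball 0 2 - {0} \<Longrightarrow> g x \<le> Cf * max 1 (u x) powr l"
  shows "\<exists>C>0. \<forall>\<kappa>. 0 < \<kappa> \<longrightarrow> (\<exists>R>0. \<forall>x. 0 < norm x \<longrightarrow> norm x < R \<longrightarrow>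
     u x \<le> C * (norm x powr (- (n - 2)) + \<kappa> powr b * norm x powr (- a)))"
proof -
  have nm: "n - 2 * real m > 0" "n > 2" "real m \<ge> 1" using dim m_pos by (auto simp: n_def)
  define D where "D = n - l * (n - 2 * real m)"
  have D: "D > 0" using l(2) nm by (simp add: D_def field_simps)
  have ab: "a = 4 * real m * (real m - 1) / D" "b = 2 * real m / D" by (simp_all add: a_def b_def D_def n_def)
  have l1: "2 * real m \<le> (n - 2) * (l - 1)" using l(1) nm by (simp add: field_simps)
  then have "0 < (n - 2) * (l - 1)" using nm by linarith
  then have "l - 1 > 0" using nm by (simp add: zero_less_mult_iff)
  \<comment> \<open>The scaling exponent of the equation: \<rho>^(2m) V^l is a multiple of V when
    \<rho> ~ V^(-1/\<gamma>). The lower bound on l says \<gamma> \<le> n - 2.\<close>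
  define \<gamma> where "\<gamma> = 2 * real m / (l - 1)"
  have \<gamma>: "0 < \<gamma>" "\<gamma> \<le> n - 2" using l1 \<open>l - 1 > 0\<close> nm by (auto simp: \<gamma>_def field_simps)
  \<comment> \<open>The power of V in \<rho>^(2m-n) for this \<rho>; the upper bound on l says
    \<theta> < 1.\<close>
  define \<theta> where "\<theta> = (n - 2 * real m) / \<gamma>"
  have \<theta>eq: "1 - \<theta> = D / (2 * real m)"
    using nm \<open>l - 1 > 0\<close> by (simp add: \<theta>_def \<gamma>_def D_def field_simps)
  have "0 < D / (2 * real m)" using D nm by simp
  then have \<theta>: "\<theta> < 1" "1 / (1 - \<theta>) = b" unfolding ab using \<theta>eq by (linarith, simp)
  have a0: "a \<ge> 0" "b > 0" using D nm by (auto simp: ab)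
  obtain C1 where C1: "C1 > 0" "\<And>x \<rho> K. 0 < norm x \<Longrightarrow> norm x < 1 / 4 \<Longrightarrow> 0 < \<rho> \<Longrightarrow> \<rho> \<le> norm x / 2 \<Longrightarrow>
    0 \<le> K \<Longrightarrow> (\<forall>y\<in>cball x \<rho>. g y \<le> K) \<Longrightarrow>
    u x \<le> C1 * (norm x powr (- n) *
        integral\<^sup>L lborel (\<lambda>y. indicator (cball x (norm x / 2)) y * u y) +
      \<rho> powr (2 * real m - n) *
        integral\<^sup>L lborel (\<lambda>y. indicator (cball x (norm x / 2)) y * g y) + \<rho> powr (2 * real m) * K)"
    using local_bound[OF m] unfolding n_def by blast
  obtain C2 where C2: "C2 \<ge> 0" "\<And>x. 0 < norm x \<Longrightarrow> norm x < 1 / 4 \<Longrightarrow>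
     integral\<^sup>L lborel (\<lambda>y. indicator (cball x (norm x / 2)) y * u y) \<le> C2 * (norm x)\<^sup>2"
    using u_mean_bound by blast
  \<comment> \<open>On the half-size ball around the maximum point u is at most 2^\<gamma> V, so its
    l-th power costs 2^(\<gamma> l).\<close>
  define Cg where "Cg = Cf * 2 powr (\<gamma> * l)"
  have Cg: "Cg > 0" using Cf(1) by (simp add: Cg_def)
  \<comment> \<open>Fixed by C1 \<tau>^(2m) Cg = 1/2, so that the nonlinear term equals V/2.\<close>
  define \<tau> where "\<tau> = (1 / (2 * C1 * Cg)) powr (1 / (2 * real m))"
  have \<tau>: "\<tau> > 0" "\<tau> powr (2 * real m) = 1 / (2 * C1 * Cg)"
    using C1(1) Cg nm by (auto simp: \<tau>_def powr_powr)
  define Q where "Q = 4 * C1 * \<tau> powr (2 * real m - n)"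
  have Q: "Q > 0" using C1(1) \<tau>(1) by (simp add: Q_def)
  define C where "C = 1 + (8 * \<tau>) powr \<gamma> + 4 * C1 * C2 * (3 / 4) powr (- (n - 2)) + Q powr b * (3 / 4) powr (- a)"
  have C: "C > 0" using C1 C2 Q \<tau> by (auto simp: C_def intro!: add_pos_nonneg)
  have "\<exists>R>0. \<forall>x. 0 < norm x \<longrightarrow> norm x < R \<longrightarrow>
     u x \<le> C * (norm x powr (- (n - 2)) + \<kappa> powr b * norm x powr (- a))" if \<kappa>: "0 < \<kappa>" for \<kappa>
  proof -
    obtain R1 where R1: "R1 > 0" "\<And>x. 0 < norm x \<Longrightarrow> norm x < R1 \<Longrightarrow>
     integral\<^sup>L lborel (\<lambda>y. indicator (cball x (norm x / 2)) y * g y) * ((norm x)\<^sup>2) ^ (m - 1) \<le> \<kappa>"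
      using g_annulus_small[OF \<kappa>] by blast
    \<comment> \<open>The maximum point satisfies |x| \<le> 5/4 |x0|; these margins keep it below
      both R1 and 1/4.\<close>
    define R where "R = min (R1 / 2) (1 / 8)"
    have R: "R > 0" using R1 by (simp add: R_def)
    have "u x0 \<le> C * (norm x0 powr (- (n - 2)) + \<kappa> powr b * norm x0 powr (- a))"
      if x0: "0 < norm x0" "norm x0 < R" for x0
    proof -
      define r0 where "r0 = norm x0"
      have r0: "0 < r0" "r0 < R1 / 2" "r0 < 1 / 8" using x0 by (auto simp: r0_def R_def)
      define X where "X = r0 powr (- (n - 2))"
      define Y where "Y = \<kappa> powr b * r0 powr (- a)"
      have XY: "X \<ge> 0" "Y \<ge> 0" by (auto simp: X_def Y_def)
      have X1: "X \<ge> 1" unfolding X_def using r0 nm powr_mono2'[of "- (n - 2)" r0 1] by simp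
      have CX: "X \<le> C * (X + Y)" "(8 * \<tau>) powr \<gamma> * X \<le> C * (X + Y)"
        "4 * C1 * C2 * (3 / 4) powr (- (n - 2)) * X \<le> C * (X + Y)"
        "Q powr b * (3 / 4) powr (- a) * Y \<le> C * (X + Y)"
      proof -
        have *: "k * Z \<le> C * (X + Y)" if "k \<le> C" "0 \<le> Z" "Z \<le> X + Y" for k Z
          using that C by (intro mult_mono) auto
        have "1 \<le> C" "(8 * \<tau>) powr \<gamma> \<le> C" "4 * C1 * C2 * (3 / 4) powr (- (n - 2)) \<le> C"
          "Q powr b * (3 / 4) powr (- a) \<le> C" using C1 C2 by (simp_all add: C_def add_increasing)
        from *[OF this(1), of X] *[OF this(2), of X] *[OF this(3), of X] *[OF this(4), of Y] XY
        show "X \<le> C * (X + Y)" "(8 * \<tau>) powr \<gamma> * X \<le> C * (X + Y)"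
          "4 * C1 * C2 * (3 / 4) powr (- (n - 2)) * X \<le> C * (X + Y)"
          "Q powr b * (3 / 4) powr (- a) * Y \<le> C * (X + Y)" by auto
      qed
      let ?B = "cball x0 (r0 / 4)"
      have nB: "3 / 4 * r0 \<le> norm y \<and> norm y \<le> 5 / 4 * r0" if "y \<in> ?B" for y
      proof -
        have "norm (x0 - y) \<le> r0 / 4" using that by (simp add: dist_norm)
        then show ?thesis using norm_triangle_ineq3[of x0 y] unfolding r0_def by linarith
      qed
      have B_sub: "?B \<subseteq> punctured"
      proof
        fix y assume "y \<in> ?B"
        from nB[OF this] r0 show "y \<in> punctured" by auto
      qed
      \<comment> \<open>The weight dd^\<gamma> vanishes on the boundary, so around an interior
        maximum point at distance d, halving the distance costs only the factor 2^\<gamma>: u is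
        controlled by its central value on a ball of radius d/2.\<close>
      define dd where "dd = (\<lambda>y. r0 / 4 - dist x0 y)"
      have dd0: "0 \<le> dd y" if "y \<in> ?B" for y using that by (simp add: dd_def)
      have cont: "continuous_on ?B (\<lambda>y. dd y powr \<gamma> * u y)"
      proof (intro continuous_on_mult continuous_on_powr' continuous_on_const continuous_on_subset[OF u_cont B_sub])
        show "continuous_on ?B dd" unfolding dd_def by (intro continuous_intros)
      qed (use dd0 \<gamma> in auto)
      have "?B \<noteq> {}" using r0 by simp
      then obtain x where x: "x \<in> ?B" "\<And>y. y \<in> ?B \<Longrightarrow> dd y powr \<gamma> * u y \<le> dd x powr \<gamma> * u x"
        using continuous_attains_sup[OF compact_cball _ cont] by blast
      define d where "d = dd x"
      define V where "V = u x"
      have d0: "0 \<le> d" "d \<le> r0 / 4" using dd0[OF x(1)] by (auto simp: d_def dd_def)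
      have main: "(r0 / 4) powr \<gamma> * u x0 \<le> d powr \<gamma> * V"
        using x(2)[of x0] r0 by (simp add: dd_def d_def V_def)
      have V0: "0 \<le> V" unfolding V_def by (intro u_nonneg subsetD[OF B_sub x(1)])
      have uV: "u x0 \<le> V"
      proof -
        have "d powr \<gamma> * V \<le> (r0 / 4) powr \<gamma> * V" using d0 \<gamma> V0 by (intro mult_right_mono powr_mono2) auto
        with main have "(r0 / 4) powr \<gamma> * u x0 \<le> (r0 / 4) powr \<gamma> * V" by linarith
        then show ?thesis using r0 by simp
      qed
      have "u x0 \<le> C * (X + Y)"
      proof (cases "V \<le> 1 \<or> d = 0")
        case True
        have "u x0 \<le> 1"
        proof (cases "d = 0")
          case 1: True
          then have "(r0 / 4) powr \<gamma> * u x0 \<le> 0" using main by simp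
          then show ?thesis using r0 by (simp add: mult_le_0_iff)
        qed (use True uV in auto)
        then show ?thesis using CX(1) X1 by linarith
      next
        case False
        then have V1: "V > 1" and d: "d > 0" using d0 by auto
        define r where "r = norm x"
        have r: "3 / 4 * r0 \<le> r" "r \<le> 5 / 4 * r0" using nB[OF x(1)] by (auto simp: r_def)
        have rb: "0 < r" "r < 1 / 4" "r < R1" using r r0 by auto
        have Kb: "g y \<le> Cg * V powr l" if "y \<in> cball x (d / 2)" for y
        proof -
          have dy: "dist x y \<le> d / 2" using that by simp
          have "dist x0 y \<le> dist x0 x + dist x y" by (rule dist_triangle)
          then have ddy: "d / 2 \<le> dd y" using dy by (simp add: d_def dd_def)
          then have yB: "y \<in> ?B" using d by (simp add: dd_def)
          have uy: "0 \<le> u y" by (intro u_nonneg subsetD[OF B_sub yB])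
          have "(d / 2) powr \<gamma> * u y \<le> dd y powr \<gamma> * u y"
            using ddy d \<gamma> uy by (intro mult_right_mono powr_mono2) auto
          also have "\<dots> \<le> d powr \<gamma> * V" using x(2)[OF yB] by (simp add: d_def V_def)
          also have "d powr \<gamma> = (d / 2) powr \<gamma> * 2 powr \<gamma>" using d by (simp add: powr_divide)
          finally have "(d / 2) powr \<gamma> * u y \<le> (d / 2) powr \<gamma> * (2 powr \<gamma> * V)" by simp
          then have "u y \<le> 2 powr \<gamma> * V" using d by simp
          moreover have "1 * 1 \<le> 2 powr \<gamma> * V" using V1 \<gamma> by (intro mult_mono) (auto intro: ge_one_powr_ge_zero)
          ultimately have "max 1 (u y) powr l \<le> (2 powr \<gamma> * V) powr l"
            using \<open>l - 1 > 0\<close> by (intro powr_mono2) auto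
          also have "\<dots> = 2 powr (\<gamma> * l) * V powr l" using V1 by (simp add: powr_mult powr_powr)
          finally have "Cf * max 1 (u y) powr l \<le> Cg * V powr l"
            using Cf(1) by (simp add: Cg_def mult.assoc)
          then show ?thesis using Cf(2)[OF subsetD[OF B_sub yB]] by linarith
        qed
        define \<rho> where "\<rho> = \<tau> * V powr (- (1 / \<gamma>))"
        have \<rho>: "\<rho> > 0" using \<tau> V1 by (simp add: \<rho>_def)
        show ?thesis
        proof (cases "\<rho> \<le> d / 2")
          \<comment> \<open>Now d is at most a multiple of V^(-1/\<gamma>), so the maximal value
            d^\<gamma> V is at most (2 \<tau>)^\<gamma>. Comparison with the centre x0 gives the
            rate r0^(-\<gamma>), which is at most r0^(-(n-2)) since r0 < 1.\<close>
          case False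
          then have "d \<le> 2 * \<tau> * V powr (- (1 / \<gamma>))" by (simp add: \<rho>_def)
          then have "d powr \<gamma> \<le> (2 * \<tau> * V powr (- (1 / \<gamma>))) powr \<gamma>" using d \<gamma> by (intro powr_mono2) auto
          also have "\<dots> = (2 * \<tau>) powr \<gamma> * V powr (- 1)"
            using \<tau> V1 \<gamma> by (simp add: powr_mult powr_powr)
          finally have "d powr \<gamma> * V \<le> (2 * \<tau>) powr \<gamma> * V powr (- 1) * V" using V0 by (rule mult_right_mono)
          also have "\<dots> = (2 * \<tau>) powr \<gamma>" using V1 by (simp add: powr_minus)
          also have "\<dots> = (r0 / 4) powr \<gamma> * ((8 * \<tau>) powr \<gamma> * r0 powr (- \<gamma>))"
          proof -
            have mult: "(p * (q * s)) powr \<gamma> = p powr \<gamma> * (q powr \<gamma> * s powr \<gamma>)"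
              if "0 < p" "0 < q" "0 < s" for p q s :: real using that by (simp add: powr_mult)
            have "2 * \<tau> = r0 / 4 * (8 * \<tau> * (1 / r0))" using r0 by simp
            then have "(2 * \<tau>) powr \<gamma> = (r0 / 4 * (8 * \<tau> * (1 / r0))) powr \<gamma>" by (rule arg_cong)
            also have "\<dots> = (r0 / 4) powr \<gamma> * ((8 * \<tau>) powr \<gamma> * (1 / r0) powr \<gamma>)"
              by (rule mult) (use r0 \<tau>(1) in auto)
            also have "(1 / r0) powr \<gamma> = r0 powr (- \<gamma>)"
              using r0 by (simp add: powr_divide powr_minus_divide)
            finally show ?thesis .
          qed
          finally have "(r0 / 4) powr \<gamma> * u x0 \<le> (r0 / 4) powr \<gamma> * ((8 * \<tau>) powr \<gamma> * r0 powr (- \<gamma>))"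
            using main by linarith
          then have "u x0 \<le> (8 * \<tau>) powr \<gamma> * r0 powr (- \<gamma>)" using r0 by simp
          also have "\<dots> \<le> (8 * \<tau>) powr \<gamma> * X"
            unfolding X_def using r0 \<gamma> by (intro mult_left_mono powr_mono') auto
          finally show ?thesis using CX(2) by linarith
        next
          case True
          have "u x \<le> C1 * (norm x powr (- n) *
              integral\<^sup>L lborel (\<lambda>y. indicator (cball x (norm x / 2)) y * u y) +
            \<rho> powr (2 * real m - n) *
              integral\<^sup>L lborel (\<lambda>y. indicator (cball x (norm x / 2)) y * g y) + \<rho> powr (2 * real m) * (Cg * V powr l))"
          proof (rule C1(2))
            show "\<forall>y\<in>cball x \<rho>. g y \<le> Cg * V powr l" using Kb True by auto
            show "\<rho> \<le> norm x / 2" using True d0 r r0 unfolding r_def by linarith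
          qed (use rb \<rho> Cg in \<open>auto simp: r_def\<close>)
          also have "\<dots> \<le> C1 * (C2 * r powr (- (n - 2)) + \<rho> powr (2 * real m - n) * (\<kappa> * r powr (- 2 * (real m - 1))) +
              \<rho> powr (2 * real m) * (Cg * V powr l))"
          proof (intro mult_left_mono add_mono order_refl)
            have "norm x powr (- n) * integral\<^sup>L lborel (\<lambda>y. indicator (cball x (norm x / 2)) y * u y) \<le> r powr (- n) * (C2 * r\<^sup>2)"
              using C2(2)[of x] rb unfolding r_def by (intro mult_left_mono) auto
            also have "r powr (- n) * (C2 * r\<^sup>2) = C2 * (r powr (- n) * r powr 2)" using rb by (simp add: powr_numeral)
            also have "r powr (- n) * r powr 2 = r powr (- (n - 2))" by (simp add: powr_add[symmetric])
            finally show "norm x powr (- n) * integral\<^sup>L lborel (\<lambda>y. indicator (cball x (norm x / 2)) y * u y) \<le> C2 * r powr (- (n - 2))" .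
            define I where "I = integral\<^sup>L lborel (\<lambda>y. indicator (cball x (norm x / 2)) y * g y)"
            have "(r\<^sup>2) ^ (m - 1) = r ^ (2 * (m - 1))" by (simp add: power_mult)
            also have "\<dots> = r powr (real (2 * (m - 1)))" using rb by (simp only: powr_realpow)
            also have "real (2 * (m - 1)) = 2 * (real m - 1)" using m_pos by (simp add: of_nat_diff)
            finally have "(r\<^sup>2) ^ (m - 1) = r powr (2 * (real m - 1))" .
            then have "I * r powr (2 * (real m - 1)) \<le> \<kappa>" using R1(2)[of x] rb unfolding I_def r_def by simp
            then have "I * r powr (2 * (real m - 1)) * r powr (- 2 * (real m - 1)) \<le> \<kappa> * r powr (- 2 * (real m - 1))"
              by (intro mult_right_mono) auto
            also have "I * r powr (2 * (real m - 1)) * r powr (- 2 * (real m - 1)) = I * (r powr (2 * (real m - 1)) * r powr (- 2 * (real m - 1)))" by simp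
            also have "r powr (2 * (real m - 1)) * r powr (- 2 * (real m - 1)) = 1" using rb by (simp add: powr_add[symmetric])
            finally show "I \<le> \<kappa> * r powr (- 2 * (real m - 1))" by simp
          qed (use C1(1) Cg in auto)
          also have "\<rho> powr (2 * real m) * (Cg * V powr l) = V / (2 * C1)"
          proof -
            have e: "- (1 / \<gamma>) * (2 * real m) + l = 1" using nm \<open>l - 1 > 0\<close> by (simp add: \<gamma>_def)
            have "\<rho> powr (2 * real m) = \<tau> powr (2 * real m) * V powr (- (1 / \<gamma>) * (2 * real m))"
              using \<tau>(1) V1 by (simp add: \<rho>_def powr_mult powr_powr)
            moreover have "V powr (- (1 / \<gamma>) * (2 * real m)) * V powr l = V"
              unfolding powr_add[symmetric] e using V1 by simp
            ultimately have "\<rho> powr (2 * real m) * (Cg * V powr l) = \<tau> powr (2 * real m) * Cg * V"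
              by (simp add: mult_ac)
            then show ?thesis using C1(1) Cg by (simp add: \<tau>(2))
          qed
          also have "\<rho> powr (2 * real m - n) = \<tau> powr (2 * real m - n) * V powr \<theta>"
          proof -
            have e: "- (1 / \<gamma>) * (2 * real m - n) = \<theta>" by (simp add: \<theta>_def divide_simps)
            show ?thesis using \<tau>(1) V1 e by (simp add: \<rho>_def powr_mult powr_powr)
          qed
          finally have "V \<le> C1 * (C2 * r powr (- (n - 2)) + \<tau> powr (2 * real m - n) * V powr \<theta> *
              (\<kappa> * r powr (- 2 * (real m - 1))) + V / (2 * C1))"
            by (simp add: V_def)
          also have "\<dots> = C1 * C2 * r powr (- (n - 2)) + C1 * \<tau> powr (2 * real m - n) * \<kappa> * r powr (- 2 * (real m - 1)) * V powr \<theta> + V / 2"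
            using C1(1) by (simp add: field_simps)
          finally have "V \<le> 2 * C1 * C2 * r powr (- (n - 2)) + (2 * C1 * \<tau> powr (2 * real m - n) * \<kappa> * r powr (- 2 * (real m - 1))) * V powr \<theta>"
            by (simp add: field_simps)
          from absorb_sublinear[OF _ \<theta>(1) _ this] V1 C1(1) \<kappa>
          have "V \<le> 2 * (2 * C1 * C2 * r powr (- (n - 2))) \<or>
              V \<le> (2 * (2 * C1 * \<tau> powr (2 * real m - n) * \<kappa> * r powr (- 2 * (real m - 1)))) powr b"
            by (simp add: \<theta>(2))
          then show ?thesis
          proof
            assume "V \<le> 2 * (2 * C1 * C2 * r powr (- (n - 2)))"
            also have "\<dots> \<le> 4 * C1 * C2 * ((3 / 4) powr (- (n - 2)) * X)"
              using powr_const_mono[of "3 / 4" r0 r "n - 2"] r r0 nm C1(1) C2(1) unfolding X_def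
              by (simp add: mult_left_mono)
            finally show ?thesis using CX(3) uV by (simp add: mult.assoc)
          next
            assume "V \<le> (2 * (2 * C1 * \<tau> powr (2 * real m - n) * \<kappa> * r powr (- 2 * (real m - 1)))) powr b"
            also have "\<dots> = (Q * \<kappa> * r powr (- 2 * (real m - 1))) powr b" by (simp add: Q_def mult_ac)
            also have "\<dots> = Q powr b * \<kappa> powr b * r powr (- 2 * (real m - 1) * b)"
              using Q \<kappa> rb by (simp add: powr_mult powr_powr)
            \<comment> \<open>Origin of the exponent a: the shell mass of g contributes r^(-2(m-1)),
              and absorption raises it to the power 1/(1 - \<theta>) = b.\<close>
            also have "- 2 * (real m - 1) * b = - a"
            proof -
              have "2 * (real m - 1) * b = a"
                unfolding ab times_divide_eq_right by (rule arg_cong[where f = "\<lambda>x. x / D"]) (simp add: algebra_simps)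
              then show ?thesis by (simp only: mult_minus_left)
            qed
            also have "Q powr b * \<kappa> powr b * r powr (- a) \<le> Q powr b * \<kappa> powr b * ((3 / 4) powr (- a) * r0 powr (- a))"
              using powr_const_mono[of "3 / 4" r0 r a] r r0 a0 by (intro mult_left_mono) auto
            also have "\<dots> = Q powr b * (3 / 4) powr (- a) * Y" by (simp add: Y_def mult_ac)
            finally show ?thesis using CX(4) uV by linarith
          qed
        qed
      qed
      then show ?thesis unfolding X_def Y_def r0_def .
    qed
    with R show ?thesis by blast
  qed
  with C show ?thesis by blast
qed

end

section \<open>From the pointwise bound to the two asymptotic statements\<close>

text \<open>Compactness handles bounded t and the asymptotic bound the rest. Since
  \<open>max 1 t\<close> is at least 1, the exponent may be raised from p to any larger l, which
  lets part (a) use the critical exponent.\<close>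

lemma growth_bound:
  fixes f :: "real \<Rightarrow> real"
  assumes "continuous_on {0..} f" "f \<in> O[at_top](\<lambda>t. t powr p)" "p \<le> l" "0 \<le> l"
  shows "\<exists>C>0. \<forall>t\<ge>0. f t \<le> C * max 1 t powr l"
proof -
  obtain c where c: "c > 0" "eventually (\<lambda>t. norm (f t) \<le> c * norm (t powr p)) at_top"
    using assms(2) by (rule landau_o.bigE)
  then obtain N where N: "\<And>t. t \<ge> N \<Longrightarrow> \<bar>f t\<bar> \<le> c * t powr p"
    by (auto simp: eventually_at_top_linorder)
  define M where "M = max N 1"
  have "bounded (f ` {0..M})"
    by (intro compact_imp_bounded compact_continuous_image continuous_on_subset[OF assms(1)]) auto
  then obtain B where B: "B > 0" "\<And>t. t \<in> {0..M} \<Longrightarrow> \<bar>f t\<bar> \<le> B"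
    unfolding bounded_pos by auto
  have "f t \<le> (B + c) * max 1 t powr l" if "t \<ge> 0" for t
  proof (cases "t \<le> M")
    case True
    have "f t \<le> B * 1" using B(2)[of t] True that by simp
    also have "\<dots> \<le> (B + c) * max 1 t powr l"
      by (intro mult_mono) (use B(1) c(1) assms(4) in \<open>auto intro: ge_one_powr_ge_zero\<close>)
    finally show ?thesis .
  next
    case False
    have "N \<le> t" using False by (simp add: M_def)
    from N[OF this] have "f t \<le> c * t powr p" by linarith
    also have "\<dots> \<le> (B + c) * max 1 t powr l"
      by (intro mult_mono) (use B(1) c(1) assms(3) False in \<open>auto simp: M_def intro: powr_mono\<close>)
    finally show ?thesis .
  qed
  then show ?thesis using B(1) c(1) by (intro exI[of _ "B + c"]) auto
qed

theorem theorem1p4: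
  fixes u :: "real^'n::finite \<Rightarrow> real"
    and f :: "real \<Rightarrow> real"
    and m :: nat
    and lam :: real
  defines "n \<equiv> CARD('n)"
  assumes m_odd: "odd m" and m_ge: "m \<ge> 3" and n_gt: "2 * m < n"
    and f_cont: "continuous_on {0..} f"
    and f_nonneg: "\<forall>t\<ge>0. f t \<ge> 0"
    and f_growth: "f \<in> O[at_top](\<lambda>t. t powr lam)"
    and u_smooth: "Ck_on (2 * m) (ball 0 2 - {0}) u"
    and u_nonneg: "\<forall>x\<in>ball 0 2 - {0}. u x \<ge> 0"
    and u_ineq: "\<forall>x\<in>ball 0 2 - {0}.
                   0 \<le> - iter_laplacian m u x \<and> - iter_laplacian m u x \<le> f (u x)"
  shows "(0 \<le> lam \<and> lam \<le> (2 * real m + real n - 2) / (real n - 2)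
            \<longrightarrow> u \<in> O[at 0](\<lambda>x. norm x powr (- (real n - 2))))
       \<and> ((2 * real m + real n - 2) / (real n - 2) < lam \<and> lam < real n / (real n - 2 * real m)
            \<longrightarrow> u \<in> o[at 0](\<lambda>x. norm x powr
                   (- (4 * real m * (real m - 1) / (real n - lam * (real n - 2 * real m))))))"
  proof -
  define N where "N = real n"
  have N: "N = real CARD('n)" by (simp add: N_def n_def)
  have "real (2 * m) < real n" using n_gt by (simp only: of_nat_less_iff)
  then have nm: "N - 2 * real m > 0" by (simp add: N_def)
  have m3: "real m \<ge> 3" using m_ge by simp
  interpret polyharmonic_inequality u m
  proof
    show "2 * m < CARD('n)" "4 \<le> CARD('n)" using n_gt m_ge by (simp_all add: n_def)
    show "0 \<le> - iter_laplacian m u x" if "x \<in> ball 0 2 - {0}" for x using u_ineq that by blast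
    show "0 \<le> u x" if "x \<in> ball 0 2 - {0}" for x using u_nonneg that by blast
  qed (use m_ge u_smooth in auto)
  have key: "\<exists>C>0. \<forall>\<kappa>. 0 < \<kappa> \<longrightarrow> (\<exists>R>0. \<forall>x. 0 < norm x \<longrightarrow> norm x < R \<longrightarrow>
     u x \<le> C * (norm x powr (- (N - 2)) + \<kappa> powr (2 * real m / (N - l * (N - 2 * real m))) *
       norm x powr (- (4 * real m * (real m - 1) / (N - l * (N - 2 * real m))))))"
    if l: "(2 * real m + N - 2) / (N - 2) \<le> l" "l < N / (N - 2 * real m)" "lam \<le> l" for l
  proof -
    have "0 \<le> (2 * real m + N - 2) / (N - 2)" using nm m3 by (intro divide_nonneg_nonneg) auto
    then have "0 \<le> l" using l(1) by linarith
    from growth_bound[OF f_cont f_growth l(3) this] obtain Cf where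
      Cf: "Cf > 0" "\<And>t. t \<ge> 0 \<Longrightarrow> f t \<le> Cf * max 1 t powr l" by blast
    have "g x \<le> Cf * max 1 (u x) powr l" if x: "x \<in> ball 0 2 - {0}" for x
    proof -
      have "g x \<le> f (u x)" "0 \<le> u x" using u_ineq u_nonneg x by (auto simp: g_def)
      with Cf(2)[of "u x"] show ?thesis by linarith
    qed
    from pointwise_bound[OF m_odd l(1,2)[unfolded N] Cf(1) this] show ?thesis unfolding N .
  qed
  have ev: "eventually P (at 0)" if "R > 0" "\<And>x. 0 < norm x \<Longrightarrow> norm x < R \<Longrightarrow> P x"
    for P :: "real^'n \<Rightarrow> bool" and R
    unfolding eventually_at using that by (intro exI[of _ R]) auto
  have un: "0 \<le> u x" if "0 < norm x" "norm x < 2" for x using u_nonneg that by auto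
  \<comment> \<open>Part (a) only uses the growth bound with the critical exponent \<open>lc\<close>, for which the exponent of
    part (b) equals n - 2.\<close>
  define lc where "lc = (2 * real m + N - 2) / (N - 2)"
  have alg: "(2 * real m + N - 2) * (N - 2 * real m) = N * (N - 2) - 4 * real m * (real m - 1)"
    by (simp add: algebra_simps)
  have mm: "4 * real m * (real m - 1) > 0" using m3 by simp
  have N2: "N - 2 > 0" using nm m3 by linarith
  have lc_eq: "N - lc * (N - 2 * real m) = 4 * real m * (real m - 1) / (N - 2)"
  proof -
    have "lc * (N - 2 * real m) = (N * (N - 2) - 4 * real m * (real m - 1)) / (N - 2)"
      unfolding lc_def times_divide_eq_left alg ..
    also have "\<dots> = N - 4 * real m * (real m - 1) / (N - 2)"
      using N2 by (simp add: diff_divide_distrib)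
    finally show ?thesis by simp
  qed
  have "lc * (N - 2 * real m) < N" using lc_eq mm N2 divide_pos_pos[OF mm N2] by linarith
  then have lc_lt: "lc < N / (N - 2 * real m)" using nm by (simp add: pos_less_divide_eq)
  have partA: "u \<in> O[at 0](\<lambda>x. norm x powr (- (N - 2)))" if lamA: "lam \<le> lc"
  proof -
    have ex: "4 * real m * (real m - 1) / (N - lc * (N - 2 * real m)) = N - 2"
      unfolding lc_eq using mm N2 m3 by (auto simp: field_simps)
    obtain C R where CR: "C > 0" "R > 0" "\<And>x. 0 < norm x \<Longrightarrow> norm x < R \<Longrightarrow>
        u x \<le> C * (norm x powr (- (N - 2)) + norm x powr (- (N - 2)))"
    proof -
      from key[OF order_refl[of lc, unfolded lc_def] lc_lt[unfolded lc_def] lamA[unfolded lc_def],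
          folded lc_def, unfolded ex]
      obtain C where C: "C > 0" "\<And>\<kappa>. 0 < \<kappa> \<Longrightarrow> \<exists>R>0. \<forall>x. 0 < norm x \<longrightarrow> norm x < R \<longrightarrow>
          u x \<le> C * (norm x powr (- (N - 2)) + \<kappa> powr (2 * real m / (N - lc * (N - 2 * real m))) *
            norm x powr (- (N - 2)))" by blast
      \<comment> \<open>At the critical exponent both terms have the same rate, and a fixed \<kappa>
        suffices for a big O.\<close>
      from C(2)[of 1] obtain R where "R > 0" "\<And>x. 0 < norm x \<Longrightarrow> norm x < R \<Longrightarrow>
          u x \<le> C * (norm x powr (- (N - 2)) + norm x powr (- (N - 2)))" by auto
      with C(1) show thesis by (rule that)
    qed
    show ?thesis
    proof (rule landau_o.bigI[of "2 * C"])
      show "eventually (\<lambda>x. norm (u x) \<le> 2 * C * norm (norm x powr (- (N - 2)))) (at 0)"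
      proof (rule ev[of "min R 2"])
        fix x :: "real^'n" assume "0 < norm x" "norm x < min R 2"
        then show "norm (u x) \<le> 2 * C * norm (norm x powr (- (N - 2)))" using CR(3)[of x] un[of x] by simp
      qed (use CR in simp)
    qed (use CR in simp)
  qed
  have partB: "u \<in> o[at 0](\<lambda>x. norm x powr (- (4 * real m * (real m - 1) / (N - lam * (N - 2 * real m)))))"
    if lam: "lc < lam" "lam < N / (N - 2 * real m)"
  proof -
    define D where "D = N - lam * (N - 2 * real m)"
    have D: "D > 0" using lam(2) nm by (simp add: D_def pos_less_divide_eq)
    define a where "a = 4 * real m * (real m - 1) / D"
    define b where "b = 2 * real m / D"
    have b: "b > 0" using D m3 by (simp add: b_def)
    have "lc * (N - 2 * real m) < lam * (N - 2 * real m)" using lam(1) nm by (rule mult_strict_right_mono)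
    then have "D < 4 * real m * (real m - 1) / (N - 2)" using lc_eq by (simp add: D_def)
    then have an: "N - 2 < a" using D N2 by (simp add: a_def field_simps)
    from key[OF less_imp_le[OF lam(1)[unfolded lc_def]] lam(2) order_refl, folded D_def, folded a_def b_def]
    obtain C where C: "C > 0" "\<And>\<kappa>. 0 < \<kappa> \<Longrightarrow> \<exists>R>0. \<forall>x. 0 < norm x \<longrightarrow> norm x < R \<longrightarrow>
        u x \<le> C * (norm x powr (- (N - 2)) + \<kappa> powr b * norm x powr (- a))" by blast
    show ?thesis unfolding D_def[symmetric] a_def[symmetric]
    proof (rule landau_o.smallI)
      fix c :: real assume c: "c > 0"
      \<comment> \<open>Makes C \<kappa>^b equal to c/2, half of the allowed constant.\<close>
      define \<kappa> where "\<kappa> = (c / (2 * C)) powr (1 / b)"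
      have k: "\<kappa> > 0" "\<kappa> powr b = c / (2 * C)" using c C(1) b by (auto simp: \<kappa>_def powr_powr)
      obtain R where R: "R > 0" "\<And>x. 0 < norm x \<Longrightarrow> norm x < R \<Longrightarrow>
          u x \<le> C * (norm x powr (- (N - 2)) + \<kappa> powr b * norm x powr (- a))"
        using C(2)[OF k(1)] by blast
      \<comment> \<open>Since a > N - 2, the term |x|^(-(N-2)) is of lower order; inside radius R'
        it uses at most the other half c/2.\<close>
      define R' where "R' = (c / (2 * C)) powr (1 / (a - (N - 2)))"
      have R': "R' > 0" "R' powr (a - (N - 2)) = c / (2 * C)" using c C(1) an by (auto simp: R'_def powr_powr)
      show "eventually (\<lambda>x. norm (u x) \<le> c * norm (norm x powr (- a))) (at 0)"
      proof (rule ev[of "min (min R R') 2"])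
        fix x :: "real^'n" assume x: "0 < norm x" "norm x < min (min R R') 2"
        have "norm x powr (- (N - 2)) = norm x powr (a - (N - 2)) * norm x powr (- a)"
          by (simp add: powr_add[symmetric])
        also have "\<dots> \<le> R' powr (a - (N - 2)) * norm x powr (- a)"
          using x an by (intro mult_right_mono powr_mono2) auto
        finally have "norm x powr (- (N - 2)) \<le> c / (2 * C) * norm x powr (- a)" unfolding R'(2) .
        then have "C * (norm x powr (- (N - 2)) + \<kappa> powr b * norm x powr (- a)) \<le>
            C * (c / (2 * C) * norm x powr (- a) + c / (2 * C) * norm x powr (- a))"
          unfolding k(2) using C(1) c by (intro mult_left_mono add_mono) auto
        also have "\<dots> = c * norm x powr (- a)" using C(1) by (simp add: field_simps)
        finally show "norm (u x) \<le> c * norm (norm x powr (- a))"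
          using R(2)[of x] un[of x] x by simp
      qed (use R(1) R'(1) in simp)
    qed
  qed
  show ?thesis
    using partA partB unfolding lc_def N_def by blast
qed

end
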